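(* Let $d,n\ge 1$ be integers and, for $j\in\{1,\dots,d\}$ and $U\in\mathbb{R}^n$, let $A_j(U)$ be a real symmetric $n\times n$ matrix whose entries are polynomial functions of $U$. Write $A_j^0:=A_j(0)$ and $A_j^1(U):=A_j(U)-A_j^0$. For $N\in\mathbb{N}$ let $(\mathrm{H}_N)$ be either one of the two problems (the same one for all $N$) $$\partial_t U_N+\mathsf{S}_N\Big(\sum_{j=1}^d A_j(U_N)\partial_{x_j}U_N\Big)=0,\qquad U_N|_{t=0}=\mathsf{P}_N U^0,$$ or $$\partial_t U_N+\sum_{j=1}^d \Big(A_j^0\partial_{x_j}U_N+\mathsf{S}_N\big(A_j^1(U_N)\partial_{x_j}U_N\big)\Big)=0,\qquad U_N|_{t=0}=\mathsf{P}_N U^0.$$ Let $s>d/2+1$ and $M>0$. There exist $C>0$ and $T>0$, depending only on $s$ and $M$, such that for every $N\in\mathbb{N}$ and every $U^0\in H^s((2\pi\mathbb{T})^d)^n$ with $|U^0|_{H^s}\le M$, there exists a unique maximal-in-time classical solution $U_N\in\mathcal{C}(I_N;H^s((2\pi\mathbb{T})^d)^n)$ to $(\mathrm{H}_N)$. The open time interval $I_N$ satisfies $I_N\supset[0,T/|U^0|_{H^s}]$ and for all $0\le t\le T/|U^0|_{H^s}$, $$|U_N(t,\cdot)|_{H^s}\le |U^0|_{H^s}\exp(C|U^0|_{H^s}t)\le 2|U^0|_{H^s}.$$ Moreover, for any $s'\ge s$, one has $U_N\in\mathcal{C}^1(I_N;H^{s'}((2\pi\mathbb{T})^d)^n)$,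 and for any $0<T^*\in I_N$ and $M^*>0$ such that $\sup_{t\in[0,T^*]}|U_N(t,\cdot)|_{H^s}\le M^*$, there exists $C^*>0$ depending only on $s$, $s'$ and $M^*$ such that for all $0\le t\le T^*$, $$|U_N(t,\cdot)|_{H^{s'}}\le |U^0|_{H^{s'}}\exp(C^*M^*t).$$
   Context: $(2\pi\mathbb{T})^d$ is the torus of period $2\pi$ in each of the $d$ variables; functions on it are real-valued. For real $s\ge0$, $H^s((2\pi\mathbb{T})^d)^n$ is the space of $U\in L^2((2\pi\mathbb{T})^d)^n$ with $|U|_{H^s}^2=\sum_{k\in\mathbb{Z}^d}\langle k\rangle^{2s}|\widehat U_k|^2<\infty$, where $\widehat U_k$ is the $k$-th Fourier coefficient and $\langle k\rangle=(1+|k|^2)^{1/2}$; $|U^0|_{H^{s'}}=+\infty$ if $U^0\notin H^{s'}$. $\mathcal{C}(I;X)$, $\mathcal{C}^1(I;X)$ denote continuous, resp. continuously differentiable, functions on the interval $I$ with values in the Banach space $X$. $\mathbb{N}$ denotes the positive integers. $\mathsf{P}_N$ (sharp low-pass filter) acts componentwise as the Fourier multiplier with symbol $\mathbf{1}_{\{-N,\dots,N\}^d}$. $\mathsf{S}_N$ (smooth low-pass filter) acts componentwise as the Fourier multiplier with symbol $k\mapsto\chi(k/N)$, where $\chi:\mathbb{R}^d\to[0,1]$ is a fixed even function with $\chi(k)=1$ if $\max_j|k_j|\le1/2$, $\chi(k)=0$ if $\max_j|k_j|\ge1$, and $\chi^{1/2}$ Lipschitz continuous. A maximal-in-time classical solution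 in $\mathcal{C}(I;H^s)$ is a solution on an open interval $I\ni0$ which cannot be extended to a solution in the same class on a strictly larger interval. If $U^0=0$, $[0,T/|U^0|_{H^s}]$ is read as $[0,\infty)$. Constants said to depend "only" on certain quantities may also depend on the fixed data $d,n,\chi,A_1,\dots,A_d$, but never on $N$. *)

theory Defs
  imports "HOL-Analysis.Analysis"
begin

text \<open>
  Functions on the torus of period \<open>2\<pi>\<close> are represented by periodic functions on \<open>real ^ 'd\<close>; the
  frequencies are the elements of \<open>int ^ 'd\<close>. An element of \<open>L\<^sup>2\<close> or \<open>H\<^sup>s\<close> is given by any of its
  representatives; Fourier coefficients, norms and filters depend only on the class.
\<close>

definition freq :: "int ^ 'd \<Rightarrow> real ^ 'd" where
  "freq k = (\<chi> j. real_of_int (k $ j))"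

definition bracket :: "int ^ 'd \<Rightarrow> real" where
  "bracket k = sqrt (1 + (norm (freq k))\<^sup>2)"

definition period_cell :: "(real ^ 'd) set" where
  "period_cell = cbox 0 (\<chi> j. 2 * pi)"

definition L2_torus :: "(real ^ 'd \<Rightarrow> real ^ 'n) set" where
  "L2_torus = {f. (\<forall>x j. f (x + axis j (2 * pi)) = f x) \<and> f \<in> borel_measurable lebesgue \<and>
     set_integrable lebesgue period_cell (\<lambda>x. (norm (f x))\<^sup>2)}"

definition fourier_coeff :: "(real ^ 'd \<Rightarrow> real ^ 'n) \<Rightarrow> int ^ 'd \<Rightarrow> complex ^ 'n" where
  "fourier_coeff f k = (\<chi> i. complex_of_real (1 / (2 * pi) ^ CARD('d)) *
     (LINT x:period_cell|lebesgue. complex_of_real (f x $ i) * cis (- (freq k \<bullet> x))))"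

definition Hs :: "real \<Rightarrow> (real ^ 'd \<Rightarrow> real ^ 'n) set" where
  "Hs s = {f \<in> L2_torus.
     (\<lambda>k. bracket k powr (2 * s) * (norm (fourier_coeff f k))\<^sup>2) summable_on UNIV}"

text \<open>The real-valued norm is meaningful on \<open>Hs s\<close> only; the extended one is \<open>\<infinity>\<close> off \<open>Hs s\<close>.\<close>

definition Hs_norm :: "real \<Rightarrow> (real ^ 'd \<Rightarrow> real ^ 'n) \<Rightarrow> real" where
  "Hs_norm s f = sqrt (\<Sum>\<^sub>\<infinity>k. bracket k powr (2 * s) * (norm (fourier_coeff f k))\<^sup>2)"

definition Hs_enorm :: "real \<Rightarrow> (real ^ 'd \<Rightarrow> real ^ 'n) \<Rightarrow> ennreal" where
  "Hs_enorm s f = (if f \<in> Hs s then ennreal (Hs_norm s f) else \<infinity>)"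

definition C0_Hs :: "real \<Rightarrow> real set \<Rightarrow> (real \<Rightarrow> real ^ 'd \<Rightarrow> real ^ 'n) \<Rightarrow> bool" where
  "C0_Hs s I U \<longleftrightarrow> (\<forall>t\<in>I. U t \<in> Hs s) \<and>
     (\<forall>t\<in>I. ((\<lambda>\<tau>. Hs_norm s (\<lambda>x. U \<tau> x - U t x)) \<longlongrightarrow> 0) (at t within I))"

text \<open>Used for open \<open>I\<close> only, so that \<open>U (t + h)\<close> lies in \<open>Hs s\<close> for small \<open>h\<close>.\<close>

definition C1_Hs :: "real \<Rightarrow> real set \<Rightarrow> (real \<Rightarrow> real ^ 'd \<Rightarrow> real ^ 'n) \<Rightarrow> bool" where
  "C1_Hs s I U \<longleftrightarrow> C0_Hs s I U \<and>
     (\<exists>V. C0_Hs s I V \<and>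
       (\<forall>t\<in>I. ((\<lambda>h. Hs_norm s (\<lambda>x. (1 / h) *\<^sub>R (U (t + h) x - U t x) - V t x)) \<longlongrightarrow> 0) (at 0)))"

text \<open>
  The symbols used below are even and finitely supported: the infinite sum is a finite one, and its
  value is real, so that taking the real part only changes the type.
\<close>

definition fourier_multiplier ::
    "(int ^ 'd \<Rightarrow> real) \<Rightarrow> (real ^ 'd \<Rightarrow> real ^ 'n) \<Rightarrow> real ^ 'd \<Rightarrow> real ^ 'n" where
  "fourier_multiplier m f x =
     (\<chi> i. Re (\<Sum>\<^sub>\<infinity>k. complex_of_real (m k) * (fourier_coeff f k $ i) * cis (freq k \<bullet> x)))"

definition sharp_filter :: "nat \<Rightarrow> (real ^ 'd \<Rightarrow> real ^ 'n) \<Rightarrow> real ^ 'd \<Rightarrow> real ^ 'n" where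
  "sharp_filter N = fourier_multiplier (indicator {k. \<forall>j. k $ j \<in> {- int N..int N}})"

definition smooth_filter ::
    "(real ^ 'd \<Rightarrow> real) \<Rightarrow> nat \<Rightarrow> (real ^ 'd \<Rightarrow> real ^ 'n) \<Rightarrow> real ^ 'd \<Rightarrow> real ^ 'n" where
  "smooth_filter chi N = fourier_multiplier (\<lambda>k. chi ((1 / real N) *\<^sub>R freq k))"

definition admissible_cutoff :: "(real ^ 'd \<Rightarrow> real) \<Rightarrow> bool" where
  "admissible_cutoff chi \<longleftrightarrow>
     (\<forall>x. chi x \<in> {0..1}) \<and> (\<forall>x. chi (- x) = chi x) \<and>
     (\<forall>x. infnorm x \<le> 1 / 2 \<longrightarrow> chi x = 1) \<and> (\<forall>x. infnorm x \<ge> 1 \<longrightarrow> chi x = 0) \<and>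
     (\<exists>L. L-lipschitz_on UNIV (\<lambda>x. sqrt (chi x)))"

definition partial_x :: "'d \<Rightarrow> (real ^ 'd \<Rightarrow> real ^ 'n) \<Rightarrow> real ^ 'd \<Rightarrow> real ^ 'n" where
  "partial_x j f x = frechet_derivative f (at x) (axis j 1)"

text \<open>The spatial operators \<open>F\<^sub>N\<close> of the two problems, both written \<open>\<partial>\<^sub>t U + F\<^sub>N(U) = 0\<close>.\<close>

definition filtered_full ::
    "(real ^ 'd \<Rightarrow> real) \<Rightarrow> ('d \<Rightarrow> real ^ 'n \<Rightarrow> real ^ 'n ^ 'n) \<Rightarrow>
     nat \<Rightarrow> (real ^ 'd \<Rightarrow> real ^ 'n) \<Rightarrow> real ^ 'd \<Rightarrow> real ^ 'n" where
  "filtered_full chi A N V =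
     smooth_filter chi N (\<lambda>x. \<Sum>j\<in>UNIV. A j (V x) *v partial_x j V x)"

definition filtered_nonlinear ::
    "(real ^ 'd \<Rightarrow> real) \<Rightarrow> ('d \<Rightarrow> real ^ 'n \<Rightarrow> real ^ 'n ^ 'n) \<Rightarrow>
     nat \<Rightarrow> (real ^ 'd \<Rightarrow> real ^ 'n) \<Rightarrow> real ^ 'd \<Rightarrow> real ^ 'n" where
  "filtered_nonlinear chi A N V = (\<lambda>x. \<Sum>j\<in>UNIV. A j 0 *v partial_x j V x +
     smooth_filter chi N (\<lambda>y. (A j (V y) - A j 0) *v partial_x j V y) x)"

text \<open>
  Classical means that the derivatives exist, and the equation holds, at every point. For \<open>s > d/2 + 1\<close>,
  differentiability of \<open>U t\<close> selects the continuously differentiable representative of the class, and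
  the right-hand side is jointly continuous in time and space, so \<open>U\<close> is then of class \<open>C\<^sup>1\<close>
  in \<open>(t, x)\<close>. Values of \<open>U\<close> outside \<open>I\<close> are irrelevant.
\<close>

definition classical_solution ::
    "((real ^ 'd \<Rightarrow> real ^ 'n) \<Rightarrow> real ^ 'd \<Rightarrow> real ^ 'n) \<Rightarrow> (real ^ 'd \<Rightarrow> real ^ 'n) \<Rightarrow>
     real \<Rightarrow> real set \<Rightarrow> (real \<Rightarrow> real ^ 'd \<Rightarrow> real ^ 'n) \<Rightarrow> bool" where
  "classical_solution F u0 s I U \<longleftrightarrow>
     open I \<and> is_interval I \<and> 0 \<in> I \<and> C0_Hs s I U \<and> U 0 = u0 \<and>
     (\<forall>t\<in>I. \<forall>x. U t differentiable (at x) \<and>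
        ((\<lambda>\<tau>. U \<tau> x) has_vector_derivative - F (U t) x) (at t))"

definition maximal_solution ::
    "((real ^ 'd \<Rightarrow> real ^ 'n) \<Rightarrow> real ^ 'd \<Rightarrow> real ^ 'n) \<Rightarrow> (real ^ 'd \<Rightarrow> real ^ 'n) \<Rightarrow>
     real \<Rightarrow> real set \<Rightarrow> (real \<Rightarrow> real ^ 'd \<Rightarrow> real ^ 'n) \<Rightarrow> bool" where
  "maximal_solution F u0 s I U \<longleftrightarrow> classical_solution F u0 s I U \<and>
     \<not> (\<exists>J V. I \<subset> J \<and> classical_solution F u0 s J V \<and> (\<forall>t\<in>I. V t = U t))"

text \<open>The interval \<open>[0, T / r]\<close>, read as \<open>[0, \<infinity>)\<close> if \<open>r = 0\<close>.\<close>

definition time_interval :: "real \<Rightarrow> real \<Rightarrow> real set" where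
  "time_interval T r = (if r = 0 then {0..} else {0..T / r})"

end

theory Submission imports Defs begin

text \<open>
  The problem is a system of ordinary differential equations in disguise. Both choices of
  \<open>(H\<^sub>N)\<close> have the form \<open>\<partial>\<^sub>t U + \<Sum>\<^sub>j P\<^sub>j \<partial>\<^sub>j U + S\<^sub>N (\<Sum>\<^sub>j Q\<^sub>j(U) \<partial>\<^sub>j U) = 0\<close> with constant
  symmetric \<open>P\<^sub>j\<close> and polynomial symmetric \<open>Q\<^sub>j\<close>: take \<open>P = 0\<close>, \<open>Q = A\<close> for the first one and
  \<open>P = A(0)\<close>, \<open>Q = A - A(0)\<close> for the second one. Outside the band \<open>{-N..N}\<^sup>d\<close> the symbol of
  \<open>S\<^sub>N\<close> vanishes, so each Fourier coefficient of a classical solution obeys a linear equation with a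
  skew-adjoint matrix there; its modulus is conserved, and it is zero initially. Hence a
  classical solution is a trigonometric polynomial with frequencies in the band
  (\<open>classical_band_limited\<close>), and its coefficients solve a finite system with a locally Lipschitz
  right-hand side (\<open>classical_coefficient_ode\<close>, \<open>field_lipschitz\<close>). Conversely, solutions of the
  finite system give classical solutions (\<open>classical_from_coefficients\<close>). This settles uniqueness by
  Gronwall's inequality, the regularity \<open>C\<^sup>1\<close> with values in every \<open>H\<^bsup>s'\<^esup>\<close>, and local existence. The
  maximal solution is the union of all classical solutions (\<open>maximal_solution_exists\<close>).
  
  What remains is an estimate that is uniform in \<open>N\<close>. Put \<open>m\<^sub>k = \<langle>k\<rangle>\<^sup>\<sigma> \<chi>(k/N)\<^bsup>1/2\<^esup>\<close>. The derivative of
  \<open>|U|\<^sup>2\<close> in \<open>H\<^sup>\<sigma>\<close> is minus twice the real part of the inner product of \<open>m\<^sub>k U\<^sub>k\<close> with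
  \<open>m\<^sub>k\<close> times the \<open>k\<close>-th coefficient of \<open>\<Sum>\<^sub>j Q\<^sub>j(U) \<partial>\<^sub>j U\<close>, because constant symmetric matrices drop out
  (\<open>inner_skew\<close>). Moving the second factor \<open>m\<^sub>k\<close> onto \<open>\<partial>\<^sub>j U\<close> leaves a quadratic form in the
  coefficients \<open>m\<^sub>k U\<^sub>k\<close>, in which the symmetry of \<open>Q\<^sub>j\<close> moves the derivative onto \<open>Q\<^sub>j(U)\<close>
  (\<open>leading_term_bound\<close>), and a commutator with kernel \<open>m\<^sub>k - m\<^sub>l\<close>. The commutator does not
  lose a derivative: since \<open>\<chi>\<^bsup>1/2\<^esup>\<close> is Lipschitz, its oscillation between \<open>k\<close> and \<open>l\<close> is at most a
  multiple of \<open>|k - l|/N\<close>, and the factor \<open>\<langle>l\<rangle>\<close> from \<open>\<partial>\<^sub>j\<close> is at most a multiple of \<open>N\<close> on the band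
  (\<open>symbol_commutator\<close>). Young's inequality for convolutions and tame estimates for polynomials of
  \<open>U\<close> (\<open>coeffs_of_polynomial\<close>) then give \<open>d/dt |U|\<^sup>2 \<le> c w(U) |U|\<^sup>2\<close> in \<open>H\<^sup>\<sigma>\<close>, where
  \<open>w(U) = \<Sum>\<^sub>k \<langle>k\<rangle> |U\<^sub>k|\<close> is controlled by the norm in \<open>H\<^sup>s\<close> for \<open>s > d/2 + 1\<close> (\<open>energy_estimate\<close>,
  \<open>sobolev_growth\<close>). With \<open>\<sigma> = s'\<close> this is the last assertion. With \<open>\<sigma> = s\<close> a continuity argument keeps
  \<open>|U|\<close> below \<open>2 |U\<^sup>0|\<close> up to time \<open>T / |U\<^sup>0|\<close>, where \<open>C = 2 \<kappa>\<close> for the constant \<open>\<kappa>\<close> of the growth bound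
  while \<open>|U| \<le> 2 M\<close>, and \<open>T = ln (3/2) / (2 \<kappa>)\<close> (\<open>controlled_solution\<close>).
\<close>

section \<open>Exponentials\<close>

definition expi :: "int ^ 'd \<Rightarrow> real ^ 'd \<Rightarrow> complex" where
  "expi k x = cis (freq k \<bullet> x)"

lemma freq_simps [simp]:
  "freq 0 = 0" "freq (k + l) = freq k + freq l" "freq (k - l) = freq k - freq l" "freq (- k) = - freq k"
  by (auto simp: freq_def vec_eq_iff)

lemma freq_nth [simp]: "freq k $ j = real_of_int (k $ j)"
  by (simp add: freq_def)

lemma expi_zero [simp]: "expi 0 x = 1"
  and expi_add: "expi (k + l) x = expi k x * expi l x"
  and expi_minus: "expi (- k) x = cnj (expi k x)"
  and norm_expi [simp]: "cmod (expi k x) = 1"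
  by (simp_all add: expi_def inner_add_left cis_mult cis_cnj)

lemma continuous_on_expi [continuous_intros]: "continuous_on S (expi k)"
  unfolding expi_def by (intro continuous_intros)

lemma expi_periodic [simp]: "expi k (x + axis j (2 * pi)) = expi k x"
proof -
  have "cis (2 * pi * real_of_int (k $ j)) = 1"
    by (simp add: cis.ctr complex_eq_iff sin_times_pi_eq_0 cos_one_2pi_int)
  then show ?thesis
    by (simp add: expi_def inner_add_right inner_axis mult.commute flip: cis_mult)
qed

section \<open>Fourier coefficients\<close>

text \<open>
  Products with exponentials and with other coefficients are not real, so the calculus of Fourier
  coefficients is developed for complex scalar functions; \<open>fourier_coeff_nth\<close> transfers it to the
  components of real vector fields.
\<close>

definition cfc :: "(real ^ 'd \<Rightarrow> complex) \<Rightarrow> int ^ 'd \<Rightarrow> complex" where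
  "cfc h k = complex_of_real (1 / (2 * pi) ^ CARD('d)) *
     (LINT x:period_cell|lebesgue. h x * cis (- (freq k \<bullet> x)))"

lemma fourier_coeff_nth: "fourier_coeff f k $ i = cfc (\<lambda>x. complex_of_real (f x $ i)) k"
  by (simp add: fourier_coeff_def cfc_def)

text \<open>
  Continuous functions are Borel measurable, so their integrals over the cell agree for
  \<open>lebesgue\<close> and \<open>lborel\<close>. Product measures and dominated convergence are then applied with \<open>lborel\<close>.
\<close>

lemma set_integrable_continuous_cell:
  fixes h :: "real ^ 'd \<Rightarrow> 'b::euclidean_space"
  assumes "continuous_on UNIV h"
  shows "set_integrable lborel period_cell h" "set_integrable lebesgue period_cell h"
    "(LINT x:period_cell|lebesgue. h x) = (LINT x:period_cell|lborel. h x)"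
proof -
  have cb: "compact (period_cell :: (real ^ 'd) set)" by (simp add: period_cell_def)
  have m: "(\<lambda>x. indicator period_cell x *\<^sub>R h x) \<in> borel_measurable lborel"
    using assms cb by (auto intro!: borel_measurable_continuous_on_indicator borel_compact intro: continuous_on_subset)
  show 1: "set_integrable lborel period_cell h"
    unfolding set_integrable_def
    by (rule borel_integrable_compact) (use assms cb in \<open>auto intro: continuous_on_subset\<close>)
  show "set_integrable lebesgue period_cell h"
    using 1 m unfolding set_integrable_def by (simp add: integrable_completion)
  show "(LINT x:period_cell|lebesgue. h x) = (LINT x:period_cell|lborel. h x)"
    using m unfolding set_lebesgue_integral_def by (simp add: integral_completion)
qed

text \<open>
  Fubini for a product of functions of one coordinate: Lebesgue measure is the image of the product
  measure over the basis.
\<close>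

lemma integral_prod_Basis:
  fixes g :: "'a::euclidean_space \<Rightarrow> real \<Rightarrow> complex"
  assumes "\<And>b. b \<in> Basis \<Longrightarrow> integrable lborel (g b)"
  shows "(\<integral>x. (\<Prod>b\<in>Basis. g b (x \<bullet> b)) \<partial>lborel) = (\<Prod>b\<in>Basis. \<integral>t. g b t \<partial>lborel)"
proof -
  interpret product_sigma_finite "\<lambda>b::'a. lborel :: real measure" ..
  have m: "g b \<in> borel_measurable borel" if "b \<in> Basis" for b
    using borel_measurable_integrable[OF assms[OF that]] by simp
  have "(\<integral>x. (\<Prod>b\<in>Basis. g b (x \<bullet> b)) \<partial>lborel) =
     (\<integral>x. (\<Prod>b\<in>Basis. g b (x \<bullet> b)) \<partial>(distr (\<Pi>\<^sub>M b\<in>Basis. lborel) borel (\<lambda>f. \<Sum>b\<in>Basis. f b *\<^sub>R b)))"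
    by (subst lborel_eq) simp
  also have "\<dots> = (\<integral>f. (\<Prod>b\<in>Basis. g b ((\<Sum>b'\<in>Basis. f b' *\<^sub>R b') \<bullet> b)) \<partial>(\<Pi>\<^sub>M b\<in>(Basis::'a set). lborel))"
  proof (rule integral_distr)
    show "(\<lambda>f. \<Sum>b\<in>Basis. f b *\<^sub>R b) \<in> measurable (Pi\<^sub>M Basis (\<lambda>b::'a. lborel)) (borel :: 'a measure)"
      by measurable
    show "(\<lambda>x. \<Prod>b\<in>Basis. g b (x \<bullet> b)) \<in> borel_measurable borel"
      using m by (intro borel_measurable_prod) (auto intro!: measurable_compose[OF _ m])
  qed
  also have "\<dots> = (\<integral>f. (\<Prod>b\<in>Basis. g b (f b)) \<partial>(\<Pi>\<^sub>M b\<in>(Basis::'a set). lborel))"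
    by (intro Bochner_Integration.integral_cong prod.cong refl arg_cong2[where f=g])
       (simp add: inner_sum_left inner_Basis if_distrib sum.delta cong: if_cong)
  also have "\<dots> = (\<Prod>b\<in>Basis. \<integral>t. g b t \<partial>lborel)"
    by (rule product_integral_prod) (use assms in auto)
  finally show ?thesis .
qed

lemma integral_cis_period:
  fixes n :: int
  shows "(\<integral>t. indicator {0..2*pi} t *\<^sub>R cis (real_of_int n * t) \<partial>lborel) = (if n = 0 then complex_of_real (2*pi) else 0)"
proof (cases "n = 0")
  case True
  have "(\<integral>t. indicator {0..2*pi} t *\<^sub>R (1::complex) \<partial>lborel) = complex_of_real (2*pi) - complex_of_real 0"
    by (rule integral_FTC_Icc) (auto intro!: derivative_eq_intros simp: has_vector_derivative_def scaleR_conv_of_real)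
  then show ?thesis using True by simp
next
  case False
  define F where "F t = cis (real_of_int n * t) / (\<i> * of_int n)" for t
  have "(\<integral>t. indicator {0..2*pi} t *\<^sub>R cis (real_of_int n * t) \<partial>lborel) = F (2*pi) - F 0"
  proof (rule integral_FTC_Icc)
    fix x :: real
    show "(F has_vector_derivative cis (real_of_int n * x)) (at x within {0..2 * pi})"
    proof -
      have "((\<lambda>z. exp (\<i> * of_int n * z) / (\<i> * of_int n)) has_field_derivative exp (\<i> * of_int n * of_real x)) (at (of_real x))"
        using False by (auto intro!: derivative_eq_intros simp: field_simps)
      from has_vector_derivative_real_field[OF this] show ?thesis
        unfolding F_def cis_conv_exp by (simp add: mult.assoc)
    qed
  qed (auto intro!: continuous_intros)
  also have "cis (real_of_int n * (2 * pi)) = 1"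
    by (simp add: complex_eq_iff sin_times_pi_eq_0 cos_one_2pi_int)
      (metis cis.sel cis_multiple_2pi Ints_of_int mult.assoc mult.commute one_complex.sel)
  then have "F (2*pi) - F 0 = 0" by (simp add: F_def)
  finally show ?thesis using False by simp
qed

lemma integral_expi:
  fixes k :: "int ^ 'd"
  shows "(LINT x:period_cell|lborel. expi k x) = (if k = 0 then complex_of_real ((2*pi) ^ CARD('d)) else 0)"
proof -
  define g where "g b t = indicator {0..2*pi} t *\<^sub>R cis ((freq k \<bullet> b) * t)" for b t
  have eq: "indicator period_cell x *\<^sub>R expi k x = (\<Prod>b\<in>Basis. g b (x \<bullet> b))" for x
  proof -
    have "(\<Prod>b\<in>Basis. g b (x \<bullet> b)) = (\<Prod>b\<in>Basis. of_real (indicator {0..2*pi} (x \<bullet> b))) * (\<Prod>b\<in>Basis. cis ((freq k \<bullet> b) * (x \<bullet> b)))"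
      by (simp add: g_def scaleR_conv_of_real prod.distrib)
    also have "(\<Prod>b\<in>Basis. cis ((freq k \<bullet> b) * (x \<bullet> b))) = cis (\<Sum>b\<in>Basis. (freq k \<bullet> b) * (x \<bullet> b))"
      by (induction rule: infinite_finite_induct) (auto simp: cis_mult)
    also have "(\<Sum>b\<in>Basis. (freq k \<bullet> b) * (x \<bullet> b)) = freq k \<bullet> x"
      by (simp add: euclidean_inner[of "freq k" x])
    also have "(\<Prod>b\<in>Basis. complex_of_real (indicator {0..2*pi} (x \<bullet> b))) = of_real (indicator period_cell x)"
    proof (cases "x \<in> period_cell")
      case True
      then have "x \<bullet> b \<in> {0..2*pi}" if "b \<in> Basis" for b
        using that by (auto simp: period_cell_def mem_box Basis_vec_def inner_axis)
      then show ?thesis using True by simp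
    next
      case False
      then obtain j where "x $ j \<notin> {0..2*pi}"
        by (auto simp: period_cell_def mem_box_cart)
      then obtain b where "b \<in> Basis" "x \<bullet> b \<notin> {0..2*pi}"
        by (metis axis_in_Basis_iff cart_eq_inner_axis Basis_real_def insertI1)
      then have "(\<Prod>b\<in>Basis. complex_of_real (indicator {0..2*pi} (x \<bullet> b))) = 0"
        by (intro prod_zero bexI[of _ b]) (auto simp: indicator_def)
      then show ?thesis using False by simp
    qed
    finally show ?thesis by (simp add: expi_def scaleR_conv_of_real)
  qed
  have int: "integrable lborel (g b)" for b
    unfolding g_def by (rule borel_integrable_compact) (auto intro!: continuous_intros)
  have ax: "freq k \<bullet> axis j 1 = real_of_int (k $ j)" for j
    by (simp add: inner_axis)
  have "(LINT x:period_cell|lborel. expi k x) = (\<Prod>b\<in>Basis. \<integral>t. g b t \<partial>lborel)"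
    unfolding set_lebesgue_integral_def eq by (rule integral_prod_Basis) (rule int)
  also have "\<dots> = (\<Prod>j\<in>UNIV. \<integral>t. g (axis j 1) t \<partial>lborel)"
  proof -
    have "inj (\<lambda>j::'d. axis j (1::real))" by (auto intro: injI simp: axis_eq_axis)
    moreover have "Basis = range (\<lambda>j::'d. axis j (1::real))" by (auto simp: Basis_vec_def)
    ultimately have "bij_betw (\<lambda>j::'d. axis j (1::real)) UNIV Basis" by (simp add: bij_betw_def)
    from prod.reindex_bij_betw[OF this, of "\<lambda>b. \<integral>t. g b t \<partial>lborel"] show ?thesis by simp
  qed
  also have "\<dots> = (\<Prod>j\<in>UNIV. if k $ j = 0 then complex_of_real (2*pi) else 0)"
    unfolding g_def ax integral_cis_period ..
  also have "\<dots> = (if k = 0 then complex_of_real ((2*pi) ^ CARD('d)) else 0)"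
    by (auto simp: vec_eq_iff)
  finally show ?thesis .
qed

lemma cfc_add: 
  assumes "continuous_on UNIV f" "continuous_on UNIV g"
  shows "cfc (\<lambda>x. f x + g x) k = cfc f k + cfc g k"
proof -
  have "set_integrable lebesgue period_cell (\<lambda>x. f x * cis (- (freq k \<bullet> x)))"
    "set_integrable lebesgue period_cell (\<lambda>x. g x * cis (- (freq k \<bullet> x)))"
    by (intro set_integrable_continuous_cell continuous_intros assms)+
  from set_integral_add(2)[OF this] show ?thesis
    by (simp add: cfc_def algebra_simps)
qed

lemma cfc_cmult: "cfc (\<lambda>x. c * f x) k = c * cfc f k"
  by (simp add: cfc_def mult.assoc)

lemma cfc_zero [simp]: "cfc (\<lambda>x. 0) k = 0"
  by (simp add: cfc_def)

lemma cfc_minus: "cfc (\<lambda>x. - f x) k = - cfc f k"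
  using cfc_cmult[of "-1" f k] by simp

lemma cfc_diff: 
  assumes "continuous_on UNIV f" "continuous_on UNIV g"
  shows "cfc (\<lambda>x. f x - g x) k = cfc f k - cfc g k"
  using cfc_add[OF assms(1), of "\<lambda>x. - g x"] assms by (simp add: cfc_minus continuous_intros)

lemma cfc_sum:
  assumes "\<And>i. i \<in> I \<Longrightarrow> continuous_on UNIV (f i)"
  shows "cfc (\<lambda>x. \<Sum>i\<in>I. f i x) k = (\<Sum>i\<in>I. cfc (f i) k)"
  using assms
  by (induction I rule: infinite_finite_induct) (auto simp: cfc_add continuous_on_sum)

lemma cfc_expi: "cfc (expi l) k = (if k = l then 1 else 0)"
proof -
  have e: "expi l x * cis (- (freq k \<bullet> x)) = expi (l - k) x" for x
    by (simp add: expi_def cis_mult inner_diff_left)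
  show ?thesis
    unfolding cfc_def e
    by (subst set_integrable_continuous_cell(3)) (auto simp: integral_expi intro!: continuous_intros)
qed

lemma cfc_expi_mult: "cfc (\<lambda>x. h x * expi l x) k = cfc h (k - l)"
proof -
  have e: "h x * expi l x * cis (- (freq k \<bullet> x)) = h x * cis (- (freq (k - l) \<bullet> x))" for x
    by (simp add: expi_def cis_mult inner_diff_left)
  show ?thesis unfolding cfc_def e ..
qed

lemma cfc_cnj: "cfc (\<lambda>x. cnj (h x)) k = cnj (cfc h (- k))"
proof -
  have "(LINT x:period_cell|lebesgue. cnj (h x) * cis (- (freq k \<bullet> x))) = 
    cnj (LINT x:period_cell|lebesgue. h x * cis (- (freq (- k) \<bullet> x)))"
  proof -
    have "cnj (indicat_real period_cell x *\<^sub>R (h x * cis (- (freq (- k) \<bullet> x)))) =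
        indicat_real period_cell x *\<^sub>R (cnj (h x) * cis (- (freq k \<bullet> x)))" for x
      by (simp add: cis_cnj)
    then show ?thesis
      unfolding set_lebesgue_integral_def by (simp add: cis_cnj flip: Bochner_Integration.integral_cnj)
  qed
  then show ?thesis by (simp add: cfc_def)
qed

lemma norm_cfc_le:
  fixes h :: "real ^ 'd \<Rightarrow> complex"
  assumes "\<And>x. cmod (h x) \<le> B"
  shows "cmod (cfc h k) \<le> B"
proof -
  have "0 \<le> B" using assms[of 0] norm_ge_zero order_trans by blast
  have vol: "(LINT x:(period_cell::(real^'d) set)|lebesgue. B) = (2 * pi) ^ CARD('d) * B"
  proof -
    have "(LINT x:(period_cell::(real^'d) set)|lborel. (1::complex)) = complex_of_real ((2*pi) ^ CARD('d))"
      using integral_expi[of "0::int^'d"] by simp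
    then have "of_real (LINT x:(period_cell::(real^'d) set)|lborel. (1::real)) = complex_of_real ((2*pi) ^ CARD('d))"
      using set_integral_complex_of_real[of lborel period_cell "\<lambda>_::real^'d. 1::real"] by simp
    then have "(LINT x:(period_cell::(real^'d) set)|lborel. (1::real)) = (2*pi) ^ CARD('d)"
      using of_real_eq_iff by blast
    then show ?thesis
      using set_integrable_continuous_cell(3)[of "\<lambda>_::real^'d. 1::real"] 
      by (simp add: set_lebesgue_integral_def)
  qed
  have "cmod (LINT x:period_cell|lebesgue. h x * cis (- (freq k \<bullet> x))) \<le>
     (LINT x:period_cell|lebesgue. cmod (h x * cis (- (freq k \<bullet> x))))"
    unfolding set_lebesgue_integral_def
    by (rule order_trans[OF integral_norm_bound]) simp
  also have "\<dots> \<le> (LINT x:(period_cell::(real^'d) set)|lebesgue. B)"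
    unfolding set_lebesgue_integral_def
  proof (rule integral_mono')
    show "integrable lebesgue (\<lambda>x::real^'d. indicat_real period_cell x *\<^sub>R B)"
      using set_integrable_continuous_cell(2)[of "\<lambda>_::real^'d. B"] by (simp add: set_integrable_def)
  qed (use assms \<open>0 \<le> B\<close> in \<open>auto simp: norm_mult indicator_def\<close>)
  finally have "cmod (LINT x:period_cell|lebesgue. h x * cis (- (freq k \<bullet> x))) \<le> (2 * pi) ^ CARD('d) * B"
    using vol by simp
  then show ?thesis
    by (simp add: cfc_def norm_mult norm_divide norm_power divide_simps mult.commute)
qed

section \<open>Uniqueness of Fourier coefficients\<close>

inductive trig :: "(real ^ 'd \<Rightarrow> complex) \<Rightarrow> bool" where
  trig_expi: "trig (expi k)"
| trig_cmult: "trig f \<Longrightarrow> trig (\<lambda>x. c * f x)"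
| trig_add: "trig f \<Longrightarrow> trig g \<Longrightarrow> trig (\<lambda>x. f x + g x)"

lemma trig_const: "trig (\<lambda>x. c)"
  using trig_cmult[OF trig_expi[of 0], of c] by simp

lemma trig_sum: "(\<And>i. i \<in> I \<Longrightarrow> trig (f i)) \<Longrightarrow> trig (\<lambda>x. \<Sum>i\<in>I. f i x)"
  by (induction I rule: infinite_finite_induct) (auto intro: trig_const trig_add)

lemma trig_mult:
  assumes "trig f" "trig g"
  shows "trig (\<lambda>x. f x * g x)"
  using assms(1)
proof induction
  case (trig_expi k)
  show ?case using assms(2)
  proof induction
    case (trig_expi l)
    have "expi (k + l) = (\<lambda>x. expi k x * expi l x)" by (simp add: expi_add fun_eq_iff)
    then show ?case using trig.trig_expi[of "k + l"] by simp
  next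
    case (trig_cmult f c)
    from trig.trig_cmult[OF this(2), of c] show ?case by (simp add: ac_simps)
  next
    case (trig_add f g)
    from trig.trig_add[OF this(3,4)] show ?case by (simp add: algebra_simps)
  qed
next
  case (trig_cmult f c)
  from trig.trig_cmult[OF this(2), of c] show ?case by (simp add: ac_simps)
next
  case (trig_add f g)
  from trig.trig_add[OF this(3,4)] show ?case by (simp add: algebra_simps)
qed

lemma continuous_on_trig: "trig f \<Longrightarrow> continuous_on UNIV f"
  by (induction rule: trig.induct) (auto intro!: continuous_intros)

text \<open>
  Multiplication by an exponential only shifts the coefficients. So a function all of whose
  coefficients vanish is orthogonal to every trigonometric polynomial.
\<close>

lemma cfc_mult_trig_zero:
  assumes "trig f" "continuous_on UNIV h" "\<And>k. cfc h k = 0"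
  shows "cfc (\<lambda>x. h x * f x) k = 0"
  using assms(1)
proof induction
  case (trig_expi l)
  show ?case by (simp add: cfc_expi_mult assms)
next
  case (trig_cmult f c)
  have "(\<lambda>x. h x * (c * f x)) = (\<lambda>x. c * (h x * f x))" by (simp add: ac_simps)
  then show ?case using trig_cmult by (simp add: cfc_cmult)
next
  case (trig_add f g)
  have "cfc (\<lambda>x. h x * f x + h x * g x) k = cfc (\<lambda>x. h x * f x) k + cfc (\<lambda>x. h x * g x) k"
    by (intro cfc_add continuous_intros assms continuous_on_trig trig_add)
  then show ?case using trig_add by (simp add: distrib_left)
qed

text \<open>
  The quotient map of the torus, realised as a product of \<open>d\<close> circles in a Euclidean space, where the
  Stone-Weierstrass theorem for polynomials applies.
\<close>

definition circle_map :: "real ^ 'd \<Rightarrow> complex ^ 'd" where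
  "circle_map x = (\<chi> j. cis (x $ j))"

text \<open>
  A real linear function on the product of circles is a combination of \<open>cos x\<^sub>j\<close> and \<open>sin x\<^sub>j\<close>,
  which are combinations of two exponentials; trigonometric polynomials form an algebra.
\<close>

lemma trig_polynomial_circle_map:
  fixes g :: "complex ^ 'd \<Rightarrow> real"
  assumes "real_polynomial_function g"
  shows "trig (\<lambda>x. complex_of_real (g (circle_map x)))"
  using assms
proof induction
  case (linear f)
  interpret f: bounded_linear f by fact
  define e where "e j = ((\<chi> i. if i = j then 1 else 0) :: int ^ 'd)" for j :: 'd
  have e: "expi (e j) x = cis (x $ j)" for j x
    by (simp add: expi_def inner_vec_def e_def of_bool_def if_distrib[where f=of_int] if_distrib[where f="\<lambda>t. t * _"] cong: if_cong)
  have "f z = (\<Sum>j\<in>UNIV. Re (z $ j) * f (axis j 1) + Im (z $ j) * f (axis j \<i>))" for z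
  proof -
    have "z $ i = (\<Sum>j\<in>UNIV. Re (z $ j) *\<^sub>R axis j 1 + Im (z $ j) *\<^sub>R axis j \<i>) $ i" for i
    proof -
      have "(Re (z $ j) *\<^sub>R axis j 1 + Im (z $ j) *\<^sub>R axis j \<i>) $ i = (if i = j then z $ j else 0)" for j
        by (simp add: axis_def complex_eq_iff)
      then show ?thesis by (simp add: sum.delta)
    qed
    then have "z = (\<Sum>j\<in>UNIV. Re (z $ j) *\<^sub>R axis j 1 + Im (z $ j) *\<^sub>R axis j \<i>)"
      unfolding vec_eq_iff by blast
    then have "f z = f (\<Sum>j\<in>UNIV. Re (z $ j) *\<^sub>R axis j 1 + Im (z $ j) *\<^sub>R axis j \<i>)" by simp
    then show ?thesis by (simp add: f.sum f.add f.scaleR)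
  qed
  then have fz: "f z = (\<Sum>j\<in>UNIV. Re (z $ j) * f (axis j 1) + Im (z $ j) * f (axis j \<i>))" for z .
  have tm: "complex_of_real (cos t * a + sin t * b) = (of_real a / 2) * (cis t + cnj (cis t)) 
         + (of_real b / (2 * \<i>)) * (cis t + (-1) * cnj (cis t))" for t a b :: real
    by (simp add: complex_eq_iff)
  have "complex_of_real (f (circle_map x)) = 
      (\<Sum>j\<in>UNIV. (of_real (f (axis j 1)) / 2) * (expi (e j) x + expi (- e j) x) 
         + (of_real (f (axis j \<i>)) / (2 * \<i>)) * (expi (e j) x + (-1) * expi (- e j) x))" for x
  proof -
    have "complex_of_real (f (circle_map x)) = 
      (\<Sum>j\<in>UNIV. complex_of_real (cos (x $ j) * f (axis j 1) + sin (x $ j) * f (axis j \<i>)))"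
      unfolding fz[of "circle_map x"] of_real_sum by (simp add: circle_map_def)
    then show ?thesis unfolding tm e expi_minus .
  qed
  moreover have "trig (\<lambda>x. \<Sum>j\<in>UNIV. (of_real (f (axis j 1)) / 2) * (expi (e j) x + expi (- e j) x) 
         + (of_real (f (axis j \<i>)) / (2 * \<i>)) * (expi (e j) x + (-1) * expi (- e j) x))"
    by (intro trig_sum trig_add trig_cmult trig_expi)
  ultimately show ?case by presburger
qed (simp_all add: trig_const trig_add trig_mult)

lemma periodic_shift:
  fixes h :: "real ^ 'd \<Rightarrow> 'b"
  assumes per: "\<And>x j. h (x + axis j (2 * pi)) = h x"
  shows "h (x + (\<chi> j. 2 * pi * real_of_int (m j))) = h x"
proof -
  have nat: "h (x + axis j (2 * pi * real n)) = h x" for n x j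
  proof (induction n)
    case (Suc n)
    have "axis j (2 * pi * real (Suc n)) = axis j (2 * pi * real n) + axis j (2 * pi)"
      by (simp add: vec_eq_iff axis_def algebra_simps)
    then have "x + axis j (2 * pi * real (Suc n)) = (x + axis j (2 * pi * real n)) + axis j (2*pi)"
      by (simp add: add.assoc)
    then show ?case using per Suc by metis
  qed (simp add: axis_def vec_eq_iff[symmetric] zero_vec_def[symmetric])
  have int: "h (x + axis j (2 * pi * real_of_int i)) = h x" for i x j
  proof (cases "i \<ge> 0")
    case True
    then show ?thesis using nat[of x j "nat i"] by simp
  next
    case False
    have "axis j (2 * pi * real_of_int i) + axis j (2 * pi * real (nat (- i))) = 0"
      using False by (simp add: vec_eq_iff axis_def)
    then have "x + axis j (2 * pi * real_of_int i) + axis j (2 * pi * real (nat (- i))) = x"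
      by (simp add: add.assoc)
    then show ?thesis using nat[of "x + axis j (2 * pi * real_of_int i)" j "nat (- i)"] by metis
  qed
  have "h (x + (\<Sum>j\<in>J. axis j (2 * pi * real_of_int (m j)))) = h x" if "finite J" for J
    using that
  proof (induction J)
    case (insert j J)
    have "h (x + (\<Sum>j\<in>insert j J. axis j (2 * pi * real_of_int (m j)))) = 
      h (x + (\<Sum>j\<in>J. axis j (2 * pi * real_of_int (m j))) + axis j (2 * pi * real_of_int (m j)))"
      using insert by (intro arg_cong[where f=h]) (simp add: ac_simps)
    also have "\<dots> = h (x + (\<Sum>j\<in>J. axis j (2 * pi * real_of_int (m j))))" by (rule int)
    also have "\<dots> = h x" by (rule insert)
    finally show ?case .
  qed simp
  moreover have "(\<Sum>j\<in>UNIV. axis j (2 * pi * real_of_int (m j))) = (\<chi> j. 2 * pi * real_of_int (m j))"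
    by (simp add: vec_eq_iff axis_def if_distrib cong: if_cong)
  ultimately show ?thesis by (metis finite)
qed

lemma periodic_circle_map:
  assumes per: "\<And>x j. h (x + axis j (2 * pi)) = h x"
  and "circle_map x = circle_map y"
  shows "h x = h y"
proof -
  have "\<exists>m::int. x $ j = y $ j + 2 * pi * m" for j
  proof -
    have "cis (x $ j) = cis (y $ j)"
      using assms(2) by (simp add: circle_map_def vec_eq_iff)
    then have "sin (x $ j) = sin (y $ j) \<and> cos (x $ j) = cos (y $ j)"
      by (metis cis.sel)
    then show ?thesis by (simp add: sin_cos_eq_iff)
  qed
  then obtain m :: "'a \<Rightarrow> int" where "\<And>j. x $ j = y $ j + 2 * pi * m j" by metis
  then have "x = y + (\<chi> j. 2 * pi * real_of_int (m j))" by (simp add: vec_eq_iff)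
  then show ?thesis using periodic_shift[of h, OF per] by metis
qed

lemma circle_map_cell: "\<exists>y\<in>period_cell. circle_map y = circle_map x"
proof
  define m where "m j = \<lfloor>x $ j / (2 * pi)\<rfloor>" for j
  define y where "y = (\<chi> j. x $ j - 2 * pi * real_of_int (m j))"
  have "cis (y $ j) = cis (x $ j)" for j
  proof -
    have "x $ j = y $ j + 2 * pi * real_of_int (m j)" by (simp add: y_def)
    then have "sin (x $ j) = sin (y $ j) \<and> cos (x $ j) = cos (y $ j)"
      using sin_cos_eq_iff by blast
    then show ?thesis by (simp add: complex_eq_iff)
  qed
  then show "circle_map y = circle_map x" by (simp add: circle_map_def)
  have "0 \<le> y $ j \<and> y $ j \<le> 2 * pi" for j
  proof -
    have "real_of_int (m j) \<le> x $ j / (2 * pi)" "x $ j / (2*pi) < real_of_int (m j) + 1"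
      unfolding m_def by linarith+
    then show ?thesis using pi_gt_zero by (simp add: y_def field_simps)
  qed
  then show "y \<in> period_cell" by (simp add: period_cell_def mem_box_cart)
qed

text \<open>
  A periodic function factors through \<open>circle_map\<close>, and the factor is continuous on the compact
  product of circles. A polynomial that approximates the factor pulls back to a trigonometric polynomial.
\<close>

lemma periodic_approx_trig:
  fixes h :: "real ^ 'd \<Rightarrow> real"
  assumes cont: "continuous_on UNIV h" and per: "\<And>x j. h (x + axis j (2 * pi)) = h x" and "0 < e"
  obtains g where "trig (\<lambda>x. complex_of_real (g x))" "\<And>x. \<bar>h x - g x\<bar> < e"
proof -
  define S :: "(complex ^ 'd) set" where "S = circle_map ` period_cell"
  define r where "r z = (SOME x. circle_map x = z)" for z :: "complex ^ 'd"
  have r: "h (r (circle_map x)) = h x" for x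
  proof -
    have "circle_map (r (circle_map x)) = circle_map x" unfolding r_def by (rule someI) rule
    from periodic_circle_map[of h, OF per this] show ?thesis .
  qed
  have cc: "continuous_on A circle_map" for A :: "(real ^ 'd) set"
    unfolding circle_map_def by (intro continuous_intros)
  have cell: "compact (period_cell :: (real ^ 'd) set)" by (simp add: period_cell_def)
  have S: "compact S" unfolding S_def by (rule compact_continuous_image[OF cc cell])
  have "continuous_on S (h \<circ> r)"
    unfolding continuous_on_closed_vimage[OF compact_imp_closed[OF S]]
  proof (intro allI impI)
    fix B :: "real set" assume B: "closed B"
    \<comment> \<open>The section r is not continuous, but preimages of closed sets under the factor are images
      of compact sets.\<close>
    have "(h \<circ> r) -` B \<inter> S = circle_map ` (period_cell \<inter> h -` B)"
      unfolding S_def using r by auto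
    moreover have "compact (period_cell \<inter> h -` B)"
      by (intro compact_Int_closed cell closed_vimage B cont)
    ultimately show "closed ((h \<circ> r) -` B \<inter> S)"
      using compact_continuous_image[OF cc] compact_imp_closed by metis
  qed
  from Stone_Weierstrass_real_polynomial_function[OF S this \<open>0 < e\<close>]
  obtain g where g: "real_polynomial_function g" "\<And>z. z \<in> S \<Longrightarrow> \<bar>(h \<circ> r) z - g z\<bar> < e"
    by blast
  show ?thesis
  proof
    show "trig (\<lambda>x. complex_of_real (g (circle_map x)))"
      by (rule trig_polynomial_circle_map) fact
    fix x
    have "circle_map x \<in> S" using circle_map_cell[of x] unfolding S_def by (metis imageI)
    from g(2)[OF this] show "\<bar>h x - g (circle_map x)\<bar> < e" by (simp add: r)
  qed
qed

text \<open>
  The function is orthogonal to its own trigonometric approximations, so the mean of its square is zero.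
\<close>

lemma cfc_eq_zero_imp_zero:
  fixes h :: "real ^ 'd \<Rightarrow> real"
  assumes cont: "continuous_on UNIV h" and per: "\<And>x j. h (x + axis j (2 * pi)) = h x"
    and zero: "\<And>k. cfc (\<lambda>x. complex_of_real (h x)) k = 0"
  shows "h x = 0"
proof -
  have cell: "compact (period_cell :: (real ^ 'd) set)" by (simp add: period_cell_def)
  have "compact (h ` period_cell)" by (rule compact_continuous_image[OF continuous_on_subset[OF cont] cell]) simp
  then have "bounded (h ` period_cell)" by (rule compact_imp_bounded)
  then obtain B where "\<forall>y\<in>h ` period_cell. norm y \<le> B"
    unfolding bounded_iff by blast
  then have B': "\<bar>h y\<bar> \<le> B" if "y \<in> period_cell" for y using that by simp
  have hy: "\<exists>y\<in>period_cell. h x = h y" for x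
  proof -
    obtain y where "y \<in> period_cell" "circle_map y = circle_map x" using circle_map_cell by blast
    then show ?thesis using periodic_circle_map[of h x y, OF per] by auto
  qed
  have B: "\<bar>h y\<bar> \<le> B" for y using hy[of y] B' by auto
  have "0 \<le> B" using B[of 0] by linarith
  have le: "cmod (cfc (\<lambda>x. complex_of_real (h x * h x)) 0) \<le> e" if "e > 0" for e
  proof -
    have e': "e / (B + 1) > 0" using that \<open>0 \<le> B\<close> by simp
    obtain g where g: "trig (\<lambda>x. complex_of_real (g x))" "\<And>x. \<bar>h x - g x\<bar> < e / (B + 1)"
      using periodic_approx_trig[OF cont per e'] by blast
    have c: "continuous_on UNIV (\<lambda>x. complex_of_real (h x))" "continuous_on UNIV (\<lambda>x. complex_of_real (g x))"
      by (intro continuous_intros cont continuous_on_trig[OF g(1)])+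
    have "cfc (\<lambda>x. complex_of_real (h x * h x)) 0 = 
       cfc (\<lambda>x. complex_of_real (h x) * complex_of_real (g x) + complex_of_real (h x) * (complex_of_real (h x) - complex_of_real (g x))) 0"
      by (rule arg_cong[where f="\<lambda>f. cfc f 0"]) (auto simp: algebra_simps)
    also have "\<dots> = cfc (\<lambda>x. complex_of_real (h x) * complex_of_real (g x)) 0 + 
       cfc (\<lambda>x. complex_of_real (h x) * (complex_of_real (h x) - complex_of_real (g x))) 0"
      by (intro cfc_add continuous_intros c)
    also have "cfc (\<lambda>x. complex_of_real (h x) * complex_of_real (g x)) 0 = 0"
      by (rule cfc_mult_trig_zero[OF g(1) c(1) zero])
    finally have "cmod (cfc (\<lambda>x. complex_of_real (h x * h x)) 0) = 
      cmod (cfc (\<lambda>x. complex_of_real (h x) * (complex_of_real (h x) - complex_of_real (g x))) 0)" by simp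
    also have "\<dots> \<le> B * (e / (B + 1))"
    proof (rule norm_cfc_le)
      fix x
      have "\<bar>h x\<bar> * \<bar>h x - g x\<bar> \<le> B * (e / (B + 1))"
        using B[of x] g(2)[of x] by (intro mult_mono) auto
      then show "cmod (complex_of_real (h x) * (complex_of_real (h x) - complex_of_real (g x))) \<le> B * (e / (B + 1))"
        by (simp add: norm_mult abs_mult flip: of_real_diff)
    qed
    also have "\<dots> \<le> e" using \<open>0 \<le> B\<close> that by (simp add: field_simps)
    finally show ?thesis .
  qed
  have "cmod (cfc (\<lambda>x. complex_of_real (h x * h x)) 0) \<le> 0"
  proof (rule field_le_epsilon)
    fix e :: real assume "0 < e"
    from le[OF this] show "cmod (cfc (\<lambda>x. complex_of_real (h x * h x)) 0) \<le> 0 + e" by linarith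
  qed
  then have "cfc (\<lambda>x. complex_of_real (h x * h x)) 0 = 0" by simp
  then have "(LINT x:period_cell|lebesgue. complex_of_real (h x * h x)) = 0"
    by (simp add: cfc_def)
  moreover have c2: "continuous_on UNIV (\<lambda>x. complex_of_real (h x * h x))" by (intro continuous_intros cont)
  ultimately have "(LINT x:period_cell|lborel. complex_of_real (h x * h x)) = 0"
    unfolding set_integrable_continuous_cell(3)[OF c2] by simp
  then have I0: "(LINT x:period_cell|lborel. h x * h x) = 0"
    unfolding set_integral_complex_of_real by simp
  have hh: "set_integrable lborel period_cell (\<lambda>x. h x * h x)"
    by (intro set_integrable_continuous_cell continuous_intros cont)
  have "((\<lambda>x. h x * h x) has_integral 0) period_cell"
    using set_borel_integral_eq_integral[OF hh] I0 by (simp add: has_integral_iff)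
  then have hc: "((\<lambda>x. h x * h x) has_integral 0) (cbox 0 (\<chi> j. 2 * pi))" by (simp add: period_cell_def)
  have "h y * h y = 0" if "y \<in> period_cell" for y
  proof (rule has_integral_0_cbox_imp_0[OF _ _ hc])
    show "continuous_on (cbox 0 (\<chi> j. 2 * pi)) (\<lambda>x. h x * h x)"
      by (intro continuous_intros continuous_on_subset[OF cont]) auto
    have "(\<chi> j. pi) \<in> box (0::real^'d) (\<chi> j. 2 * pi)" by (simp add: mem_box_cart)
    then show "box (0::real^'d) (\<chi> j. 2 * pi) \<noteq> {}" by blast
  qed (use that in \<open>auto simp: period_cell_def\<close>)
  then show ?thesis using hy[of x] by auto
qed


section \<open>Absolutely convergent Fourier series\<close>

definition fser :: "(int ^ 'd \<Rightarrow> complex) \<Rightarrow> real ^ 'd \<Rightarrow> complex" where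
  "fser c x = (\<Sum>\<^sub>\<infinity>k. c k * expi k x)"

lemma uniform_limit_fser:
  assumes "(\<lambda>k. cmod (c k)) summable_on UNIV"
  shows "uniform_limit UNIV (\<lambda>F x. \<Sum>k\<in>F. c k * expi k x) (fser c) (finite_subsets_at_top UNIV)"
  unfolding fser_def by (rule Weierstrass_m_test_general) (use assms in \<open>auto simp: norm_mult\<close>)

lemma continuous_on_fser:
  assumes "(\<lambda>k. cmod (c k)) summable_on UNIV"
  shows "continuous_on UNIV (fser c)"
  by (rule uniform_limit_theorem[OF _ uniform_limit_fser[OF assms]])
     (auto intro!: always_eventually continuous_intros)

lemma norm_fser_le:
  assumes "(\<lambda>k. cmod (c k)) summable_on UNIV"
  shows "cmod (fser c x) \<le> (\<Sum>\<^sub>\<infinity>k. cmod (c k))"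
  unfolding fser_def using norm_infsum_bound[of "\<lambda>k. c k * expi k x" UNIV] assms by (simp add: norm_mult)

text \<open>
  The series converges uniformly and coefficients are bounded by the supremum norm, so they may be
  computed termwise.
\<close>

lemma cfc_fser:
  assumes s: "(\<lambda>k. cmod (c k)) summable_on UNIV"
  shows "cfc (fser c) k = c k"
proof -
  let ?p = "\<lambda>F x. \<Sum>k\<in>F. c k * expi k x"
  have "((\<lambda>F. cfc (?p F) k) \<longlongrightarrow> cfc (fser c) k) (finite_subsets_at_top UNIV)"
  proof (rule tendstoI)
    fix e :: real assume "e > 0"
    with uniform_limitD[OF uniform_limit_fser[OF s], of "e/2"]
    have "\<forall>\<^sub>F F in finite_subsets_at_top UNIV. \<forall>x\<in>UNIV. dist (?p F x) (fser c x) < e/2" by simp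
    then show "\<forall>\<^sub>F F in finite_subsets_at_top UNIV. dist (cfc (?p F) k) (cfc (fser c) k) < e"
    proof eventually_elim
      case (elim F)
      have "cfc (?p F) k - cfc (fser c) k = cfc (\<lambda>x. ?p F x - fser c x) k"
        by (intro cfc_diff[symmetric] continuous_on_fser[OF s] continuous_intros)
      also have "cmod \<dots> \<le> e/2" using elim by (intro norm_cfc_le) (auto simp: dist_norm less_imp_le)
      finally show ?case using \<open>e > 0\<close> by (simp add: dist_norm)
    qed
  qed
  moreover have "\<forall>\<^sub>F F in finite_subsets_at_top UNIV. cfc (?p F) k = c k"
  proof -
    have "\<forall>\<^sub>F F in finite_subsets_at_top UNIV. finite F \<and> {k} \<subseteq> F"
      by (auto simp: eventually_finite_subsets_at_top intro: exI[of _ "{k}"])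
    then show ?thesis
    proof eventually_elim
      case (elim F)
      have "cfc (?p F) k = (\<Sum>l\<in>F. c l * cfc (expi l) k)"
        by (subst cfc_sum) (auto intro!: continuous_intros simp: cfc_cmult)
      also have "\<dots> = c k" using elim by (simp add: cfc_expi if_distrib cong: if_cong)
      finally show ?case .
    qed
  qed
  then have "((\<lambda>F. cfc (?p F) k) \<longlongrightarrow> c k) (finite_subsets_at_top UNIV)"
    by (rule tendsto_eventually)
  ultimately show ?thesis
    by (rule tendsto_unique[OF finite_subsets_at_top_neq_bot])
qed

lemma norm_cis_diff_le: "cmod (cis a - cis b) \<le> \<bar>a - b\<bar>"
proof -
  have "cis a - cis b = cis b * (exp (\<i> * of_real (a - b)) - 1)"
    by (simp add: cis_conv_exp algebra_simps flip: exp_add)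
  then have "cmod (cis a - cis b) = 2 * \<bar>sin ((a - b) / 2)\<bar>"
    by (simp only: norm_mult norm_cis dist_exp_i_1 mult_1)
  then show ?thesis using abs_sin_x_le_abs_x[of "(a - b) / 2"] by simp
qed

text \<open>
  Difference quotients of the \<open>k\<close>-th exponential are bounded by \<open>|k\<^sub>j|\<close>, so the series of difference
  quotients converges uniformly in the increment and limit and sum may be exchanged.
\<close>

lemma fser_partial:
  assumes s: "(\<lambda>k. cmod (c k)) summable_on UNIV"
    and s': "(\<lambda>k. \<bar>real_of_int (k $ j)\<bar> * cmod (c k)) summable_on UNIV"
  shows "((\<lambda>h. (fser c (x + h *\<^sub>R axis j 1) - fser c x) / of_real h) \<longlongrightarrow>
           fser (\<lambda>k. \<i> * of_int (k $ j) * c k) x) (at (0::real))"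
proof -
  define q where "q k h = c k * ((expi k (x + h *\<^sub>R axis j 1) - expi k x) / of_real h)" for k and h :: real
  have ex: "expi k (x + h *\<^sub>R axis j 1) = cis (freq k \<bullet> x + h * real_of_int (k $ j))" for k h
    by (simp add: expi_def inner_add_right inner_axis)
  have qb: "cmod (q k h) \<le> \<bar>real_of_int (k $ j)\<bar> * cmod (c k)" for k h
  proof -
    have "cmod (expi k (x + h *\<^sub>R axis j 1) - expi k x) \<le> \<bar>h\<bar> * \<bar>real_of_int (k $ j)\<bar>"
      unfolding ex using norm_cis_diff_le[of "freq k \<bullet> x + h * real_of_int (k $ j)" "freq k \<bullet> x"]
      by (simp add: expi_def abs_mult)
    then have "cmod ((expi k (x + h *\<^sub>R axis j 1) - expi k x) / of_real h) \<le> \<bar>real_of_int (k $ j)\<bar>"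
      by (cases "h = 0") (simp_all add: norm_divide divide_simps mult.commute)
    then have "cmod (c k) * cmod ((expi k (x + h *\<^sub>R axis j 1) - expi k x) / of_real h) \<le> cmod (c k) * \<bar>real_of_int (k $ j)\<bar>"
      by (intro mult_left_mono) auto
    moreover have "cmod (q k h) = cmod (c k) * cmod ((expi k (x + h *\<^sub>R axis j 1) - expi k x) / of_real h)"
      by (simp only: q_def norm_mult)
    ultimately show ?thesis by (simp only: mult.commute)
  qed
  have lim: "((q k) \<longlongrightarrow> \<i> * of_int (k $ j) * c k * expi k x) (at 0)" for k
  proof -
    have "((\<lambda>z. exp (\<i> * (of_real (freq k \<bullet> x) + z * of_int (k $ j)))) has_field_derivative
      \<i> * of_int (k $ j) * expi k x) (at 0)"
      by (auto intro!: derivative_eq_intros simp: expi_def cis_conv_exp)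
    then have d: "((\<lambda>z. (exp (\<i> * (of_real (freq k \<bullet> x) + z * of_int (k $ j))) - expi k x) / z) \<longlongrightarrow>
      \<i> * of_int (k $ j) * expi k x) (at 0)"
      by (simp add: DERIV_def expi_def cis_conv_exp)
    have r: "filterlim (complex_of_real) (at 0) (at 0)"
      by (rule filterlim_atI) (auto intro!: tendsto_eq_intros simp: eventually_at_filter)
    have "((\<lambda>h. (cis (freq k \<bullet> x + h * real_of_int (k $ j)) - expi k x) / of_real h) \<longlongrightarrow> \<i> * of_int (k $ j) * expi k x) (at 0)"
      using filterlim_compose[OF d r] by (simp add: cis_conv_exp)
    from tendsto_mult[OF tendsto_const[of "c k"] this] show ?thesis
      unfolding q_def ex by (simp add: ac_simps)
  qed
  have ul: "uniform_limit UNIV (\<lambda>F h. \<Sum>k\<in>F. q k h) (\<lambda>h. \<Sum>\<^sub>\<infinity>k. q k h) (finite_subsets_at_top UNIV)"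
    by (rule Weierstrass_m_test_general[OF _ s']) (simp add: qb)
  let ?g = "\<lambda>k. \<i> * of_int (k $ j) * c k * expi k x"
  have "cmod (?g k) = \<bar>real_of_int (k $ j)\<bar> * cmod (c k)" for k
    by (simp add: norm_mult)
  then have "(\<lambda>k. norm (?g k)) summable_on UNIV" using s' by presburger
  from infsum_tendsto[OF abs_summable_summable[OF this]]
  have gl: "(sum ?g \<longlongrightarrow> fser (\<lambda>k. \<i> * of_int (k $ j) * c k) x) (finite_subsets_at_top UNIV)"
    unfolding fser_def .
  have "((\<lambda>h. \<Sum>\<^sub>\<infinity>k. q k h) \<longlongrightarrow> fser (\<lambda>k. \<i> * of_int (k $ j) * c k) x) (at 0)"
  proof (rule swap_uniform_limit[OF _ gl ul])
    show "\<forall>\<^sub>F F in finite_subsets_at_top UNIV. ((\<lambda>h. \<Sum>k\<in>F. q k h) \<longlongrightarrow> sum ?g F) (at 0 within UNIV)"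
      by (intro always_eventually allI tendsto_sum) (use lim in simp)
  qed simp
  moreover have "(\<Sum>\<^sub>\<infinity>k. q k h) = (fser c (x + h *\<^sub>R axis j 1) - fser c x) / of_real h" for h
  proof -
    have sm: "(\<lambda>k. c k * expi k y) summable_on UNIV" for y
      by (rule abs_summable_summable) (use s in \<open>simp add: norm_mult\<close>)
    have "q k h = (c k * expi k (x + h *\<^sub>R axis j 1) - c k * expi k x) * (1 / of_real h)" for k
      by (simp only: q_def right_diff_distrib times_divide_eq_right mult_1_right)
    then have "(\<Sum>\<^sub>\<infinity>k. q k h) = (\<Sum>\<^sub>\<infinity>k. (c k * expi k (x + h *\<^sub>R axis j 1) - c k * expi k x) * (1 / of_real h))"
      by presburger
    also have "\<dots> = (\<Sum>\<^sub>\<infinity>k. (c k * expi k (x + h *\<^sub>R axis j 1) - c k * expi k x)) * (1 / of_real h)"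
      by (rule infsum_cmult_left') 
    also have "(\<Sum>\<^sub>\<infinity>k. (c k * expi k (x + h *\<^sub>R axis j 1) - c k * expi k x)) = fser c (x + h *\<^sub>R axis j 1) - fser c x"
      unfolding fser_def 
      using infsum_add[OF sm[of "x + h *\<^sub>R axis j 1"] summable_on_uminus[THEN iffD2, OF sm[of x]]]
      by (simp add: infsum_uminus)
    finally show ?thesis by simp
  qed
  ultimately show ?thesis by simp
qed

section \<open>The weights and the Sobolev embedding\<close>

lemma bracket_ge_1: "1 \<le> bracket k"
  by (simp add: bracket_def)

lemma bracket_pos [simp]: "0 < bracket k"
  using bracket_ge_1[of k] by linarith

lemma bracket_nonneg [simp]: "0 \<le> bracket k"
  using bracket_pos[of k] by linarith

lemma bracket_neq_0 [simp]: "bracket k \<noteq> 0"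
  using bracket_pos[of k] by linarith

lemma norm_freq_le_bracket: "norm (freq k) \<le> bracket k"
  unfolding bracket_def by (rule real_le_rsqrt) simp

lemma abs_nth_le_bracket: "\<bar>real_of_int (k $ j)\<bar> \<le> bracket k"
  using component_le_norm_cart[of "freq k" j] norm_freq_le_bracket[of k] by simp

lemma bracket_add_le_norm: "bracket (k + l) \<le> bracket k + norm (freq l)"
proof -
  have b: "bracket k = norm (1::real, freq k)" for k :: "int ^ 'a" by (simp add: bracket_def norm_Pair)
  have "norm ((1::real, freq k) + (0, freq l)) \<le> norm (1::real, freq k) + norm (0::real, freq l)"
    by (rule norm_triangle_ineq)
  then show ?thesis by (simp add: b)
qed

lemma bracket_diff_le: "\<bar>bracket k - bracket l\<bar> \<le> norm (freq (k - l))"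
proof -
  have "bracket k \<le> bracket l + norm (freq (k - l))"
    using bracket_add_le_norm[of l "k - l"] by (metis add_diff_cancel_left' diff_add_cancel add.commute)
  moreover have "bracket l \<le> bracket k + norm (freq (l - k))"
    using bracket_add_le_norm[of k "l - k"] by (metis add_diff_cancel_left' diff_add_cancel add.commute)
  moreover have "norm (freq (l - k)) = norm (freq (k - l))"
    by (simp add: norm_minus_commute)
  ultimately show ?thesis by linarith
qed

lemma bracket_add_le: "bracket (k + l) \<le> bracket k + bracket l"
  using bracket_add_le_norm[of k l] norm_freq_le_bracket[of l] by linarith

lemma summable_int_powr:
  assumes "p > 1"
  shows "(\<lambda>n::int. (1 + (real_of_int n)\<^sup>2) powr (- p / 2)) summable_on UNIV"
proof -
  let ?g = "\<lambda>n::int. (1 + (real_of_int n)\<^sup>2) powr (- p / 2)"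
  have "summable (\<lambda>n. real n powr (- p))" using assms by (simp add: summable_real_powr_iff)
  then have "summable (\<lambda>n. ?g (int n))"
  proof (rule summable_comparison_test[rotated], intro exI[of _ 1] allI impI)
    fix n :: nat assume "1 \<le> n"
    have "(1 + (real n)\<^sup>2) powr (- p / 2) \<le> ((real n)\<^sup>2) powr (- p / 2)"
      using assms \<open>1 \<le> n\<close> by (intro powr_mono2') auto
    also have "\<dots> = real n powr (- p)"
      using \<open>1 \<le> n\<close> by (simp add: powr_powr flip: powr_numeral)
    finally show "norm (?g (int n)) \<le> real n powr (- p)" by simp
  qed
  then have n: "(\<lambda>n. ?g (int n)) summable_on UNIV"
    by (subst summable_on_UNIV_nonneg_real_iff) auto
  have "?g summable_on (range int)" by (subst summable_on_reindex) (use n in \<open>auto simp: o_def inj_on_def\<close>)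
  moreover have "?g summable_on (range (\<lambda>n. - int n))" by (subst summable_on_reindex) (use n in \<open>auto simp: o_def inj_on_def\<close>)
  ultimately have "?g summable_on (range int \<union> range (\<lambda>n. - int n))" by (rule summable_on_union)
  moreover have "range int \<union> range (\<lambda>n. - int n) = UNIV"
  proof -
    have "i \<in> range int \<union> range (\<lambda>n. - int n)" for i
      by (cases i rule: int_cases2) auto
    then show ?thesis by blast
  qed
  ultimately show ?thesis by simp
qed

text \<open>
  With \<open>p = r/d > 1\<close>, each of the \<open>d\<close> factors \<open>\<langle>k\<rangle>\<^bsup>-p\<^esup>\<close> is at most \<open>(1 + k\<^sub>j\<^sup>2)\<^bsup>-p/2\<^esup>\<close>, so the sum is
  dominated by the \<open>d\<close>-th power of a convergent series over the integers.
\<close>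

lemma sum_bracket_bounded:
  assumes r: "r > real CARD('d)"
  shows "\<exists>B\<ge>0. \<forall>F. finite F \<longrightarrow> (\<Sum>k\<in>F. bracket (k :: int ^ 'd) powr (- r)) \<le> B"
proof -
  let ?d = "real CARD('d)"
  define p where "p = r / ?d"
  have d: "?d > 0" by simp
  have p: "p > 1" using r d by (simp add: p_def field_simps)
  let ?g = "\<lambda>n::int. (1 + (real_of_int n)\<^sup>2) powr (- p / 2)"
  define S where "S = infsum ?g UNIV"
  have S0: "0 \<le> S" unfolding S_def by (rule infsum_nonneg) simp
  have "(\<Sum>k\<in>F. bracket (k :: int ^ 'd) powr (- r)) \<le> S ^ CARD('d)" if F: "finite F" for F
  proof -
    define Z where "Z = (\<Union>k\<in>F. range (\<lambda>j. k $ j))"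
    have Z: "finite Z" using F by (simp add: Z_def)
    have le: "bracket k powr (- r) \<le> (\<Prod>j\<in>UNIV. ?g (k $ j))" for k :: "int ^ 'd"
    proof -
      have "bracket k powr (- r) = (1 + (norm (freq k))\<^sup>2) powr (- r / 2)"
        by (simp add: bracket_def powr_half_sqrt[symmetric] powr_powr)
      also have "\<dots> = ((1 + (norm (freq k))\<^sup>2) powr (- p / 2)) ^ CARD('d)"
      proof -
        have "real CARD('d) * (- p / 2) = - r / 2" using d by (simp add: p_def)
        moreover have "0 < 1 + (norm (freq k))\<^sup>2" by (simp add: add_pos_nonneg)
        ultimately show ?thesis by (subst powr_power) (auto simp: mult.commute)
      qed
      also have "\<dots> = (\<Prod>j\<in>(UNIV::'d set). (1 + (norm (freq k))\<^sup>2) powr (- p / 2))" by simp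
      also have "\<dots> \<le> (\<Prod>j\<in>UNIV. ?g (k $ j))"
      proof (intro prod_mono conjI powr_mono2')
        fix j
        show "1 + (real_of_int (k $ j))\<^sup>2 \<le> 1 + (norm (freq k))\<^sup>2"
          using component_le_norm_cart[of "freq k" j] by (simp add: abs_le_square_iff[symmetric])
      qed (use p in \<open>auto simp: add_pos_nonneg\<close>)
      finally show ?thesis .
    qed
    have "(\<Sum>k\<in>F. bracket k powr (- r)) \<le> (\<Sum>k\<in>F. \<Prod>j\<in>UNIV. ?g (k $ j))"
      by (intro sum_mono le)
    also have "\<dots> = (\<Sum>f\<in>vec_nth ` F. \<Prod>j\<in>UNIV. ?g (f j))"
      by (subst sum.reindex) (auto simp: inj_on_def vec_nth_inject)
    also have "\<dots> \<le> (\<Sum>f\<in>PiE (UNIV::'d set) (\<lambda>_. Z). \<Prod>j\<in>UNIV. ?g (f j))"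
    proof (rule Groups_Big.sum_mono2)
      show "finite (PiE (UNIV::'d set) (\<lambda>_. Z))" using Z by (simp add: finite_PiE)
      show "vec_nth ` F \<subseteq> PiE UNIV (\<lambda>_. Z)" by (auto simp: Z_def)
    qed (auto intro!: prod_nonneg)
    also have "\<dots> = (\<Prod>j\<in>(UNIV::'d set). \<Sum>n\<in>Z. ?g n)"
      by (rule prod_sum_PiE[symmetric]) (use Z in auto)
    also have "\<dots> \<le> (\<Prod>j\<in>(UNIV::'d set). S)"
      unfolding S_def by (intro prod_mono conjI sum_nonneg finite_sum_le_infsum summable_int_powr p Z) auto
    finally show ?thesis by simp
  qed
  then show ?thesis using S0 by (intro exI[of _ "S ^ CARD('d)"]) auto
qed

text \<open>
  Cauchy-Schwarz with the weight \<open>\<langle>k\<rangle>\<^bsup>1-s\<^esup>\<close>, which is square summable because \<open>2 s - 2 > d\<close>. The constant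
  does not depend on the finite set; this is what makes later bounds uniform in \<open>N\<close>.
\<close>

lemma sobolev_finite:
  assumes s: "s > real CARD('d) / 2 + 1"
  shows "\<exists>B>0. \<forall>F a. finite F \<longrightarrow> (\<forall>k. 0 \<le> a k) \<longrightarrow>
    (\<Sum>k\<in>F. bracket (k :: int ^ 'd) * a k) \<le> B * L2_set (\<lambda>k. bracket k powr s * a k) F"
proof -
  have "2 * s - 2 > real CARD('d)" using s by simp
  from sum_bracket_bounded[OF this] obtain B where B: "B \<ge> 0"
    "\<And>F. finite F \<Longrightarrow> (\<Sum>k\<in>F. bracket (k :: int ^ 'd) powr (- (2 * s - 2))) \<le> B" by blast
  show ?thesis
  proof (intro exI[of _ "sqrt B + 1"] conjI allI impI)
    show "0 < sqrt B + 1" using B(1) by (simp add: add_nonneg_pos)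
    fix F :: "(int ^ 'd) set" and a :: "int ^ 'd \<Rightarrow> real"
    assume F: "finite F" and a: "\<forall>k. 0 \<le> a k"
    have "(\<Sum>k\<in>F. bracket k * a k) = (\<Sum>k\<in>F. \<bar>bracket k powr (1 - s)\<bar> * \<bar>bracket k powr s * a k\<bar>)"
      using a by (intro sum.cong refl) (simp add: abs_mult powr_add[symmetric] flip: mult.assoc)
    also have "\<dots> \<le> L2_set (\<lambda>k. bracket k powr (1 - s)) F * L2_set (\<lambda>k. bracket k powr s * a k) F"
      by (rule L2_set_mult_ineq)
    also have "L2_set (\<lambda>k. bracket k powr (1 - s)) F \<le> sqrt B"
    proof -
      have "(\<Sum>k\<in>F. (bracket k powr (1 - s))\<^sup>2) = (\<Sum>k\<in>F. bracket k powr (- (2 * s - 2)))"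
        by (intro sum.cong refl) (simp add: power2_eq_square powr_add[symmetric])
      then show ?thesis unfolding L2_set_def using B(2)[OF F] by simp
    qed
    then have "L2_set (\<lambda>k. bracket k powr (1 - s)) F * L2_set (\<lambda>k. bracket k powr s * a k) F \<le>
        (sqrt B + 1) * L2_set (\<lambda>k. bracket k powr s * a k) F"
      by (intro mult_right_mono) auto
    finally show "(\<Sum>k\<in>F. bracket k * a k) \<le> (sqrt B + 1) * L2_set (\<lambda>k. bracket k powr s * a k) F" .
  qed
qed

lemma sobolev:
  assumes s: "s > real CARD('d) / 2 + 1"
  shows "\<exists>B>0. \<forall>f \<in> (Hs s :: (real ^ 'd \<Rightarrow> real ^ 'n) set).
     (\<lambda>k. bracket k * norm (fourier_coeff f k)) summable_on UNIV \<and>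
     (\<Sum>\<^sub>\<infinity>k. bracket k * norm (fourier_coeff f k)) \<le> B * Hs_norm s f"
proof -
  obtain B where B: "B > 0" "\<And>F a. finite F \<Longrightarrow> (\<And>k. 0 \<le> a k) \<Longrightarrow>
    (\<Sum>k\<in>F. bracket (k :: int ^ 'd) * a k) \<le> B * L2_set (\<lambda>k. bracket k powr s * a k) F"
    using sobolev_finite[OF s] by metis
  show ?thesis
  proof (intro exI[of _ B] conjI ballI B(1))
    fix f :: "real ^ 'd \<Rightarrow> real ^ 'n" assume f: "f \<in> Hs s"
    let ?a = "\<lambda>k. norm (fourier_coeff f k)"
    have sm: "(\<lambda>k. bracket k powr (2 * s) * (?a k)\<^sup>2) summable_on UNIV"
      using f by (simp add: Hs_def)
    have fin: "(\<Sum>k\<in>F. bracket k * ?a k) \<le> B * Hs_norm s f" if "finite F" for F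
    proof -
      have "L2_set (\<lambda>k. bracket k powr s * ?a k) F \<le> Hs_norm s f"
      proof -
        have "(\<Sum>k\<in>F. (bracket k powr s * ?a k)\<^sup>2) = (\<Sum>k\<in>F. bracket k powr (2 * s) * (?a k)\<^sup>2)"
          by (intro sum.cong refl) (simp add: power_mult_distrib powr_power)
        also have "\<dots> \<le> (\<Sum>\<^sub>\<infinity>k. bracket k powr (2 * s) * (?a k)\<^sup>2)"
          by (intro finite_sum_le_infsum[OF sm] that) auto
        finally show ?thesis by (simp add: L2_set_def Hs_norm_def)
      qed
      with B(2)[OF that, of ?a] B(1) show ?thesis
        by (smt (verit) mult_left_mono norm_ge_zero)
    qed
    show 1: "(\<lambda>k. bracket k * ?a k) summable_on UNIV"
      by (rule nonneg_bdd_above_summable_on) (use fin in \<open>auto simp: bdd_above_def\<close>)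
    show "(\<Sum>\<^sub>\<infinity>k. bracket k * ?a k) \<le> B * Hs_norm s f"
      by (rule infsum_le_finite_sums[OF 1]) (use fin in auto)
  qed
qed

section \<open>Trigonometric polynomials\<close>

definition tsum :: "(int ^ 'd) set \<Rightarrow> (int ^ 'd \<Rightarrow> complex ^ 'n) \<Rightarrow> real ^ 'd \<Rightarrow> real ^ 'n" where
  "tsum K c x = (\<chi> i. Re (\<Sum>k\<in>K. c k $ i * expi k x))"

text \<open>
  The condition on Fourier coefficients that characterises real functions. Only under it does the real
  part in \<open>tsum\<close> leave the trigonometric sum unchanged.
\<close>

definition herm :: "(int ^ 'd \<Rightarrow> complex ^ 'n) \<Rightarrow> bool" where
  "herm c \<longleftrightarrow> (\<forall>k i. c (- k) $ i = cnj (c k $ i))"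

definition band :: "nat \<Rightarrow> (int ^ 'd) set" where
  "band N = {k. \<forall>j. k $ j \<in> {- int N..int N}}"

lemma finite_band [simp]: "finite (band N :: (int ^ 'd) set)"
proof -
  have "vec_nth ` (band N :: (int ^ 'd) set) \<subseteq> PiE UNIV (\<lambda>_. {- int N..int N})"
    by (auto simp: band_def)
  then have "finite (vec_nth ` (band N :: (int ^ 'd) set))"
    by (rule finite_subset) (simp add: finite_PiE)
  then show ?thesis by (rule finite_imageD) (simp add: inj_on_def vec_nth_inject)
qed

lemma uminus_band [simp]: "- k \<in> band N \<longleftrightarrow> k \<in> band N"
  by (auto simp: band_def) (metis minus_le_iff neg_le_iff_le)+

lemma sum_cnj_herm:
  assumes sym: "\<And>k. k \<in> K \<Longrightarrow> - k \<in> K" and h: "herm c"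
  shows "cnj (\<Sum>k\<in>K. c k $ i * expi k x) = (\<Sum>k\<in>K. c k $ i * expi k x)"
proof -
  have "cnj (\<Sum>k\<in>K. c k $ i * expi k x) = (\<Sum>k\<in>K. c (- k) $ i * expi (- k) x)"
    using h by (simp add: cnj_sum herm_def expi_minus)
  also have "\<dots> = (\<Sum>k\<in>K. c k $ i * expi k x)"
    by (rule sum.reindex_bij_witness[where i=uminus and j=uminus]) (use sym in auto)
  finally show ?thesis .
qed

lemma tsum_complex:
  assumes "\<And>k. k \<in> K \<Longrightarrow> - k \<in> K" "herm c"
  shows "complex_of_real (tsum K c x $ i) = (\<Sum>k\<in>K. c k $ i * expi k x)"
proof -
  have "of_real (Re z) = z" if "cnj z = z" for z
    using that by (simp add: complex_eq_iff)
  from this[OF sum_cnj_herm[OF assms]] show ?thesis by (simp only: tsum_def vec_lambda_beta)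
qed

lemma tsum_periodic [simp]: "tsum K c (x + axis j (2 * pi)) = tsum K c x"
  by (simp add: tsum_def)

lemma continuous_on_tsum: "continuous_on S (tsum K c)"
  unfolding tsum_def by (intro continuous_intros)

lemma has_derivative_expi: "(expi k has_derivative (\<lambda>v. \<i> * of_real (freq k \<bullet> v) * expi k x)) (at x)"
proof -
  have "bounded_linear (\<lambda>x. \<i> * complex_of_real (freq k \<bullet> x))"
    by (intro bounded_linear_const_mult bounded_linear_compose[OF bounded_linear_of_real] bounded_linear_inner_right)
  then have d: "((\<lambda>x. \<i> * complex_of_real (freq k \<bullet> x)) has_derivative (\<lambda>v. \<i> * of_real (freq k \<bullet> v))) (at x)"
    by (rule bounded_linear_imp_has_derivative)
  have "(exp has_derivative (*) (exp w)) (at w)" for w :: complex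
    using DERIV_exp[of w] unfolding has_field_derivative_def .
  from has_derivative_compose[OF d this] show ?thesis
    unfolding expi_def cis_conv_exp by (simp add: mult.commute)
qed

lemma has_derivative_tsum:
  fixes c :: "int ^ 'd \<Rightarrow> complex ^ 'n"
  shows "(tsum K c has_derivative (\<lambda>v. tsum K (\<lambda>k. (\<i> * of_real (freq k \<bullet> v)) *s c k) x)) (at x)"
proof (rule has_derivative_componentwise_within[THEN iffD2], rule)
  fix b :: "real ^ 'n" assume "b \<in> Basis"
  then obtain i where b: "b = axis i 1" by (auto simp: Basis_vec_def)
  have "((\<lambda>x. Re (\<Sum>k\<in>K. c k $ i * expi k x)) has_derivative
      (\<lambda>v. Re (\<Sum>k\<in>K. c k $ i * (\<i> * of_real (freq k \<bullet> v) * expi k x)))) (at x)"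
    by (rule has_derivative_Re[OF has_derivative_sum[OF has_derivative_mult_right[OF has_derivative_expi]]])
  then show "((\<lambda>x. tsum K c x \<bullet> b) has_derivative (\<lambda>v. tsum K (\<lambda>k. (\<i> * of_real (freq k \<bullet> v)) *s c k) x \<bullet> b)) (at x)"
    unfolding b by (simp only: inner_axis tsum_def vec_lambda_beta vector_smult_component inner_real_def mult_1_right mult.assoc mult.left_commute)
qed

lemma differentiable_tsum: "tsum K c differentiable (at x)"
  using has_derivative_tsum by (rule differentiableI)

lemma partial_tsum: "partial_x j (tsum K c) x = tsum K (\<lambda>k. (\<i> * of_int (k $ j)) *s c k) x"
  unfolding partial_x_def frechet_derivative_at[OF has_derivative_tsum, symmetric]
  by (simp add: inner_axis)

lemma herm_partial: "herm c \<Longrightarrow> herm (\<lambda>k. (\<i> * of_int (k $ j)) *s c k)"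
  by (simp add: herm_def)

section \<open>Fourier coefficients of vector-valued functions\<close>

lemma norm_vec_le_sum: "norm (x :: 'a::real_normed_vector ^ 'n) \<le> (\<Sum>i\<in>UNIV. norm (x $ i))"
  by (simp add: norm_vec_def L2_set_le_sum)

lemma fourier_coeff_sum:
  assumes "\<And>j. j \<in> J \<Longrightarrow> continuous_on UNIV (f j)"
  shows "fourier_coeff (\<lambda>x. \<Sum>j\<in>J. f j x) k = (\<Sum>j\<in>J. fourier_coeff (f j) k)"
  by (simp add: vec_eq_iff fourier_coeff_nth sum_component) (intro allI cfc_sum continuous_intros assms)

lemma fourier_coeff_add:
  assumes "continuous_on UNIV f" "continuous_on UNIV g"
  shows "fourier_coeff (\<lambda>x. f x + g x) k = fourier_coeff f k + fourier_coeff g k"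
  by (simp add: vec_eq_iff fourier_coeff_nth) (intro allI cfc_add continuous_intros assms)

lemma fourier_coeff_diff:
  assumes "continuous_on UNIV f" "continuous_on UNIV g"
  shows "fourier_coeff (\<lambda>x. f x - g x) k = fourier_coeff f k - fourier_coeff g k"
  by (simp add: vec_eq_iff fourier_coeff_nth) (intro allI cfc_diff continuous_intros assms)

lemma fourier_coeff_scaleR: "fourier_coeff (\<lambda>x. r *\<^sub>R f x) k = r *\<^sub>R fourier_coeff f k"
  unfolding vec_eq_iff
proof
  fix i
  show "fourier_coeff (\<lambda>x. r *\<^sub>R f x) k $ i = (r *\<^sub>R fourier_coeff f k) $ i"
    using cfc_cmult[of "of_real r" "\<lambda>x. complex_of_real (f x $ i)" k]
    by (simp add: fourier_coeff_nth scaleR_conv_of_real[where 'a=complex])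
qed

lemma fourier_coeff_minus: "fourier_coeff (\<lambda>x. - f x) k = - fourier_coeff f k"
  using fourier_coeff_scaleR[of "-1" f k] by simp

text \<open>
  A real matrix acting on complex vectors, such as Fourier coefficients.
\<close>

definition cmatvec :: "real ^ 'n ^ 'm \<Rightarrow> complex ^ 'n \<Rightarrow> complex ^ 'm" where
  "cmatvec A z = (\<chi> p. \<Sum>q\<in>UNIV. of_real (A $ p $ q) * z $ q)"

lemma fourier_coeff_matrix:
  assumes "continuous_on UNIV f"
  shows "fourier_coeff (\<lambda>x. A *v f x) k = cmatvec A (fourier_coeff f k)"
  unfolding vec_eq_iff
proof
  fix p
  have "fourier_coeff (\<lambda>x. A *v f x) k $ p = cfc (\<lambda>x. \<Sum>q\<in>UNIV. of_real (A $ p $ q) * of_real (f x $ q)) k"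
    by (simp add: fourier_coeff_nth matrix_vector_mult_def)
  also have "\<dots> = (\<Sum>q\<in>UNIV. cfc (\<lambda>x. of_real (A $ p $ q) * of_real (f x $ q)) k)"
    by (intro cfc_sum continuous_intros assms)
  finally show "fourier_coeff (\<lambda>x. A *v f x) k $ p = cmatvec A (fourier_coeff f k) $ p"
    by (simp add: cfc_cmult cmatvec_def fourier_coeff_nth)
qed

lemma norm_fourier_coeff_le:
  fixes f :: "real ^ 'd \<Rightarrow> real ^ 'n"
  assumes "\<And>x. norm (f x) \<le> B"
  shows "norm (fourier_coeff f k) \<le> real CARD('n) * B"
proof -
  have "norm (fourier_coeff f k) \<le> (\<Sum>i\<in>UNIV. norm (fourier_coeff f k $ i))" by (rule norm_vec_le_sum)
  also have "\<dots> \<le> (\<Sum>i\<in>(UNIV::'n set). B)"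
  proof (rule sum_mono)
    fix i
    have "\<bar>f x $ i\<bar> \<le> B" for x using component_le_norm_cart[of "f x" i] assms[of x] by linarith
    then show "norm (fourier_coeff f k $ i) \<le> B"
      unfolding fourier_coeff_nth by (intro norm_cfc_le) simp
  qed
  finally show ?thesis by simp
qed

lemma herm_fourier_coeff: "herm (fourier_coeff f)"
  unfolding herm_def
proof (intro allI)
  fix k i
  show "fourier_coeff f (- k) $ i = cnj (fourier_coeff f k $ i)"
    using cfc_cnj[of "\<lambda>x. complex_of_real (f x $ i)" "- k"] by (simp add: fourier_coeff_nth)
qed

lemma fourier_coeff_tsum:
  assumes "finite K" "\<And>k. k \<in> K \<Longrightarrow> - k \<in> K" "herm c"
  shows "fourier_coeff (tsum K c) k = (if k \<in> K then c k else 0)"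
  unfolding vec_eq_iff
proof
  fix i
  have "fourier_coeff (tsum K c) k $ i = cfc (\<lambda>x. \<Sum>l\<in>K. c l $ i * expi l x) k"
    using tsum_complex[OF assms(2,3)] by (simp add: fourier_coeff_nth)
  also have "\<dots> = (\<Sum>l\<in>K. c l $ i * cfc (expi l) k)"
    by (subst cfc_sum) (auto intro!: continuous_intros simp: cfc_cmult)
  also have "\<dots> = (if k \<in> K then c k else 0) $ i"
    using assms(1) by (simp add: cfc_expi if_distrib cong: if_cong)
  finally show "fourier_coeff (tsum K c) k $ i = (if k \<in> K then c k else 0) $ i" .
qed

text \<open>
  Componentwise consequence of \<open>cfc_eq_zero_imp_zero\<close>.
\<close>

lemma fourier_coeff_inject:
  fixes f g :: "real ^ 'd \<Rightarrow> real ^ 'n"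
  assumes "continuous_on UNIV f" "continuous_on UNIV g"
    and pf: "\<And>x j. f (x + axis j (2 * pi)) = f x" and pg: "\<And>x j. g (x + axis j (2 * pi)) = g x"
    and eq: "\<And>k. fourier_coeff f k = fourier_coeff g k"
  shows "f = g"
proof
  fix x
  have "f x $ i - g x $ i = 0" for i
  proof (rule cfc_eq_zero_imp_zero[of "\<lambda>x. f x $ i - g x $ i"])
    show "continuous_on UNIV (\<lambda>x. f x $ i - g x $ i)" by (intro continuous_intros assms)
    fix k
    have "cfc (\<lambda>x. complex_of_real (f x $ i) - complex_of_real (g x $ i)) k = fourier_coeff f k $ i - fourier_coeff g k $ i"
      unfolding fourier_coeff_nth by (intro cfc_diff continuous_intros assms)
    then show "cfc (\<lambda>x. complex_of_real (f x $ i - g x $ i)) k = 0" by (simp add: eq)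
  qed (simp add: pf pg)
  then show "f x = g x" by (simp add: vec_eq_iff)
qed

section \<open>Sobolev spaces\<close>

lemma HsI:
  fixes f :: "real ^ 'd \<Rightarrow> real ^ 'n"
  assumes c: "continuous_on UNIV f" and per: "\<And>x j. f (x + axis j (2 * pi)) = f x"
    and sm: "(\<lambda>k. bracket k powr (2 * s) * (norm (fourier_coeff f k))\<^sup>2) summable_on UNIV"
  shows "f \<in> Hs s"
proof -
  have "f \<in> borel_measurable lebesgue"
    using borel_measurable_continuous_onI[OF c] by (simp add: measurable_completion)
  moreover have "set_integrable lebesgue period_cell (\<lambda>x. (norm (f x))\<^sup>2)"
    by (intro set_integrable_continuous_cell continuous_intros c)
  ultimately show ?thesis using per sm by (simp add: Hs_def L2_torus_def)
qed

lemma Hs_periodic: "f \<in> Hs s \<Longrightarrow> f (x + axis j (2 * pi)) = f x"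
  by (simp add: Hs_def L2_torus_def)

lemma Hs_norm_nonneg [simp]: "0 \<le> Hs_norm s f"
  by (simp add: Hs_norm_def infsum_nonneg)

lemma tsum_Hs:
  assumes "finite K" "\<And>k. k \<in> K \<Longrightarrow> - k \<in> K" "herm c"
  shows "tsum K c \<in> Hs s" "Hs_norm s (tsum K c) = L2_set (\<lambda>k. bracket k powr s * norm (c k)) K"
proof -
  let ?f = "\<lambda>k. bracket k powr (2 * s) * (norm (fourier_coeff (tsum K c) k))\<^sup>2"
  have z: "?f k = 0" if "k \<notin> K" for k using that by (simp add: fourier_coeff_tsum[OF assms])
  have "?f summable_on UNIV \<longleftrightarrow> ?f summable_on K"
    by (rule summable_on_cong_neutral) (use z in auto)
  then have "?f summable_on UNIV" using assms(1) by simp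
  then show "tsum K c \<in> Hs s" by (intro HsI continuous_on_tsum) simp_all
  have "infsum ?f UNIV = infsum ?f K" by (rule infsum_cong_neutral) (use z in auto)
  also have "\<dots> = (\<Sum>k\<in>K. (bracket k powr s * norm (c k))\<^sup>2)"
    using assms(1) by (simp add: fourier_coeff_tsum[OF assms] power_mult_distrib powr_power cong: sum.cong)
  finally show "Hs_norm s (tsum K c) = L2_set (\<lambda>k. bracket k powr s * norm (c k)) K"
    by (simp add: Hs_norm_def L2_set_def)
qed

text \<open>
  The values of a classical solution at a fixed time. Membership in \<open>H\<^sup>s\<close> alone concerns the class
  modulo null sets; differentiability selects the continuous representative, so that pointwise
  statements make sense.
\<close>

definition Hs_differentiable :: "real \<Rightarrow> (real ^ 'd \<Rightarrow> real ^ 'n) \<Rightarrow> bool" where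
  "Hs_differentiable s V \<longleftrightarrow> V \<in> Hs s \<and> (\<forall>x. V differentiable (at x))"

lemma Hs_differentiable_tsum: "finite K \<Longrightarrow> (\<And>k. k \<in> K \<Longrightarrow> - k \<in> K) \<Longrightarrow> herm c \<Longrightarrow> Hs_differentiable s (tsum K c)"
  by (simp add: Hs_differentiable_def tsum_Hs differentiable_tsum)

lemma Hs_differentiable_continuous: "Hs_differentiable s V \<Longrightarrow> continuous_on UNIV V"
  by (simp add: Hs_differentiable_def continuous_on_eq_continuous_within differentiable_imp_continuous_within)

lemma Hs_differentiable_diff:
  assumes "Hs_differentiable s V" "Hs_differentiable s W"
  shows "Hs_differentiable s (\<lambda>x. V x - W x)"
proof -
  have cV: "continuous_on UNIV V" and cW: "continuous_on UNIV W"
    using assms by (auto intro: Hs_differentiable_continuous)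
  let ?v = "\<lambda>k. norm (fourier_coeff V k)" and ?w = "\<lambda>k. norm (fourier_coeff W k)"
  have "(\<lambda>k. bracket k powr (2 * s) * (norm (fourier_coeff (\<lambda>x. V x - W x) k))\<^sup>2) summable_on UNIV"
  proof (rule summable_on_comparison_test)
    show "(\<lambda>k. 2 * (bracket k powr (2 * s) * (?v k)\<^sup>2) + 2 * (bracket k powr (2 * s) * (?w k)\<^sup>2)) summable_on UNIV"
      using assms by (intro summable_on_add summable_on_cmult_right) (auto simp: Hs_differentiable_def Hs_def)
    fix k
    have "norm (fourier_coeff (\<lambda>x. V x - W x) k) \<le> ?v k + ?w k"
      by (simp add: fourier_coeff_diff[OF cV cW] norm_triangle_ineq4)
    then have "(norm (fourier_coeff (\<lambda>x. V x - W x) k))\<^sup>2 \<le> (?v k + ?w k)\<^sup>2"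
      by (intro power_mono) auto
    also have "\<dots> \<le> 2 * (?v k)\<^sup>2 + 2 * (?w k)\<^sup>2"
      using sum_squares_ge_zero[of "?v k - ?w k" 0] by (simp add: power2_eq_square algebra_simps)
    finally have "bracket k powr (2 * s) * (norm (fourier_coeff (\<lambda>x. V x - W x) k))\<^sup>2 \<le> 
      bracket k powr (2 * s) * (2 * (?v k)\<^sup>2 + 2 * (?w k)\<^sup>2)" by (intro mult_left_mono) auto
    then show "bracket k powr (2 * s) * (norm (fourier_coeff (\<lambda>x. V x - W x) k))\<^sup>2 \<le> 
      2 * (bracket k powr (2 * s) * (?v k)\<^sup>2) + 2 * (bracket k powr (2 * s) * (?w k)\<^sup>2)"
      by (simp add: algebra_simps)
  qed simp
  moreover have "V x - W x = V (x + axis j (2 * pi)) - W (x + axis j (2 * pi))" for x j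
    using assms by (simp add: Hs_differentiable_def Hs_periodic[of V s] Hs_periodic[of W s])
  ultimately have "(\<lambda>x. V x - W x) \<in> Hs s"
    by (intro HsI continuous_intros cV cW) auto
  then show ?thesis using assms by (auto simp: Hs_differentiable_def intro: differentiable_diff)
qed

text \<open>
  The Fourier series of such a function converges absolutely together with its termwise derivatives. It
  has the same coefficients as the function, so it equals it everywhere.
\<close>

lemma Hs_differentiable_representation:
  fixes V :: "real ^ 'd \<Rightarrow> real ^ 'n"
  assumes V: "Hs_differentiable s V" and sm: "(\<lambda>k. bracket k * norm (fourier_coeff V k)) summable_on UNIV"
  defines "S \<equiv> (\<Sum>\<^sub>\<infinity>k. bracket k * norm (fourier_coeff V k))"
  shows "norm (V x) \<le> real CARD('n) * S"
    "norm (partial_x j V x) \<le> real CARD('n) * S"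
    "continuous_on UNIV (partial_x j V)"
    "fourier_coeff (partial_x j V) k = (\<i> * of_int (k $ j)) *s fourier_coeff V k"
proof -
  have cV: "continuous_on UNIV V" by (rule Hs_differentiable_continuous[OF V])
  have le1: "cmod (fourier_coeff V k $ i) \<le> bracket k * norm (fourier_coeff V k)" for k i
    using mult_mono[OF bracket_ge_1[of k] Finite_Cartesian_Product.norm_nth_le[of "fourier_coeff V k" i]] by simp
  have le2: "cmod (\<i> * of_int (k $ j) * fourier_coeff V k $ i) \<le> bracket k * norm (fourier_coeff V k)" for k i
    using mult_mono[OF abs_nth_le_bracket[of k j] Finite_Cartesian_Product.norm_nth_le[of "fourier_coeff V k" i]]
    by (simp add: norm_mult)
  have s1: "(\<lambda>k. cmod (fourier_coeff V k $ i)) summable_on UNIV" for i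
    by (rule summable_on_comparison_test[OF sm]) (use le1 in auto)
  have s2: "(\<lambda>k. cmod (\<i> * of_int (k $ j) * fourier_coeff V k $ i)) summable_on UNIV" for i
    by (rule summable_on_comparison_test[OF sm]) (use le2 in auto)
  let ?f = "\<lambda>i. fser (\<lambda>k. fourier_coeff V k $ i)"
  let ?g = "\<lambda>i. fser (\<lambda>k. \<i> * of_int (k $ j) * fourier_coeff V k $ i)"
  have real: "complex_of_real (Re (?f i x)) = ?f i x" for x i
  proof -
    have e: "cnj (fourier_coeff V k $ i * expi k x) = fourier_coeff V (- k) $ i * expi (- k) x" for k
      using herm_fourier_coeff[of V] by (simp add: herm_def expi_minus)
    have "cnj (?f i x) = (\<Sum>\<^sub>\<infinity>k. fourier_coeff V (- k) $ i * expi (- k) x)"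
      unfolding fser_def infsum_cnj[symmetric] e ..
    also have "\<dots> = ?f i x"
      unfolding fser_def
      by (rule infsum_reindex_bij_witness[where i=uminus and j=uminus]) auto
    finally have "cnj (?f i x) = ?f i x" .
    moreover have "of_real (Re z) = z" if "cnj z = z" for z
      using that by (simp add: complex_eq_iff)
    ultimately show ?thesis by blast
  qed
  have rep: "complex_of_real (V x $ i) = ?f i x" for x i
  proof -
    have "V = (\<lambda>x. \<chi> i. Re (?f i x))"
    proof (rule fourier_coeff_inject[OF cV])
      have c: "continuous_on UNIV (?f i)" for i by (rule continuous_on_fser[OF s1])
      show "continuous_on UNIV (\<lambda>x. \<chi> i. Re (?f i x))"
        by (intro continuous_intros c)
      show "V (x + axis j (2 * pi)) = V x" for x j using V by (simp add: Hs_differentiable_def Hs_periodic[of V s])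
      show "(\<chi> i. Re (?f i (x + axis j (2 * pi)))) = (\<chi> i. Re (?f i x))" for x j
        by (simp add: fser_def)
      fix k
      show "fourier_coeff V k = fourier_coeff (\<lambda>x. \<chi> i. Re (?f i x)) k"
        unfolding vec_eq_iff
      proof
        fix i
        have "fourier_coeff (\<lambda>x. \<chi> i. Re (?f i x)) k $ i = cfc (?f i) k"
          unfolding fourier_coeff_nth[of "\<lambda>x. \<chi> i. Re (?f i x)"] vec_lambda_beta real ..
        also have "\<dots> = fourier_coeff V k $ i" by (rule cfc_fser[OF s1])
        finally show "fourier_coeff V k $ i = fourier_coeff (\<lambda>x. \<chi> i. Re (?f i x)) k $ i" by simp
      qed
    qed
    then have "V x $ i = Re (?f i x)" by (metis vec_lambda_beta)
    then show ?thesis using real by simp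
  qed
  have prep: "complex_of_real (partial_x j V x $ i) = ?g i x" for x i
  proof -
    have "((\<lambda>h. (?f i (x + h *\<^sub>R axis j 1) - ?f i x) / of_real h) \<longlongrightarrow> ?g i x) (at (0::real))"
    proof (rule fser_partial[OF s1])
      show "(\<lambda>k. \<bar>real_of_int (k $ j)\<bar> * cmod (fourier_coeff V k $ i)) summable_on UNIV"
        using s2[of i] by (simp add: norm_mult)
    qed
    then have 1: "((\<lambda>h. complex_of_real ((V (x + h *\<^sub>R axis j 1) $ i - V x $ i) / h)) \<longlongrightarrow> ?g i x) (at (0::real))"
      by (simp add: rep)
    have "((\<lambda>h. V (x + h *\<^sub>R axis j 1)) has_derivative (\<lambda>h. frechet_derivative V (at x) (h *\<^sub>R axis j 1))) (at 0)"
    proof -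
      have "(V has_derivative frechet_derivative V (at x)) (at (x + 0 *\<^sub>R axis j 1))"
        using V frechet_derivative_works by (auto simp: Hs_differentiable_def)
      moreover have "((\<lambda>h::real. x + h *\<^sub>R axis j 1) has_derivative (\<lambda>h. h *\<^sub>R axis j 1)) (at 0)"
        by (auto intro!: derivative_eq_intros)
      ultimately show ?thesis by (rule has_derivative_compose[rotated])
    qed
    then have "((\<lambda>h. V (x + h *\<^sub>R axis j 1)) has_vector_derivative partial_x j V x) (at 0)"
      unfolding has_vector_derivative_def partial_x_def
      using linear_scale[OF linear_frechet_derivative[of V "at x"]] V by (simp add: Hs_differentiable_def)
    then have "((\<lambda>h. V (x + h *\<^sub>R axis j 1) $ i) has_vector_derivative partial_x j V x $ i) (at 0)"
      using bounded_linear.has_vector_derivative[OF bounded_linear_vec_nth] by blast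
    then have "((\<lambda>h. V (x + h *\<^sub>R axis j 1) $ i) has_real_derivative partial_x j V x $ i) (at 0)"
      by (simp add: has_real_derivative_iff_has_vector_derivative)
    then have "((\<lambda>h. (V (x + h *\<^sub>R axis j 1) $ i - V x $ i) / h) \<longlongrightarrow> partial_x j V x $ i) (at 0)"
      by (simp add: DERIV_def)
    from tendsto_of_real[OF this] have "((\<lambda>h. complex_of_real ((V (x + h *\<^sub>R axis j 1) $ i - V x $ i) / h)) \<longlongrightarrow> complex_of_real (partial_x j V x $ i)) (at 0)" .
    from tendsto_unique[OF _ this 1] show ?thesis by simp
  qed
  have b1: "\<bar>V x $ i\<bar> \<le> S" for i
  proof -
    have "\<bar>V x $ i\<bar> = cmod (?f i x)" by (simp flip: rep)
    also have "\<dots> \<le> (\<Sum>\<^sub>\<infinity>k. cmod (fourier_coeff V k $ i))" by (rule norm_fser_le[OF s1])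
    also have "\<dots> \<le> S" unfolding S_def by (rule infsum_mono[OF s1 sm le1])
    finally show ?thesis .
  qed
  have b2: "\<bar>partial_x j V x $ i\<bar> \<le> S" for i
  proof -
    have "\<bar>partial_x j V x $ i\<bar> = cmod (?g i x)" by (simp flip: prep)
    also have "\<dots> \<le> (\<Sum>\<^sub>\<infinity>k. cmod (\<i> * of_int (k $ j) * fourier_coeff V k $ i))" by (rule norm_fser_le[OF s2])
    also have "\<dots> \<le> S" unfolding S_def by (rule infsum_mono[OF s2 sm le2])
    finally show ?thesis .
  qed
  show "norm (V x) \<le> real CARD('n) * S"
    using order_trans[OF norm_vec_le_sum[of "V x"] sum_mono[of UNIV "\<lambda>i. norm (V x $ i)" "\<lambda>_. S"]] b1 by simp
  show "norm (partial_x j V x) \<le> real CARD('n) * S"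
    using order_trans[OF norm_vec_le_sum[of "partial_x j V x"] sum_mono[of UNIV "\<lambda>i. norm (partial_x j V x $ i)" "\<lambda>_. S"]] b2 by simp
  have eq: "partial_x j V = (\<lambda>x. \<chi> i. Re (?g i x))"
    by (simp add: fun_eq_iff vec_eq_iff flip: prep)
  show "continuous_on UNIV (partial_x j V)"
    unfolding eq by (intro continuous_intros continuous_on_fser[OF s2])
  show "fourier_coeff (partial_x j V) k = (\<i> * of_int (k $ j)) *s fourier_coeff V k"
    by (simp add: vec_eq_iff fourier_coeff_nth[of "partial_x j V"] prep cfc_fser[OF s2])
qed

lemma Hs_differentiable_bounds:
  assumes s: "s > real CARD('d) / 2 + 1"
  shows "\<exists>B>0. \<forall>V :: real ^ 'd \<Rightarrow> real ^ 'n. Hs_differentiable s V \<longrightarrow>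
    (\<forall>x j. norm (V x) \<le> B * Hs_norm s V \<and> norm (partial_x j V x) \<le> B * Hs_norm s V)"
proof -
  obtain B where B: "B > 0" "\<forall>f \<in> (Hs s :: (real ^ 'd \<Rightarrow> real ^ 'n) set).
     (\<lambda>k. bracket k * norm (fourier_coeff f k)) summable_on UNIV \<and>
     (\<Sum>\<^sub>\<infinity>k. bracket k * norm (fourier_coeff f k)) \<le> B * Hs_norm s f"
    using sobolev[OF s, where 'n='n] by blast
  show ?thesis
  proof (intro exI[of _ "real CARD('n) * B"] conjI allI impI)
    fix V :: "real ^ 'd \<Rightarrow> real ^ 'n" and x j assume V: "Hs_differentiable s V"
    then have sm: "(\<lambda>k. bracket k * norm (fourier_coeff V k)) summable_on UNIV"
      and le: "(\<Sum>\<^sub>\<infinity>k. bracket k * norm (fourier_coeff V k)) \<le> B * Hs_norm s V"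
      using B(2) by (simp_all add: Hs_differentiable_def)
    from mult_left_mono[OF le, of "real CARD('n)"]
    show "norm (V x) \<le> real CARD('n) * B * Hs_norm s V" "norm (partial_x j V x) \<le> real CARD('n) * B * Hs_norm s V"
      using Hs_differentiable_representation(1)[OF V sm, of x] Hs_differentiable_representation(2)[OF V sm, of j x] unfolding mult.assoc by linarith+
  qed (use B in simp)
qed

lemma Hs_differentiable_partial:
  assumes s: "s > real CARD('d) / 2 + 1" and V: "Hs_differentiable s (V :: real ^ 'd \<Rightarrow> real ^ 'n)"
  shows "continuous_on UNIV (partial_x j V)"
    "fourier_coeff (partial_x j V) k = (\<i> * of_int (k $ j)) *s fourier_coeff V k"
proof -
  have sm: "(\<lambda>k. bracket k * norm (fourier_coeff V k)) summable_on UNIV"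
    using sobolev[OF s, where 'n='n] V by (auto simp: Hs_differentiable_def)
  show "continuous_on UNIV (partial_x j V)" by (rule Hs_differentiable_representation(3)[OF V sm])
  show "fourier_coeff (partial_x j V) k = (\<i> * of_int (k $ j)) *s fourier_coeff V k"
    by (rule Hs_differentiable_representation(4)[OF V sm])
qed

section \<open>Convolution estimates\<close>

lemma L2_set_sum_le: "L2_set (\<lambda>k. \<Sum>l\<in>D. F l k) E \<le> (\<Sum>l\<in>D. L2_set (F l) E)"
proof (induction D rule: infinite_finite_induct)
  case (insert l D)
  have "L2_set (\<lambda>k. F l k + (\<Sum>l\<in>D. F l k)) E \<le> L2_set (F l) E + L2_set (\<lambda>k. \<Sum>l\<in>D. F l k) E"
    by (rule L2_set_triangle_ineq)
  then show ?case using insert by simp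
qed (simp_all add: L2_set_0')

text \<open>
  Convolutions are taken over finite sets of frequencies; translation invariance becomes an inequality,
  since a translate of the support of \<open>g\<close> may leave the set \<open>E\<close>.
\<close>

lemma L2_set_shift_le:
  fixes g :: "int ^ 'd \<Rightarrow> real"
  assumes "finite E" "finite E'" "\<And>k. k \<notin> E' \<Longrightarrow> g k = 0"
  shows "L2_set (\<lambda>k. g (k - l)) E \<le> L2_set g E'"
proof -
  have "(\<Sum>k\<in>E. (g (k - l))\<^sup>2) = (\<Sum>m\<in>(\<lambda>k. k - l) ` E. (g m)\<^sup>2)"
    by (subst sum.reindex) (auto simp: inj_on_def)
  also have "\<dots> = (\<Sum>m\<in>(\<lambda>k. k - l) ` E \<inter> E'. (g m)\<^sup>2)"
    by (rule sum.mono_neutral_right) (use assms in auto)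
  also have "\<dots> \<le> (\<Sum>m\<in>E'. (g m)\<^sup>2)" by (rule sum_mono2) (use assms in auto)
  finally show ?thesis by (simp add: L2_set_def)
qed

text \<open>
  Young's inequality: the convolution is a superposition of translates of \<open>g\<close>.
\<close>

lemma young_l1_l2:
  fixes f g :: "int ^ 'd \<Rightarrow> real"
  assumes "finite E" "finite E'" "\<And>k. k \<notin> E' \<Longrightarrow> g k = 0" "\<And>l. 0 \<le> f l"
  shows "L2_set (\<lambda>k. \<Sum>l\<in>D. f l * g (k - l)) E \<le> (\<Sum>l\<in>D. f l) * L2_set g E'"
proof -
  have "L2_set (\<lambda>k. \<Sum>l\<in>D. f l * g (k - l)) E \<le> (\<Sum>l\<in>D. L2_set (\<lambda>k. f l * g (k - l)) E)"
    by (rule L2_set_sum_le)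
  also have "\<dots> = (\<Sum>l\<in>D. f l * L2_set (\<lambda>k. g (k - l)) E)"
    using assms(4) by (simp add: L2_set_right_distrib)
  also have "\<dots> \<le> (\<Sum>l\<in>D. f l * L2_set g E')"
    by (intro sum_mono mult_left_mono L2_set_shift_le assms)
  finally show ?thesis by (simp add: sum_distrib_right)
qed

lemma convolution_commute:
  fixes f g :: "int ^ 'd \<Rightarrow> real"
  assumes "finite D" "finite E'" "\<And>k. k \<notin> E' \<Longrightarrow> g k = 0"
  shows "(\<Sum>l\<in>D. f l * g (k - l)) = (\<Sum>m\<in>E'. g m * (if k - m \<in> D then f (k - m) else 0))"
  by (rule sum.reindex_bij_witness_not_neutral[where i="\<lambda>m. k - m" and j="\<lambda>l. k - l" and 
        S'="{l\<in>D. k - l \<notin> E'}" and T'="{m\<in>E'. k - m \<notin> D}"])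
     (use assms in auto)

lemma young_l2_l1:
  fixes f g :: "int ^ 'd \<Rightarrow> real"
  assumes "finite D" "finite E" "finite E'" "\<And>k. k \<notin> E' \<Longrightarrow> g k = 0" "\<And>k. 0 \<le> g k"
  shows "L2_set (\<lambda>k. \<Sum>l\<in>D. f l * g (k - l)) E \<le> L2_set f D * (\<Sum>m\<in>E'. g m)"
proof -
  let ?f = "\<lambda>l. if l \<in> D then f l else 0"
  have "L2_set (\<lambda>k. \<Sum>l\<in>D. f l * g (k - l)) E = L2_set (\<lambda>k. \<Sum>m\<in>E'. g m * ?f (k - m)) E"
    by (intro L2_set_cong refl convolution_commute assms)
  also have "\<dots> \<le> (\<Sum>m\<in>E'. g m) * L2_set ?f D"
    by (rule young_l1_l2) (use assms in auto)
  also have "L2_set ?f D = L2_set f D" by (intro L2_set_cong) auto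
  finally show ?thesis by (simp add: mult.commute)
qed

lemma young_l1_l1:
  fixes f g :: "int ^ 'd \<Rightarrow> real"
  assumes "finite E" "finite E'" "\<And>k. k \<notin> E' \<Longrightarrow> g k = 0" "\<And>k. 0 \<le> g k" "\<And>l. 0 \<le> f l"
  shows "(\<Sum>k\<in>E. \<Sum>l\<in>D. f l * g (k - l)) \<le> (\<Sum>l\<in>D. f l) * (\<Sum>m\<in>E'. g m)"
proof -
  have sh: "(\<Sum>k\<in>E. g (k - l)) \<le> (\<Sum>m\<in>E'. g m)" for l
  proof -
    have "(\<Sum>k\<in>E. g (k - l)) = (\<Sum>m\<in>(\<lambda>k. k - l) ` E. g m)"
      by (subst sum.reindex) (auto simp: inj_on_def)
    also have "\<dots> = (\<Sum>m\<in>(\<lambda>k. k - l) ` E \<inter> E'. g m)"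
      by (rule sum.mono_neutral_right) (use assms in auto)
    also have "\<dots> \<le> (\<Sum>m\<in>E'. g m)" by (rule sum_mono2) (use assms in auto)
    finally show ?thesis .
  qed
  have "(\<Sum>k\<in>E. \<Sum>l\<in>D. f l * g (k - l)) = (\<Sum>l\<in>D. f l * (\<Sum>k\<in>E. g (k - l)))"
    by (subst sum.swap) (simp add: sum_distrib_left)
  also have "\<dots> \<le> (\<Sum>l\<in>D. f l * (\<Sum>m\<in>E'. g m))"
    by (intro sum_mono mult_left_mono sh assms)
  finally show ?thesis by (simp add: sum_distrib_right)
qed

lemma sum_mult_le_L2: "(\<Sum>k\<in>K. f k * g k) \<le> L2_set f K * L2_set g K"
proof -
  have "(\<Sum>k\<in>K. f k * g k) \<le> (\<Sum>k\<in>K. \<bar>f k\<bar> * \<bar>g k\<bar>)"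
    by (intro sum_mono) (simp flip: abs_mult)
  also have "\<dots> \<le> L2_set f K * L2_set g K" by (rule L2_set_mult_ineq)
  finally show ?thesis .
qed

text \<open>
  The middle factor will be a coefficient of the equation, the other two come from the unknown. Summable is
  the coefficient here and the unknown in \<open>trilinear_l2_l2_l1\<close>: the weight of order \<open>s\<close> falls on the unknown in
  the first case and on the coefficient in the second one.
\<close>

lemma trilinear_l2_l1_l2:
  fixes f g h :: "int ^ 'd \<Rightarrow> real"
  assumes "finite K" "finite E" "\<And>k. k \<notin> E \<Longrightarrow> g k = 0" "\<And>k. 0 \<le> g k"
  shows "(\<Sum>k\<in>K. \<Sum>l\<in>K. f k * g (k - l) * h l) \<le> L2_set f K * ((\<Sum>m\<in>E. g m) * L2_set h K)"
proof -
  have "(\<Sum>k\<in>K. \<Sum>l\<in>K. f k * g (k - l) * h l) = (\<Sum>k\<in>K. f k * (\<Sum>l\<in>K. h l * g (k - l)))"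
    by (simp add: sum_distrib_left mult_ac)
  also have "\<dots> \<le> L2_set f K * L2_set (\<lambda>k. \<Sum>l\<in>K. h l * g (k - l)) K" by (rule sum_mult_le_L2)
  also have "\<dots> \<le> L2_set f K * (L2_set h K * (\<Sum>m\<in>E. g m))"
    by (intro mult_left_mono young_l2_l1 assms L2_set_nonneg)
  finally show ?thesis by (simp add: mult.commute)
qed

lemma trilinear_l2_l2_l1:
  fixes f g h :: "int ^ 'd \<Rightarrow> real"
  assumes "finite K" "finite E" "\<And>k. k \<notin> E \<Longrightarrow> g k = 0" "\<And>k. 0 \<le> h k"
  shows "(\<Sum>k\<in>K. \<Sum>l\<in>K. f k * g (k - l) * h l) \<le> L2_set f K * (L2_set g E * (\<Sum>l\<in>K. h l))"
proof -
  have "(\<Sum>k\<in>K. \<Sum>l\<in>K. f k * g (k - l) * h l) = (\<Sum>k\<in>K. f k * (\<Sum>l\<in>K. h l * g (k - l)))"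
    by (simp add: sum_distrib_left mult_ac)
  also have "\<dots> \<le> L2_set f K * L2_set (\<lambda>k. \<Sum>l\<in>K. h l * g (k - l)) K" by (rule sum_mult_le_L2)
  also have "\<dots> \<le> L2_set f K * ((\<Sum>l\<in>K. h l) * L2_set g E)"
    by (intro mult_left_mono young_l1_l2 assms L2_set_nonneg)
  finally show ?thesis by (simp add: mult.commute)
qed

section \<open>Composition with polynomials\<close>

text \<open>
  The function \<open>g\<close> is the trigonometric polynomial with coefficients \<open>a\<close>, and \<open>D\<close> is some finite set
  that contains their support.
\<close>

definition coeffs_of :: "(int ^ 'd) set \<Rightarrow> (real ^ 'd \<Rightarrow> real) \<Rightarrow> (int ^ 'd \<Rightarrow> complex) \<Rightarrow> bool" where
  "coeffs_of D g a \<longleftrightarrow> finite D \<and> (\<forall>k. k \<notin> D \<longrightarrow> a k = 0) \<and> (\<forall>x. complex_of_real (g x) = (\<Sum>k\<in>D. a k * expi k x))"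

text \<open>
  The norm of a function together with its first derivatives in the Wiener algebra of absolutely
  convergent Fourier series. Up to a constant it bounds the suprema of the function and of its gradient.
\<close>

definition wnorm :: "(int ^ 'd) set \<Rightarrow> (int ^ 'd \<Rightarrow> 'a::real_normed_vector) \<Rightarrow> real" where
  "wnorm D a = (\<Sum>k\<in>D. bracket k * norm (a k))"

text \<open>
  The norm of \<open>H\<^sup>s\<close> for trigonometric polynomials, see \<open>tsum_Hs\<close>.
\<close>

definition hnorm :: "real \<Rightarrow> (int ^ 'd) set \<Rightarrow> (int ^ 'd \<Rightarrow> 'a::real_normed_vector) \<Rightarrow> real" where
  "hnorm s D a = L2_set (\<lambda>k. bracket k powr s * norm (a k)) D"

lemma wnorm_nonneg [simp]: "0 \<le> wnorm D a"
  by (simp add: wnorm_def sum_nonneg)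

lemma hnorm_nonneg [simp]: "0 \<le> hnorm s D a"
  by (simp add: hnorm_def)

lemma wnorm_enlarge:
  assumes "finite E" "D \<subseteq> E" "\<And>k. k \<notin> D \<Longrightarrow> a k = 0"
  shows "wnorm E a = wnorm D a"
  unfolding wnorm_def by (rule sum.mono_neutral_right) (use assms in auto)

lemma hnorm_enlarge:
  assumes "finite E" "D \<subseteq> E" "\<And>k. k \<notin> D \<Longrightarrow> a k = 0"
  shows "hnorm s E a = hnorm s D a"
  unfolding hnorm_def L2_set_def by (intro arg_cong[where f=sqrt] sum.mono_neutral_right) (use assms in auto)

lemma wnorm_add: "wnorm D (\<lambda>k. a k + b k) \<le> wnorm D a + wnorm D b"
  unfolding wnorm_def sum.distrib[symmetric]
  by (intro sum_mono) (simp add: norm_triangle_ineq flip: distrib_left)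

lemma hnorm_add: "hnorm s D (\<lambda>k. a k + b k) \<le> hnorm s D a + hnorm s D b"
proof -
  have "hnorm s D (\<lambda>k. a k + b k) \<le> L2_set (\<lambda>k. bracket k powr s * norm (a k) + bracket k powr s * norm (b k)) D"
    unfolding hnorm_def by (intro L2_set_mono) (auto simp: norm_triangle_ineq simp flip: distrib_left)
  also have "\<dots> \<le> hnorm s D a + hnorm s D b" unfolding hnorm_def by (rule L2_set_triangle_ineq)
  finally show ?thesis .
qed

lemma wnorm_cmult: "wnorm D (\<lambda>k. r * a k) = norm r * wnorm D a" for r :: complex
  by (simp add: wnorm_def norm_mult sum_distrib_left mult_ac)

lemma hnorm_cmult: "hnorm s D (\<lambda>k. r * a k) = norm r * hnorm s D a" for r :: complex
  by (simp add: hnorm_def norm_mult L2_set_right_distrib mult_ac)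

lemma coeffs_of_enlarge:
  assumes "coeffs_of D g a" "finite E" "D \<subseteq> E"
  shows "coeffs_of E g a"
proof -
  have "(\<Sum>k\<in>E. a k * expi k x) = (\<Sum>k\<in>D. a k * expi k x)" for x
    by (rule sum.mono_neutral_right) (use assms in \<open>auto simp: coeffs_of_def\<close>)
  then show ?thesis using assms by (auto simp: coeffs_of_def)
qed

lemma coeffs_of_add:
  assumes "coeffs_of D g a" "coeffs_of E h b"
  shows "coeffs_of (D \<union> E) (\<lambda>x. g x + h x) (\<lambda>k. a k + b k)"
    "wnorm (D \<union> E) (\<lambda>k. a k + b k) \<le> wnorm D a + wnorm E b"
    "hnorm s (D \<union> E) (\<lambda>k. a k + b k) \<le> hnorm s D a + hnorm s E b"
proof -
  have f: "finite (D \<union> E)" using assms by (simp add: coeffs_of_def)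
  have a: "coeffs_of (D \<union> E) g a" and b: "coeffs_of (D \<union> E) h b"
    using assms f by (auto intro: coeffs_of_enlarge)
  then show "coeffs_of (D \<union> E) (\<lambda>x. g x + h x) (\<lambda>k. a k + b k)"
    unfolding coeffs_of_def by (auto simp: sum.distrib distrib_right)
  have z: "\<And>k. k \<notin> D \<Longrightarrow> a k = 0" "\<And>k. k \<notin> E \<Longrightarrow> b k = 0" using assms by (auto simp: coeffs_of_def)
  have "wnorm (D \<union> E) a = wnorm D a" "wnorm (D \<union> E) b = wnorm E b"
    by (rule wnorm_enlarge[OF f]; use z in auto)+
  then show "wnorm (D \<union> E) (\<lambda>k. a k + b k) \<le> wnorm D a + wnorm E b"
    using wnorm_add[of "D \<union> E" a b] by simp
  have "hnorm s (D \<union> E) a = hnorm s D a" "hnorm s (D \<union> E) b = hnorm s E b"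
    by (rule hnorm_enlarge[OF f]; use z in auto)+
  then show "hnorm s (D \<union> E) (\<lambda>k. a k + b k) \<le> hnorm s D a + hnorm s E b"
    using hnorm_add[of s "D \<union> E" a b] by simp
qed

lemma coeffs_of_cmult:
  assumes "coeffs_of D g a"
  shows "coeffs_of D (\<lambda>x. r * g x) (\<lambda>k. of_real r * a k)"
  using assms unfolding coeffs_of_def by (auto simp: sum_distrib_left mult.assoc)

lemma powr_add_le:
  fixes x y s :: real
  assumes "0 \<le> x" "0 \<le> y" "0 \<le> s"
  shows "(x + y) powr s \<le> 2 powr s * (x powr s + y powr s)"
proof -
  have "(x + y) powr s \<le> (2 * max x y) powr s" using assms by (intro powr_mono2) auto
  also have "\<dots> = 2 powr s * (max x y) powr s" using assms by (simp add: powr_mult)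
  also have "(max x y) powr s \<le> x powr s + y powr s" by (simp add: max_def)
  finally show ?thesis by simp
qed

lemma bracket_powr_le:
  assumes "0 \<le> s"
  shows "bracket k powr s \<le> 2 powr s * (bracket l powr s + bracket (k - l) powr s)"
proof -
  have "bracket k \<le> bracket l + bracket (k - l)"
    using bracket_add_le[of l "k - l"] by (metis add_diff_cancel_left' diff_add_cancel add.commute)
  then have "bracket k powr s \<le> (bracket l + bracket (k - l)) powr s"
    using assms by (intro powr_mono2) auto
  also have "\<dots> \<le> 2 powr s * (bracket l powr s + bracket (k - l) powr s)"
    using assms by (intro powr_add_le) auto
  finally show ?thesis .
qed

text \<open>
  The sum of two numbers that are at least one is at most twice their product.
\<close>

lemma bracket_le_mult: "bracket k \<le> 2 * (bracket l * bracket (k - l))"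
proof -
  have "bracket k \<le> bracket l + bracket (k - l)"
    using bracket_add_le[of l "k - l"] by (metis add_diff_cancel_left' diff_add_cancel add.commute)
  also have "\<dots> \<le> 2 * (bracket l * bracket (k - l))"
  proof -
    have "1 * bracket (k - l) \<le> bracket l * bracket (k - l)" "bracket l * 1 \<le> bracket l * bracket (k - l)"
      by (intro mult_right_mono mult_left_mono bracket_ge_1; simp)+
    then show ?thesis by linarith
  qed
  finally show ?thesis .
qed

text \<open>
  The weight at \<open>k\<close> is distributed to one of the frequencies \<open>l\<close> and \<open>k - l\<close>, and Young's
  inequality is applied to each part. The estimate is tame: in every term only one factor is measured
  in \<open>H\<^sup>s\<close>, so bounds of \<open>H\<^sup>s\<close> norms stay linear.
\<close>

lemma coeffs_of_mult:
  fixes a b :: "int ^ 'd \<Rightarrow> complex"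
  assumes ga: "coeffs_of D g a" and hb: "coeffs_of E h b" and s: "0 \<le> s"
  shows "\<exists>M c. coeffs_of M (\<lambda>x. g x * h x) c \<and> wnorm M c \<le> 2 * (wnorm D a * wnorm E b) \<and>
    hnorm s M c \<le> 2 powr s * (hnorm s D a * wnorm E b + wnorm D a * hnorm s E b)"
proof -
  define M where "M = (\<lambda>(k, l). k + l) ` (D \<times> E)"
  define c where "c m = (\<Sum>l\<in>D. a l * b (m - l))" for m
  have fD: "finite D" and fE: "finite E" and za: "\<And>k. k \<notin> D \<Longrightarrow> a k = 0" and zb: "\<And>k. k \<notin> E \<Longrightarrow> b k = 0"
    using ga hb by (auto simp: coeffs_of_def)
  have fM: "finite M" using fD fE by (simp add: M_def)
  have zc: "c m = 0" if "m \<notin> M" for m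
    unfolding c_def
  proof (rule sum.neutral, rule ballI)
    fix l assume l: "l \<in> D"
    have "m - l \<notin> E"
    proof
      assume "m - l \<in> E"
      with l have "l + (m - l) \<in> M" unfolding M_def by (intro image_eqI[of _ _ "(l, m - l)"]) auto
      then show False using that by simp
    qed
    then show "a l * b (m - l) = 0" by (simp add: zb)
  qed
  have "complex_of_real (g x * h x) = (\<Sum>m\<in>M. c m * expi m x)" for x
  proof -
    have inner: "(\<Sum>m\<in>M. b (m - l) * expi m x) = expi l x * (\<Sum>q\<in>E. b q * expi q x)" if "l \<in> D" for l
    proof -
      have "(\<Sum>m\<in>M. b (m - l) * expi m x) = (\<Sum>m\<in>(\<lambda>q. l + q) ` E. b (m - l) * expi m x)"
      proof (rule sum.mono_neutral_right[OF fM])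
        show "(\<lambda>q. l + q) ` E \<subseteq> M" using that by (auto simp: M_def intro!: image_eqI[of _ _ "(l, _)"])
        show "\<forall>m\<in>M - (\<lambda>q. l + q) ` E. b (m - l) * expi m x = 0"
        proof
          fix m assume "m \<in> M - (\<lambda>q. l + q) ` E"
          then have "m - l \<notin> E" by (auto simp: image_iff)
          then show "b (m - l) * expi m x = 0" by (simp add: zb)
        qed
      qed
      also have "\<dots> = (\<Sum>q\<in>E. b q * expi (l + q) x)"
        by (subst sum.reindex) (auto simp: inj_on_def)
      also have "\<dots> = expi l x * (\<Sum>q\<in>E. b q * expi q x)"
        by (simp only: expi_add sum_distrib_left mult.left_commute)
      finally show ?thesis .
    qed
    have "(\<Sum>m\<in>M. c m * expi m x) = (\<Sum>l\<in>D. \<Sum>m\<in>M. a l * (b (m - l) * expi m x))"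
      unfolding c_def sum_distrib_right by (subst sum.swap) (simp only: mult.assoc)
    also have "\<dots> = (\<Sum>l\<in>D. a l * (expi l x * (\<Sum>q\<in>E. b q * expi q x)))"
      by (rule sum.cong[OF refl]) (simp only: inner flip: sum_distrib_left)
    also have "\<dots> = (\<Sum>l\<in>D. a l * expi l x) * (\<Sum>q\<in>E. b q * expi q x)"
      by (simp only: sum_distrib_right mult.assoc)
    also have "\<dots> = complex_of_real (g x) * complex_of_real (h x)"
      using ga hb by (simp only: coeffs_of_def)
    finally show ?thesis by simp
  qed
  then have "coeffs_of M (\<lambda>x. g x * h x) c" using fM zc by (simp add: coeffs_of_def)
  moreover have cb: "cmod (c m) \<le> (\<Sum>l\<in>D. cmod (a l) * cmod (b (m - l)))" for m
    unfolding c_def by (rule order_trans[OF norm_sum]) (simp add: norm_mult)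
  have "wnorm M c \<le> 2 * (wnorm D a * wnorm E b)"
  proof -
    have "wnorm M c \<le> (\<Sum>m\<in>M. \<Sum>l\<in>D. (2 * (bracket l * cmod (a l))) * (bracket (m - l) * cmod (b (m - l))))"
      unfolding wnorm_def
    proof (rule sum_mono)
      fix m
      have "bracket m * cmod (c m) \<le> bracket m * (\<Sum>l\<in>D. cmod (a l) * cmod (b (m - l)))"
        by (intro mult_left_mono cb) simp
      also have "\<dots> = (\<Sum>l\<in>D. bracket m * (cmod (a l) * cmod (b (m - l))))" by (simp add: sum_distrib_left)
      also have "\<dots> \<le> (\<Sum>l\<in>D. (2 * (bracket l * bracket (m - l))) * (cmod (a l) * cmod (b (m - l))))"
        by (intro sum_mono mult_right_mono bracket_le_mult) simp
      finally show "bracket m * cmod (c m) \<le> (\<Sum>l\<in>D. (2 * (bracket l * cmod (a l))) * (bracket (m - l) * cmod (b (m - l))))"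
        by (simp add: mult_ac)
    qed
    also have "\<dots> \<le> (\<Sum>l\<in>D. 2 * (bracket l * cmod (a l))) * (\<Sum>q\<in>E. bracket q * cmod (b q))"
      by (rule young_l1_l1) (use fM fE zb in auto)
    also have "(\<Sum>l\<in>D. 2 * (bracket l * cmod (a l))) = 2 * wnorm D a"
      by (simp only: wnorm_def sum_distrib_left)
    finally show ?thesis by (simp only: wnorm_def mult.assoc)
  qed
  moreover have "hnorm s M c \<le> 2 powr s * (hnorm s D a * wnorm E b + wnorm D a * hnorm s E b)"
  proof -
    have le1: "cmod z \<le> bracket k * cmod z" for z and k :: "int ^ 'd"
      using mult_right_mono[OF bracket_ge_1, of "cmod z" k] by simp
    let ?A = "\<lambda>l. bracket l powr s * cmod (a l)" and ?B = "\<lambda>l. bracket l powr s * cmod (b l)"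
    have "hnorm s M c \<le> L2_set (\<lambda>m. 2 powr s * ((\<Sum>l\<in>D. ?A l * cmod (b (m - l))) + (\<Sum>l\<in>D. cmod (a l) * ?B (m - l)))) M"
      unfolding hnorm_def
    proof (rule L2_set_mono)
      fix m
      have "bracket m powr s * cmod (c m) \<le> bracket m powr s * (\<Sum>l\<in>D. cmod (a l) * cmod (b (m - l)))"
        by (intro mult_left_mono cb) simp
      also have "\<dots> = (\<Sum>l\<in>D. bracket m powr s * (cmod (a l) * cmod (b (m - l))))" by (simp add: sum_distrib_left)
      also have "\<dots> \<le> (\<Sum>l\<in>D. (2 powr s * (bracket l powr s + bracket (m - l) powr s)) * (cmod (a l) * cmod (b (m - l))))"
        by (intro sum_mono mult_right_mono bracket_powr_le s) simp
      also have "\<dots> = 2 powr s * ((\<Sum>l\<in>D. ?A l * cmod (b (m - l))) + (\<Sum>l\<in>D. cmod (a l) * ?B (m - l)))"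
        by (simp add: sum.distrib[symmetric] sum_distrib_left algebra_simps)
      finally show "bracket m powr s * cmod (c m) \<le> 2 powr s * ((\<Sum>l\<in>D. ?A l * cmod (b (m - l))) + (\<Sum>l\<in>D. cmod (a l) * ?B (m - l)))" .
    qed simp
    also have "\<dots> = 2 powr s * L2_set (\<lambda>m. (\<Sum>l\<in>D. ?A l * cmod (b (m - l))) + (\<Sum>l\<in>D. cmod (a l) * ?B (m - l))) M"
      by (rule L2_set_right_distrib[symmetric]) simp
    also have "\<dots> \<le> 2 powr s * (L2_set (\<lambda>m. \<Sum>l\<in>D. ?A l * cmod (b (m - l))) M + L2_set (\<lambda>m. \<Sum>l\<in>D. cmod (a l) * ?B (m - l)) M)"
      by (intro mult_left_mono L2_set_triangle_ineq) simp
    also have "\<dots> \<le> 2 powr s * (hnorm s D a * wnorm E b + wnorm D a * hnorm s E b)"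
    proof (intro mult_left_mono add_mono)
      have "L2_set (\<lambda>m. \<Sum>l\<in>D. ?A l * cmod (b (m - l))) M \<le> hnorm s D a * (\<Sum>q\<in>E. cmod (b q))"
        unfolding hnorm_def by (rule young_l2_l1) (use fD fM fE zb in auto)
      also have "\<dots> \<le> hnorm s D a * wnorm E b"
        unfolding wnorm_def by (intro mult_left_mono sum_mono le1) simp
      finally show "L2_set (\<lambda>m. \<Sum>l\<in>D. ?A l * cmod (b (m - l))) M \<le> hnorm s D a * wnorm E b" .
      have "L2_set (\<lambda>m. \<Sum>l\<in>D. cmod (a l) * ?B (m - l)) M \<le> (\<Sum>l\<in>D. cmod (a l)) * hnorm s E b"
        unfolding hnorm_def by (rule young_l1_l2) (use fM fE zb in auto)
      also have "\<dots> \<le> wnorm D a * hnorm s E b"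
        unfolding wnorm_def by (intro mult_right_mono sum_mono le1) simp
      finally show "L2_set (\<lambda>m. \<Sum>l\<in>D. cmod (a l) * ?B (m - l)) M \<le> wnorm D a * hnorm s E b" .
    qed simp
    finally show ?thesis .
  qed
  ultimately show ?thesis by blast
qed

lemma coeffs_of_linear_tsum:
  fixes f :: "real ^ 'n \<Rightarrow> real"
  assumes f: "bounded_linear f" and K: "finite K" "\<And>k. k \<in> K \<Longrightarrow> - k \<in> K" and c: "herm c"
  defines "a \<equiv> \<lambda>k. if k \<in> K then \<Sum>i\<in>UNIV. of_real (f (axis i 1)) * c k $ i else 0"
  shows "coeffs_of K (\<lambda>x. f (tsum K c x)) a"
    "cmod (a k) \<le> (\<Sum>i\<in>UNIV. \<bar>f (axis i 1)\<bar>) * norm (c k)"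
proof -
  interpret f: bounded_linear f by fact
  have fv: "f v = (\<Sum>i\<in>UNIV. f (axis i 1) * v $ i)" for v
  proof -
    have "v = (\<Sum>i\<in>UNIV. v $ i *\<^sub>R axis i 1)"
      by (simp add: vec_eq_iff axis_def if_distrib cong: if_cong)
    then have "f v = f (\<Sum>i\<in>UNIV. v $ i *\<^sub>R axis i 1)" by simp
    then show ?thesis by (simp add: f.sum f.scaleR mult.commute)
  qed
  have "complex_of_real (f (tsum K c x)) = (\<Sum>k\<in>K. a k * expi k x)" for x
  proof -
    have "complex_of_real (f (tsum K c x)) = (\<Sum>i\<in>UNIV. of_real (f (axis i 1)) * of_real (tsum K c x $ i))"
      by (subst fv) simp
    also have "\<dots> = (\<Sum>i\<in>UNIV. of_real (f (axis i 1)) * (\<Sum>k\<in>K. c k $ i * expi k x))"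
      by (simp only: tsum_complex[OF K(2) c])
    also have "\<dots> = (\<Sum>k\<in>K. \<Sum>i\<in>UNIV. of_real (f (axis i 1)) * c k $ i * expi k x)"
      by (subst sum.swap) (simp only: sum_distrib_left mult.assoc)
    also have "\<dots> = (\<Sum>k\<in>K. a k * expi k x)"
      by (rule sum.cong[OF refl]) (simp add: a_def sum_distrib_right)
    finally show ?thesis .
  qed
  then show "coeffs_of K (\<lambda>x. f (tsum K c x)) a" using K by (simp add: coeffs_of_def a_def)
  have "cmod (\<Sum>i\<in>UNIV. of_real (f (axis i 1)) * c k $ i) \<le> (\<Sum>i\<in>UNIV. \<bar>f (axis i 1)\<bar> * norm (c k))"
    by (rule order_trans[OF norm_sum]) (auto intro!: sum_mono mult_left_mono Finite_Cartesian_Product.norm_nth_le simp: norm_mult)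
  then show "cmod (a k) \<le> (\<Sum>i\<in>UNIV. \<bar>f (axis i 1)\<bar>) * norm (c k)"
    by (auto simp: a_def sum_distrib_right sum_nonneg)
qed

text \<open>
  Tame estimate for composition with a polynomial: induction over the polynomial, where the
  product is treated by \<open>coeffs_of_mult\<close>. The constant term is subtracted because the bounds are
  proportional to the norms of \<open>c\<close>, so the function has to vanish with \<open>c\<close>.
\<close>

lemma coeffs_of_polynomial:
  fixes f :: "real ^ 'n \<Rightarrow> real"
  assumes "real_polynomial_function f" and s: "0 \<le> s" and R: "0 \<le> R"
  shows "\<exists>C\<ge>0. \<forall>K (c :: int ^ 'd \<Rightarrow> complex ^ 'n). finite K \<longrightarrow> (\<forall>k\<in>K. - k \<in> K) \<longrightarrow> herm c \<longrightarrow> wnorm K c \<le> R \<longrightarrow>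
    (\<exists>D a. coeffs_of D (\<lambda>x. f (tsum K c x) - f 0) a \<and> wnorm D a \<le> C * wnorm K c \<and> hnorm s D a \<le> C * hnorm s K c)"
  using assms(1)
proof induction
  case (linear f)
  let ?C = "\<Sum>i\<in>UNIV. \<bar>f (axis i 1)\<bar>"
  show ?case
  proof (rule exI[of _ ?C], intro conjI allI impI)
    show C: "0 \<le> ?C" by (simp add: sum_nonneg)
    fix K :: "(int ^ 'd) set" and c :: "int ^ 'd \<Rightarrow> complex ^ 'n"
    assume K: "finite K" "\<forall>k\<in>K. - k \<in> K" and c: "herm c"
    define a where "a k = (if k \<in> K then \<Sum>i\<in>UNIV. of_real (f (axis i 1)) * c k $ i else 0)" for k
    note * = coeffs_of_linear_tsum[OF linear K(1) K(2)[rule_format] c, folded a_def]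
    have le: "w * cmod (a k) \<le> ?C * (w * norm (c k))" if "0 \<le> w" for w k
      using mult_left_mono[OF *(2) that, of k] by (simp only: mult.left_commute)
    have "wnorm K a \<le> ?C * wnorm K c"
      unfolding wnorm_def sum_distrib_left[of ?C] by (intro sum_mono le) simp
    moreover have "hnorm s K a \<le> ?C * hnorm s K c"
      unfolding hnorm_def L2_set_right_distrib[OF C] by (intro L2_set_mono le) simp_all
    moreover have "f 0 = 0" using linear by (rule linear_0[OF bounded_linear.linear])
    ultimately show "\<exists>D a. coeffs_of D (\<lambda>x. f (tsum K c x) - f 0) a \<and> wnorm D a \<le> ?C * wnorm K c \<and> hnorm s D a \<le> ?C * hnorm s K c"
      using *(1) by auto
  qed
next
  case (const r)
  show ?case
    by (intro exI[of _ 0] conjI allI impI exI[of _ "{}"] exI[of _ "\<lambda>_. 0"])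
       (auto simp: coeffs_of_def wnorm_def hnorm_def)
next
  case (add f g)
  from add.IH(1) obtain C1 where C1: "C1 \<ge> 0" 
    "\<And>K c. \<lbrakk>finite K; \<forall>k\<in>K. - k \<in> K; herm (c :: int ^ 'd \<Rightarrow> complex ^ 'n); wnorm K c \<le> R\<rbrakk> \<Longrightarrow>
    (\<exists>D a. coeffs_of D (\<lambda>x. f (tsum K c x) - f 0) a \<and> wnorm D a \<le> C1 * wnorm K c \<and> hnorm s D a \<le> C1 * hnorm s K c)" by blast
  from add.IH(2) obtain C2 where C2: "C2 \<ge> 0" 
    "\<And>K c. \<lbrakk>finite K; \<forall>k\<in>K. - k \<in> K; herm (c :: int ^ 'd \<Rightarrow> complex ^ 'n); wnorm K c \<le> R\<rbrakk> \<Longrightarrow>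
    (\<exists>D a. coeffs_of D (\<lambda>x. g (tsum K c x) - g 0) a \<and> wnorm D a \<le> C2 * wnorm K c \<and> hnorm s D a \<le> C2 * hnorm s K c)" by blast
  show ?case
  proof (rule exI[of _ "C1 + C2"], intro conjI allI impI)
    show "0 \<le> C1 + C2" using C1 C2 by simp
    fix K :: "(int ^ 'd) set" and c :: "int ^ 'd \<Rightarrow> complex ^ 'n"
    assume K: "finite K" "\<forall>k\<in>K. - k \<in> K" "herm c" "wnorm K c \<le> R"
    obtain D a where a: "coeffs_of D (\<lambda>x. f (tsum K c x) - f 0) a" "wnorm D a \<le> C1 * wnorm K c" "hnorm s D a \<le> C1 * hnorm s K c"
      using C1(2)[OF K] by blast
    obtain E b where b: "coeffs_of E (\<lambda>x. g (tsum K c x) - g 0) b" "wnorm E b \<le> C2 * wnorm K c" "hnorm s E b \<le> C2 * hnorm s K c"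
      using C2(2)[OF K] by blast
    note ab = coeffs_of_add[OF a(1) b(1)]
    have "coeffs_of (D \<union> E) (\<lambda>x. f (tsum K c x) + g (tsum K c x) - (f 0 + g 0)) (\<lambda>k. a k + b k)"
      using ab(1) by (simp add: algebra_simps)
    moreover have "wnorm (D \<union> E) (\<lambda>k. a k + b k) \<le> (C1 + C2) * wnorm K c"
      unfolding distrib_right using ab(2) a b by linarith
    moreover have "hnorm s (D \<union> E) (\<lambda>k. a k + b k) \<le> (C1 + C2) * hnorm s K c"
      unfolding distrib_right using ab(3)[of s] a b by linarith
    ultimately show "\<exists>D a. coeffs_of D (\<lambda>x. f (tsum K c x) + g (tsum K c x) - (f 0 + g 0)) a \<and>
       wnorm D a \<le> (C1 + C2) * wnorm K c \<and> hnorm s D a \<le> (C1 + C2) * hnorm s K c" by blast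
  qed
next
  case (mult f g)
  from mult.IH(1) obtain C1 where C1: "C1 \<ge> 0" 
    "\<And>K c. \<lbrakk>finite K; \<forall>k\<in>K. - k \<in> K; herm (c :: int ^ 'd \<Rightarrow> complex ^ 'n); wnorm K c \<le> R\<rbrakk> \<Longrightarrow>
    (\<exists>D a. coeffs_of D (\<lambda>x. f (tsum K c x) - f 0) a \<and> wnorm D a \<le> C1 * wnorm K c \<and> hnorm s D a \<le> C1 * hnorm s K c)" by blast
  from mult.IH(2) obtain C2 where C2: "C2 \<ge> 0" 
    "\<And>K c. \<lbrakk>finite K; \<forall>k\<in>K. - k \<in> K; herm (c :: int ^ 'd \<Rightarrow> complex ^ 'n); wnorm K c \<le> R\<rbrakk> \<Longrightarrow>
    (\<exists>D a. coeffs_of D (\<lambda>x. g (tsum K c x) - g 0) a \<and> wnorm D a \<le> C2 * wnorm K c \<and> hnorm s D a \<le> C2 * hnorm s K c)" by blast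
  let ?C = "2 * (C1 * C2 * R) + 2 powr s * (2 * (C1 * C2 * R)) + (\<bar>f 0\<bar> * C2 + \<bar>g 0\<bar> * C1)"
  show ?case
  proof (rule exI[of _ ?C], intro conjI allI impI)
    show "0 \<le> ?C" using C1 C2 R by (intro add_nonneg_nonneg mult_nonneg_nonneg) auto
    fix K :: "(int ^ 'd) set" and c :: "int ^ 'd \<Rightarrow> complex ^ 'n"
    assume K: "finite K" "\<forall>k\<in>K. - k \<in> K" "herm c" "wnorm K c \<le> R"
    define W where "W = wnorm K c"
    define H where "H = hnorm s K c"
    have W: "0 \<le> W" "W \<le> R" and H: "0 \<le> H" using K by (auto simp: W_def H_def)
    obtain D a where a: "coeffs_of D (\<lambda>x. f (tsum K c x) - f 0) a" "wnorm D a \<le> C1 * W" "hnorm s D a \<le> C1 * H"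
      using C1(2)[OF K] unfolding W_def H_def by blast
    obtain E b where b: "coeffs_of E (\<lambda>x. g (tsum K c x) - g 0) b" "wnorm E b \<le> C2 * W" "hnorm s E b \<le> C2 * H"
      using C2(2)[OF K] unfolding W_def H_def by blast
    obtain M e where e: "coeffs_of M (\<lambda>x. (f (tsum K c x) - f 0) * (g (tsum K c x) - g 0)) e"
      "wnorm M e \<le> 2 * (wnorm D a * wnorm E b)"
      "hnorm s M e \<le> 2 powr s * (hnorm s D a * wnorm E b + wnorm D a * hnorm s E b)"
      using coeffs_of_mult[OF a(1) b(1) s] by blast
    note a' = coeffs_of_cmult[OF a(1), of "g 0"] and b' = coeffs_of_cmult[OF b(1), of "f 0"]
    note ab = coeffs_of_add[OF a' b'] 
    note eab = coeffs_of_add[OF e(1) ab(1)]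
    \<comment> \<open>\<open>f g - f(0) g(0) = (f - f(0)) (g - g(0)) + g(0) (f - f(0)) + f(0) (g - g(0))\<close>\<close>
    have fin: "coeffs_of (M \<union> (D \<union> E)) (\<lambda>x. f (tsum K c x) * g (tsum K c x) - f 0 * g 0) (\<lambda>k. e k + (of_real (g 0) * a k + of_real (f 0) * b k))"
      using eab(1) by (simp add: algebra_simps)
    have C12: "0 \<le> C1 * C2" using C1 C2 by simp
    have aW: "wnorm D a * wnorm E b \<le> (C1 * C2 * R) * W"
    proof -
      have "wnorm D a * wnorm E b \<le> (C1 * W) * (C2 * W)" using a b C1 C2 W by (intro mult_mono) auto
      also have "\<dots> = (C1 * C2) * (W * W)" by (simp only: mult_ac)
      also have "\<dots> \<le> (C1 * C2) * (R * W)" using C12 W by (intro mult_left_mono mult_right_mono) auto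
      finally show ?thesis by (simp only: mult_ac)
    qed
    have aH: "hnorm s D a * wnorm E b + wnorm D a * hnorm s E b \<le> 2 * (C1 * C2 * R) * H"
    proof -
      have "hnorm s D a * wnorm E b \<le> (C1 * H) * (C2 * W)" using a b C1 C2 W H by (intro mult_mono) auto
      moreover have "wnorm D a * hnorm s E b \<le> (C1 * W) * (C2 * H)" using a b C1 C2 W H by (intro mult_mono) auto
      ultimately have "hnorm s D a * wnorm E b + wnorm D a * hnorm s E b \<le> 2 * (C1 * C2) * H * W" by (simp add: mult_ac)
      also have "\<dots> \<le> 2 * (C1 * C2) * H * R" using C12 W H by (intro mult_left_mono) auto
      finally show ?thesis by (simp only: mult_ac)
    qed
    have lW: "wnorm D (\<lambda>k. of_real (g 0) * a k) \<le> (\<bar>g 0\<bar> * C1) * W" "wnorm E (\<lambda>k. of_real (f 0) * b k) \<le> (\<bar>f 0\<bar> * C2) * W"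
      using mult_left_mono[OF a(2), of "\<bar>g 0\<bar>"] mult_left_mono[OF b(2), of "\<bar>f 0\<bar>"] by (simp_all add: wnorm_cmult mult.assoc)
    have lH: "hnorm s D (\<lambda>k. of_real (g 0) * a k) \<le> (\<bar>g 0\<bar> * C1) * H" "hnorm s E (\<lambda>k. of_real (f 0) * b k) \<le> (\<bar>f 0\<bar> * C2) * H"
      using mult_left_mono[OF a(3), of "\<bar>g 0\<bar>"] mult_left_mono[OF b(3), of "\<bar>f 0\<bar>"] by (simp_all add: hnorm_cmult mult.assoc)
    let ?X = "C1 * C2 * R"
    have X: "0 \<le> ?X" using C12 R by simp
    have "wnorm (M \<union> (D \<union> E)) (\<lambda>k. e k + (of_real (g 0) * a k + of_real (f 0) * b k)) \<le> ?C * W"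
    proof -
      have "0 \<le> 2 powr s * (2 * ?X) * W" using X W by simp
      then show ?thesis unfolding distrib_right using eab(2) ab(2) e(2) aW lW by linarith
    qed
    moreover have "hnorm s (M \<union> (D \<union> E)) (\<lambda>k. e k + (of_real (g 0) * a k + of_real (f 0) * b k)) \<le> ?C * H"
    proof -
      have "0 \<le> 2 * ?X * H" using X H by simp
      moreover have "hnorm s M e \<le> 2 powr s * (2 * ?X) * H"
        using order_trans[OF e(3) mult_left_mono[OF aH, of "2 powr s"]] by (simp add: mult.assoc)
      ultimately show ?thesis unfolding distrib_right using eab(3)[of s] ab(3)[of s] lH by linarith
    qed
    ultimately show "\<exists>D a. coeffs_of D (\<lambda>x. f (tsum K c x) * g (tsum K c x) - f 0 * g 0) a \<and>
       wnorm D a \<le> ?C * wnorm K c \<and> hnorm s D a \<le> ?C * hnorm s K c"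
      using fin unfolding W_def H_def by blast
  qed
qed

section \<open>The filter symbol\<close>

lemma powr_diff_le:
  fixes x y s :: real
  assumes "0 < x" "0 < y" "1 \<le> s"
  shows "\<bar>x powr s - y powr s\<bar> \<le> s * \<bar>x - y\<bar> * (max x y) powr (s - 1)"
proof -
  have gen: "v powr s - u powr s \<le> s * (v - u) * v powr (s - 1)" if "0 < u" "u < v" for u v :: real
  proof -
    have "\<exists>z>u. z < v \<and> v powr s - u powr s = (v - u) * (s * z powr (s - 1))"
      by (rule MVT2[OF that(2)]) (use that in \<open>auto intro!: derivative_eq_intros simp: powr_diff field_simps\<close>)
    then obtain z where z: "u < z" "z < v" "v powr s - u powr s = (v - u) * (s * z powr (s - 1))" by blast
    have "z powr (s - 1) \<le> v powr (s - 1)" using z that assms by (intro powr_mono2) auto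
    then have "(v - u) * (s * z powr (s - 1)) \<le> (v - u) * (s * v powr (s - 1))"
      using that assms by (intro mult_left_mono) auto
    then show ?thesis unfolding z(3) by (simp only: mult_ac)
  qed
  consider "x = y" | "x < y" | "y < x" by linarith
  then show ?thesis
  proof cases
    case 2
    then have "x powr s \<le> y powr s" using assms by (intro powr_mono2) auto
    then show ?thesis using gen[of x y] 2 assms by (simp add: max_def)
  next
    case 3
    then have "y powr s \<le> x powr s" using assms by (intro powr_mono2) auto
    then show ?thesis using gen[of y x] 3 assms by (simp add: max_def)
  qed simp
qed

lemma infnorm_freq_le:
  fixes k :: "int ^ 'd"
  assumes "k \<notin> band N" "N \<ge> 1"
  shows "1 \<le> infnorm ((1 / real N) *\<^sub>R freq k)"
proof -
  obtain j where "k $ j \<notin> {- int N..int N}" using assms by (auto simp: band_def)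
  then have "real N \<le> \<bar>real_of_int (k $ j)\<bar>" by (auto simp: abs_if)
  then have "1 \<le> \<bar>((1 / real N) *\<^sub>R freq k) $ j\<bar>" using assms by (simp add: field_simps)
  also have "\<dots> \<le> infnorm ((1 / real N) *\<^sub>R freq k)" by (rule component_le_infnorm_cart)
  finally show ?thesis .
qed

lemma cutoff_outside_band:
  assumes "admissible_cutoff chi" "k \<notin> band N" "N \<ge> 1"
  shows "chi ((1 / real N) *\<^sub>R freq k) = 0"
  using infnorm_freq_le[OF assms(2,3)] assms(1) by (simp add: admissible_cutoff_def)

text \<open>
  On the band a derivative costs at most a multiple of \<open>N\<close>.
\<close>

lemma bracket_band_le:
  fixes k :: "int ^ 'd"
  assumes "k \<in> band N" "N \<ge> 1"
  shows "bracket k \<le> (1 + real CARD('d)) * real N"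
proof -
  have "norm (freq k) \<le> (\<Sum>j\<in>UNIV. \<bar>freq k $ j\<bar>)" by (rule norm_le_l1_cart)
  also have "\<dots> \<le> (\<Sum>j\<in>(UNIV::'d set). real N)"
  proof (rule sum_mono)
    fix j
    have "- int N \<le> k $ j \<and> k $ j \<le> int N" using assms by (auto simp: band_def)
    then have "\<bar>k $ j\<bar> \<le> int N" by linarith
    then show "\<bar>freq k $ j\<bar> \<le> real N" by simp
  qed
  finally have n: "norm (freq k) \<le> real CARD('d) * real N" by simp
  have "bracket k \<le> 1 + norm (freq k)"
    using bracket_add_le_norm[of 0 k] by (simp add: bracket_def)
  also have "\<dots> \<le> real N + real CARD('d) * real N" using n assms by simp
  finally show ?thesis by (simp add: distrib_right)
qed

text \<open>
  The difference of the symbols is split into the difference of the powers, which the mean value theorem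
  controls by \<open>|k - l|\<close> times \<open>\<langle>l\<rangle>\<^bsup>s-1\<^esup> + \<langle>k - l\<rangle>\<^bsup>s-1\<^esup>\<close>, and \<open>\<langle>l\<rangle>\<^sup>s\<close> times the difference of the cutoffs,
  which is at most a multiple of \<open>|k - l| / N\<close>. The factor \<open>\<langle>l\<rangle>\<close> completes \<open>\<langle>l\<rangle>\<^bsup>s-1\<^esup>\<close> to \<open>\<langle>l\<rangle>\<^sup>s\<close> in the first part
  and is absorbed by \<open>1/N\<close> in the second one. This is the only place where the Lipschitz continuity of the
  square root of the cutoff enters, and it is the reason for a constant independent of \<open>N\<close>.
\<close>

lemma symbol_commutator:
  fixes chi :: "real ^ 'd \<Rightarrow> real"
  assumes chi: "admissible_cutoff chi" and s: "1 \<le> s"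
  shows "\<exists>L\<ge>0. \<forall>N\<ge>1. \<forall>k. \<forall>l\<in>band N.
    \<bar>bracket k powr s * sqrt (chi ((1 / real N) *\<^sub>R freq k)) - bracket l powr s * sqrt (chi ((1 / real N) *\<^sub>R freq l))\<bar> * bracket l
     \<le> L * (bracket (k - l) * bracket l powr s + bracket (k - l) powr s * bracket l)"
proof -
  obtain L0 where L0: "L0-lipschitz_on UNIV (\<lambda>x. sqrt (chi x))"
    using chi by (auto simp: admissible_cutoff_def)
  then have L0p: "0 \<le> L0" by (rule lipschitz_on_nonneg)
  define L1 where "L1 = s * 2 powr (s - 1)"
  define L2 where "L2 = L0 * (1 + real CARD('d))"
  have L12: "0 \<le> L1" "0 \<le> L2" using s L0p by (auto simp: L1_def L2_def)
  show ?thesis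
  proof (intro exI[of _ "L1 + L2"] conjI allI impI ballI)
    show "0 \<le> L1 + L2" using L12 by simp
    fix N :: nat and k l :: "int ^ 'd" assume N: "1 \<le> N" and l: "l \<in> band N"
    define th where "th k = sqrt (chi ((1 / real N) *\<^sub>R freq k))" for k :: "int ^ 'd"
    define b where "b = bracket l" 
    define q where "q = bracket (k - l)"
    have b: "1 \<le> b" and q: "1 \<le> q" by (auto simp: b_def q_def bracket_ge_1)
    have th: "0 \<le> th k" "th k \<le> 1" for k
      using chi by (auto simp: th_def admissible_cutoff_def)
    have d: "\<bar>bracket k - b\<bar> \<le> q"
      unfolding b_def q_def using order_trans[OF bracket_diff_le norm_freq_le_bracket] .
    have pd: "\<bar>bracket k powr s - b powr s\<bar> \<le> L1 * (q * (b powr (s - 1) + q powr (s - 1)))"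
    proof -
      have "\<bar>bracket k powr s - b powr s\<bar> \<le> s * \<bar>bracket k - b\<bar> * (max (bracket k) b) powr (s - 1)"
        using b s by (intro powr_diff_le) auto
      also have "\<dots> \<le> s * q * (b + q) powr (s - 1)"
      proof (intro mult_mono)
        show "max (bracket k) b powr (s - 1) \<le> (b + q) powr (s - 1)"
          using d b q s by (intro powr_mono2) auto
      qed (use d s q in auto)
      also have "\<dots> \<le> s * q * (2 powr (s - 1) * (b powr (s - 1) + q powr (s - 1)))"
        using b q s by (intro mult_left_mono powr_add_le) auto
      finally show ?thesis by (simp add: L1_def mult_ac)
    qed
    have td: "\<bar>th k - th l\<bar> * b \<le> L2 * q"
    proof -
      have "\<bar>th k - th l\<bar> \<le> L0 * dist ((1 / real N) *\<^sub>R freq k) ((1 / real N) *\<^sub>R freq l)"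
        using lipschitz_onD[OF L0, of "(1 / real N) *\<^sub>R freq k" "(1 / real N) *\<^sub>R freq l"] by (simp add: th_def dist_real_def)
      also have "dist ((1 / real N) *\<^sub>R freq k) ((1 / real N) *\<^sub>R freq l) = norm (freq (k - l)) / real N"
        by (simp add: dist_norm flip: scaleR_diff_right)
      also have "L0 * (norm (freq (k - l)) / real N) \<le> L0 * (q / real N)"
        unfolding q_def using L0p by (intro mult_left_mono divide_right_mono norm_freq_le_bracket) auto
      finally have "\<bar>th k - th l\<bar> * b \<le> L0 * (q / real N) * b" using b by (intro mult_right_mono) auto
      also have "\<dots> \<le> L0 * (q / real N) * ((1 + real CARD('d)) * real N)"
        unfolding b_def using L0p q by (intro mult_left_mono bracket_band_le l N) auto
      also have "\<dots> = L2 * q" using N by (simp add: L2_def)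
      finally show ?thesis .
    qed
    have "bracket k powr s * th k - b powr s * th l = (bracket k powr s - b powr s) * th k + b powr s * (th k - th l)"
      by (simp add: algebra_simps)
    then have "\<bar>bracket k powr s * th k - b powr s * th l\<bar> \<le> \<bar>bracket k powr s - b powr s\<bar> * \<bar>th k\<bar> + b powr s * \<bar>th k - th l\<bar>"
      using abs_triangle_ineq[of "(bracket k powr s - b powr s) * th k" "b powr s * (th k - th l)"] by (simp add: abs_mult)
    also have "\<dots> \<le> \<bar>bracket k powr s - b powr s\<bar> + b powr s * \<bar>th k - th l\<bar>"
      using th[of k] by (simp add: mult_left_le)
    finally have "\<bar>bracket k powr s * th k - b powr s * th l\<bar> * b \<le> (\<bar>bracket k powr s - b powr s\<bar> + b powr s * \<bar>th k - th l\<bar>) * b"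
      using b by (intro mult_right_mono) auto
    also have "\<dots> = \<bar>bracket k powr s - b powr s\<bar> * b + b powr s * (\<bar>th k - th l\<bar> * b)"
      by (simp add: algebra_simps)
    also have "\<dots> \<le> (L1 * (q * (b powr (s - 1) + q powr (s - 1)))) * b + b powr s * (L2 * q)"
      using pd td b by (intro add_mono mult_right_mono mult_left_mono) auto
    also have "\<dots> = L1 * (q * (b powr (s - 1) * b) + (q powr (s - 1) * q) * b) + L2 * (q * b powr s)"
      by (simp add: algebra_simps)
    also have "b powr (s - 1) * b = b powr s" using b by (simp add: powr_diff)
    also have "q powr (s - 1) * q = q powr s" using q by (simp add: powr_diff)
    also have "L1 * (q * b powr s + q powr s * b) + L2 * (q * b powr s) \<le> (L1 + L2) * (q * b powr s + q powr s * b)"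
      using L12 b q by (simp add: distrib_right distrib_left)
    finally show "\<bar>bracket k powr s * sqrt (chi ((1 / real N) *\<^sub>R freq k)) - bracket l powr s * sqrt (chi ((1 / real N) *\<^sub>R freq l))\<bar> * bracket l
      \<le> (L1 + L2) * (bracket (k - l) * bracket l powr s + bracket (k - l) powr s * bracket l)"
      by (simp only: th_def b_def q_def)
  qed
qed

section \<open>Energy estimate\<close>

text \<open>
  Symmetrisation: the terms for \<open>(k, l, p, q)\<close> and \<open>(l, k, q, p)\<close> involve conjugate products, so that
  their sum contains \<open>l\<^sub>j - k\<^sub>j\<close> in place of \<open>l\<^sub>j\<close>. In physical space this is the integration by parts
  \<open>2 \<integral> w \<bullet> a \<partial>\<^sub>j w = - \<integral> w \<bullet> (\<partial>\<^sub>j a) w\<close> for symmetric \<open>a\<close>.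
\<close>

lemma leading_term_bound:
  fixes w :: "int ^ 'd \<Rightarrow> complex ^ 'n" and a :: "'n \<Rightarrow> 'n \<Rightarrow> int ^ 'd \<Rightarrow> complex"
  assumes K: "finite K" and sym: "\<And>p q m. a p q m = a q p m" and herm: "\<And>p q m. a p q (- m) = cnj (a p q m)"
  shows "\<bar>\<Sum>k\<in>K. \<Sum>l\<in>K. \<Sum>p\<in>UNIV. \<Sum>q\<in>UNIV. Re (cnj (w k $ p) * a p q (k - l) * (\<i> * of_int (l $ j)) * w l $ q)\<bar>
    \<le> (\<Sum>p\<in>UNIV. \<Sum>q\<in>UNIV. \<Sum>k\<in>K. \<Sum>l\<in>K. cmod (w k $ p) * (bracket (k - l) * cmod (a p q (k - l))) * cmod (w l $ q))"
proof -
  define z where "z k l p q = cnj (w k $ p) * a p q (k - l) * w l $ q" for k l p q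
  define T where "T k l p q = Re (z k l p q * (\<i> * of_int (l $ j)))" for k l p q
  have nm: "cmod \<i> * cmod (of_int r) = \<bar>real_of_int r\<bar>" for r :: int by simp
  define S where "S = (\<Sum>k\<in>K. \<Sum>l\<in>K. \<Sum>p\<in>UNIV. \<Sum>q\<in>UNIV. T k l p q)"
  have zz: "z l k q p = cnj (z k l p q)" for k l p q
    using sym[of p q] herm[of p q "k - l"] by (simp add: z_def mult_ac)
  have swap: "T l k q p = - Re (z k l p q * (\<i> * of_int (k $ j)))" for k l p q
  proof -
    have e: "z l k q p = cnj (z k l p q)" by (rule zz)
    have "Re (z l k q p * y) = Re (cnj (z k l p q) * y)" for y by (simp only: e)
    then have "T l k q p = Re (cnj (z k l p q) * (\<i> * of_int (k $ j)))" unfolding T_def by blast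
    moreover have "Re (cnj y * (\<i> * of_int (k $ j))) = - Re (y * (\<i> * of_int (k $ j)))" for y
      by simp
    ultimately show ?thesis by presburger
  qed
  have "S = (\<Sum>k\<in>K. \<Sum>l\<in>K. \<Sum>p\<in>UNIV. \<Sum>q\<in>UNIV. T l k p q)"
    unfolding S_def by (rule sum.swap)
  also have "\<dots> = (\<Sum>k\<in>K. \<Sum>l\<in>K. \<Sum>p\<in>UNIV. \<Sum>q\<in>UNIV. T l k q p)"
    by (intro sum.cong refl sum.swap)
  finally have "2 * S = S + (\<Sum>k\<in>K. \<Sum>l\<in>K. \<Sum>p\<in>UNIV. \<Sum>q\<in>UNIV. T l k q p)" by simp
  also have "\<dots> = (\<Sum>k\<in>K. \<Sum>l\<in>K. \<Sum>p\<in>UNIV. \<Sum>q\<in>UNIV. T k l p q + T l k q p)"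
    unfolding S_def by (simp only: sum.distrib)
  also have "\<bar>\<dots>\<bar> \<le> (\<Sum>k\<in>K. \<Sum>l\<in>K. \<Sum>p\<in>UNIV. \<Sum>q\<in>UNIV. cmod (w k $ p) * (bracket (k - l) * cmod (a p q (k - l))) * cmod (w l $ q))"
  proof (rule order_trans[OF sum_abs sum_mono], rule order_trans[OF sum_abs sum_mono], 
      rule order_trans[OF sum_abs sum_mono], rule order_trans[OF sum_abs sum_mono])
    fix k l p q
    have "T k l p q + T l k q p = Re (z k l p q * (\<i> * of_int ((l - k) $ j)))"
      unfolding swap[of l k q p] unfolding T_def by (simp add: algebra_simps)
    also have "\<bar>\<dots>\<bar> \<le> cmod (z k l p q * (\<i> * of_int ((l - k) $ j)))" by (rule abs_Re_le_cmod)
    also have "\<dots> = cmod (z k l p q) * \<bar>real_of_int ((l - k) $ j)\<bar>" by (simp only: norm_mult nm)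
    also have "\<dots> \<le> cmod (z k l p q) * bracket (k - l)"
      using abs_nth_le_bracket[of "k - l" j] by (intro mult_left_mono) (auto simp: abs_minus_commute)
    finally show "\<bar>T k l p q + T l k q p\<bar> \<le> cmod (w k $ p) * (bracket (k - l) * cmod (a p q (k - l))) * cmod (w l $ q)"
      by (simp add: z_def norm_mult mult_ac)
  qed
  finally have "\<bar>S\<bar> \<le> (\<Sum>k\<in>K. \<Sum>l\<in>K. \<Sum>p\<in>UNIV. \<Sum>q\<in>UNIV. cmod (w k $ p) * (bracket (k - l) * cmod (a p q (k - l))) * cmod (w l $ q))"
    by linarith
  also have "\<dots> = (\<Sum>k\<in>K. \<Sum>p\<in>UNIV. \<Sum>q\<in>UNIV. \<Sum>l\<in>K. cmod (w k $ p) * (bracket (k - l) * cmod (a p q (k - l))) * cmod (w l $ q))"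
    by (rule sum.cong[OF refl], subst sum.swap, rule sum.cong[OF refl], rule sum.swap)
  also have "\<dots> = (\<Sum>p\<in>UNIV. \<Sum>q\<in>UNIV. \<Sum>k\<in>K. \<Sum>l\<in>K. cmod (w k $ p) * (bracket (k - l) * cmod (a p q (k - l))) * cmod (w l $ q))"
    by (subst sum.swap, rule sum.cong[OF refl], rule sum.swap)
  finally show ?thesis unfolding S_def T_def z_def by (simp only: mult_ac)
qed

text \<open>
  The energy estimate for one coefficient matrix, with a symbol \<open>m\<close> that satisfies the commutator estimate of
  \<open>symbol_commutator\<close>. Writing \<open>(m\<^sub>k)\<^sup>2 = m\<^sub>k m\<^sub>l + m\<^sub>k (m\<^sub>k - m\<^sub>l)\<close> separates the leading term from
  the commutator.
\<close>

lemma energy_bilinear_bound: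
  fixes c :: "int ^ 'd \<Rightarrow> complex ^ 'n" and a :: "'n \<Rightarrow> 'n \<Rightarrow> int ^ 'd \<Rightarrow> complex"
  assumes K: "finite K" and E: "finite E" "\<And>p q m. m \<notin> E \<Longrightarrow> a p q m = 0"
    and sym: "\<And>p q m. a p q m = a q p m" and herm: "\<And>p q m. a p q (- m) = cnj (a p q m)"
    and m: "\<And>k. 0 \<le> m k" "\<And>k. m k \<le> bracket k powr s" and L: "0 \<le> L"
    and comm: "\<And>k l. l \<in> K \<Longrightarrow> \<bar>m k - m l\<bar> * bracket l \<le> L * (bracket (k - l) * bracket l powr s + bracket (k - l) powr s * bracket l)"
    and C: "0 \<le> C" and aw: "\<And>p q. wnorm E (a p q) \<le> C * wnorm K c" and ah: "\<And>p q. hnorm s E (a p q) \<le> C * hnorm s K c"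
  shows "\<bar>\<Sum>k\<in>K. \<Sum>l\<in>K. \<Sum>p\<in>UNIV. \<Sum>q\<in>UNIV. Re (cnj (c k $ p) * of_real ((m k)\<^sup>2) * a p q (k - l) * (\<i> * of_int (l $ j)) * c l $ q)\<bar>
    \<le> (real CARD('n))\<^sup>2 * ((1 + 2 * L) * C) * wnorm K c * (hnorm s K c)\<^sup>2"
proof -
  let ?W = "wnorm K c" and ?H = "hnorm s K c"
  define w where "w k = m k *\<^sub>R c k" for k
  have wp: "w k $ p = of_real (m k) * c k $ p" for k p
    by (simp add: w_def scaleR_conv_of_real[where 'a=complex])
  define T1 where "T1 k l p q = Re (cnj (w k $ p) * a p q (k - l) * (\<i> * of_int (l $ j)) * w l $ q)" for k l p q
  define T2 where "T2 k l p q = Re (of_real (m k - m l) * (cnj (w k $ p) * a p q (k - l) * (\<i> * of_int (l $ j)) * c l $ q))" for k l p q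
  have split: "Re (cnj (c k $ p) * of_real ((m k)\<^sup>2) * a p q (k - l) * (\<i> * of_int (l $ j)) * c l $ q) = T1 k l p q + T2 k l p q" for k l p q
    unfolding T1_def T2_def plus_complex.sel(1)[symmetric]
    by (rule arg_cong[where f=Re]) (simp add: wp power2_eq_square algebra_simps)
  have wle: "L2_set (\<lambda>k. cmod (w k $ p)) K \<le> ?H" for p
    unfolding hnorm_def
  proof (rule L2_set_mono)
    fix k
    have "cmod (w k $ p) = m k * cmod (c k $ p)" using m(1) by (simp add: w_def)
    also have "\<dots> \<le> bracket k powr s * norm (c k)"
      using m by (intro mult_mono Finite_Cartesian_Product.norm_nth_le) auto
    finally show "cmod (w k $ p) \<le> bracket k powr s * norm (c k)" .
  qed simp
  have cle: "L2_set (\<lambda>k. bracket k powr s * cmod (c k $ q)) K \<le> ?H" for q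
    unfolding hnorm_def by (intro L2_set_mono mult_left_mono Finite_Cartesian_Product.norm_nth_le) auto
  have cw: "(\<Sum>l\<in>K. bracket l * cmod (c l $ q)) \<le> ?W" for q
    unfolding wnorm_def by (intro sum_mono mult_left_mono Finite_Cartesian_Product.norm_nth_le) auto
  have sumW: "(\<Sum>m\<in>E. bracket m * cmod (a p q m)) = wnorm E (a p q)" for p q by (simp only: wnorm_def)
  have sumH: "L2_set (\<lambda>m. bracket m powr s * cmod (a p q m)) E = hnorm s E (a p q)" for p q by (simp only: hnorm_def)
  have t1: "(\<Sum>k\<in>K. \<Sum>l\<in>K. cmod (w k $ p) * (bracket (k - l) * cmod (a p q (k - l))) * f l) \<le> C * ?W * ?H\<^sup>2"
    if f: "L2_set f K \<le> ?H" for p q f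
  proof -
    have "(\<Sum>k\<in>K. \<Sum>l\<in>K. cmod (w k $ p) * (bracket (k - l) * cmod (a p q (k - l))) * f l) \<le>
      L2_set (\<lambda>k. cmod (w k $ p)) K * ((\<Sum>m\<in>E. bracket m * cmod (a p q m)) * L2_set f K)"
      by (rule trilinear_l2_l1_l2[OF K E(1)]) (use E(2) in auto)
    also have "\<dots> \<le> ?H * ((C * ?W) * ?H)"
      unfolding sumW using f wle aw C by (intro mult_mono mult_nonneg_nonneg) auto
    finally show ?thesis by (simp add: power2_eq_square mult_ac)
  qed
  have t2: "(\<Sum>k\<in>K. \<Sum>l\<in>K. cmod (w k $ p) * (bracket (k - l) powr s * cmod (a p q (k - l))) * (bracket l * cmod (c l $ q))) \<le> C * ?W * ?H\<^sup>2" for p q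
  proof -
    have "(\<Sum>k\<in>K. \<Sum>l\<in>K. cmod (w k $ p) * (bracket (k - l) powr s * cmod (a p q (k - l))) * (bracket l * cmod (c l $ q))) \<le>
      L2_set (\<lambda>k. cmod (w k $ p)) K * (L2_set (\<lambda>m. bracket m powr s * cmod (a p q m)) E * (\<Sum>l\<in>K. bracket l * cmod (c l $ q)))"
      by (rule trilinear_l2_l2_l1[OF K E(1)]) (use E(2) in auto)
    also have "\<dots> \<le> ?H * ((C * ?H) * ?W)"
      unfolding sumH using cw wle ah C by (intro mult_mono mult_nonneg_nonneg sum_nonneg) auto
    finally show ?thesis by (simp add: power2_eq_square mult_ac)
  qed
  let ?n = "real CARD('n)"
  have "\<bar>\<Sum>k\<in>K. \<Sum>l\<in>K. \<Sum>p\<in>UNIV. \<Sum>q\<in>UNIV. T1 k l p q\<bar> \<le> (\<Sum>p\<in>(UNIV::'n set). \<Sum>q\<in>(UNIV::'n set). C * ?W * ?H\<^sup>2)"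
    unfolding T1_def
    by (rule order_trans[OF leading_term_bound[where a=a and w=w and j=j, OF K sym herm]]) (intro sum_mono t1 wle)
  then have b1: "\<bar>\<Sum>k\<in>K. \<Sum>l\<in>K. \<Sum>p\<in>UNIV. \<Sum>q\<in>UNIV. T1 k l p q\<bar> \<le> ?n\<^sup>2 * (C * ?W * ?H\<^sup>2)"
    by (simp add: power2_eq_square)
  have T2b: "\<bar>T2 k l p q\<bar> \<le> L * (cmod (w k $ p) * (bracket (k - l) * cmod (a p q (k - l))) * (bracket l powr s * cmod (c l $ q)))
     + L * (cmod (w k $ p) * (bracket (k - l) powr s * cmod (a p q (k - l))) * (bracket l * cmod (c l $ q)))" if "l \<in> K" for k l p q
  proof -
    have "\<bar>T2 k l p q\<bar> \<le> \<bar>m k - m l\<bar> * (cmod (w k $ p) * cmod (a p q (k - l)) * \<bar>real_of_int (l $ j)\<bar> * cmod (c l $ q))"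
      unfolding T2_def by (rule order_trans[OF abs_Re_le_cmod]) (simp add: norm_mult flip: of_real_diff)
    also have "\<dots> \<le> \<bar>m k - m l\<bar> * (cmod (w k $ p) * cmod (a p q (k - l)) * bracket l * cmod (c l $ q))"
      by (intro mult_left_mono mult_right_mono abs_nth_le_bracket mult_nonneg_nonneg) auto
    also have "\<dots> = (\<bar>m k - m l\<bar> * bracket l) * (cmod (w k $ p) * cmod (a p q (k - l)) * cmod (c l $ q))" by (simp only: mult_ac)
    also have "\<dots> \<le> (L * (bracket (k - l) * bracket l powr s + bracket (k - l) powr s * bracket l)) * (cmod (w k $ p) * cmod (a p q (k - l)) * cmod (c l $ q))"
      by (intro mult_right_mono comm that mult_nonneg_nonneg) auto
    finally show ?thesis by (simp only: distrib_left distrib_right mult_ac)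
  qed
  have "\<bar>\<Sum>k\<in>K. \<Sum>l\<in>K. \<Sum>p\<in>UNIV. \<Sum>q\<in>UNIV. T2 k l p q\<bar> \<le> 
     (\<Sum>k\<in>K. \<Sum>l\<in>K. \<Sum>p\<in>UNIV. \<Sum>q\<in>UNIV. L * (cmod (w k $ p) * (bracket (k - l) * cmod (a p q (k - l))) * (bracket l powr s * cmod (c l $ q)))
     + L * (cmod (w k $ p) * (bracket (k - l) powr s * cmod (a p q (k - l))) * (bracket l * cmod (c l $ q))))" (is "_ \<le> ?R")
    by (rule order_trans[OF sum_abs sum_mono], rule order_trans[OF sum_abs sum_mono], 
      rule order_trans[OF sum_abs sum_mono], rule order_trans[OF sum_abs sum_mono]) (rule T2b)
  also have "?R = (\<Sum>p\<in>UNIV. \<Sum>q\<in>UNIV. \<Sum>k\<in>K. \<Sum>l\<in>K. L * (cmod (w k $ p) * (bracket (k - l) * cmod (a p q (k - l))) * (bracket l powr s * cmod (c l $ q)))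
     + L * (cmod (w k $ p) * (bracket (k - l) powr s * cmod (a p q (k - l))) * (bracket l * cmod (c l $ q))))"
  proof -
    have sw: "(\<Sum>k\<in>K. \<Sum>l\<in>K. \<Sum>p\<in>UNIV. \<Sum>q\<in>UNIV. G k l p q) = (\<Sum>p\<in>UNIV. \<Sum>q\<in>UNIV. \<Sum>k\<in>K. \<Sum>l\<in>K. G k l p q)"
      for G :: "int ^ 'd \<Rightarrow> int ^ 'd \<Rightarrow> 'n \<Rightarrow> 'n \<Rightarrow> real"
    proof -
      have "(\<Sum>k\<in>K. \<Sum>l\<in>K. \<Sum>p\<in>UNIV. \<Sum>q\<in>UNIV. G k l p q) = (\<Sum>k\<in>K. \<Sum>p\<in>UNIV. \<Sum>q\<in>UNIV. \<Sum>l\<in>K. G k l p q)"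
        by (rule sum.cong[OF refl], subst sum.swap, rule sum.cong[OF refl], rule sum.swap)
      also have "\<dots> = (\<Sum>p\<in>UNIV. \<Sum>q\<in>UNIV. \<Sum>k\<in>K. \<Sum>l\<in>K. G k l p q)"
        by (subst sum.swap, rule sum.cong[OF refl], rule sum.swap)
      finally show ?thesis .
    qed
    show ?thesis by (rule sw)
  qed
  also have "\<dots> \<le> (\<Sum>p\<in>(UNIV::'n set). \<Sum>q\<in>(UNIV::'n set). L * (C * ?W * ?H\<^sup>2) + L * (C * ?W * ?H\<^sup>2))"
  proof (intro sum_mono)
    fix p q
    have "(\<Sum>k\<in>K. \<Sum>l\<in>K. L * (cmod (w k $ p) * (bracket (k - l) * cmod (a p q (k - l))) * (bracket l powr s * cmod (c l $ q)))
     + L * (cmod (w k $ p) * (bracket (k - l) powr s * cmod (a p q (k - l))) * (bracket l * cmod (c l $ q)))) =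
     L * (\<Sum>k\<in>K. \<Sum>l\<in>K. cmod (w k $ p) * (bracket (k - l) * cmod (a p q (k - l))) * (bracket l powr s * cmod (c l $ q))) +
     L * (\<Sum>k\<in>K. \<Sum>l\<in>K. cmod (w k $ p) * (bracket (k - l) powr s * cmod (a p q (k - l))) * (bracket l * cmod (c l $ q)))"
      by (simp only: sum.distrib sum_distrib_left)
    also have "\<dots> \<le> L * (C * ?W * ?H\<^sup>2) + L * (C * ?W * ?H\<^sup>2)"
      by (rule add_mono[OF mult_left_mono[OF t1[OF cle] L] mult_left_mono[OF t2 L]])
    finally show "(\<Sum>k\<in>K. \<Sum>l\<in>K. L * (cmod (w k $ p) * (bracket (k - l) * cmod (a p q (k - l))) * (bracket l powr s * cmod (c l $ q)))
     + L * (cmod (w k $ p) * (bracket (k - l) powr s * cmod (a p q (k - l))) * (bracket l * cmod (c l $ q)))) \<le>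
     L * (C * ?W * ?H\<^sup>2) + L * (C * ?W * ?H\<^sup>2)" .
  qed
  finally have b2: "\<bar>\<Sum>k\<in>K. \<Sum>l\<in>K. \<Sum>p\<in>UNIV. \<Sum>q\<in>UNIV. T2 k l p q\<bar> \<le> ?n\<^sup>2 * (2 * L * (C * ?W * ?H\<^sup>2))"
    by (simp add: power2_eq_square mult_ac)
  have "\<bar>\<Sum>k\<in>K. \<Sum>l\<in>K. \<Sum>p\<in>UNIV. \<Sum>q\<in>UNIV. T1 k l p q + T2 k l p q\<bar> \<le> ?n\<^sup>2 * (C * ?W * ?H\<^sup>2) + ?n\<^sup>2 * (2 * L * (C * ?W * ?H\<^sup>2))"
    unfolding sum.distrib by (rule order_trans[OF abs_triangle_ineq add_mono[OF b1 b2]])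
  also have "\<dots> = ?n\<^sup>2 * ((1 + 2 * L) * C) * ?W * ?H\<^sup>2" by (simp add: algebra_simps)
  finally show ?thesis unfolding split .
qed

section \<open>The filtered hyperbolic operator\<close>

definition flux :: "('d \<Rightarrow> real ^ 'n \<Rightarrow> real ^ 'n ^ 'n) \<Rightarrow> (real ^ 'd \<Rightarrow> real ^ 'n) \<Rightarrow> real ^ 'd \<Rightarrow> real ^ 'n" where
  "flux Q V x = (\<Sum>j\<in>UNIV. Q j (V x) *v partial_x j V x)"

text \<open>
  The common form of the two problems: a constant part without filter, and a filtered quasilinear part.
\<close>

definition hyp_op :: "(real ^ 'd \<Rightarrow> real) \<Rightarrow> ('d \<Rightarrow> real ^ 'n ^ 'n) \<Rightarrow> ('d \<Rightarrow> real ^ 'n \<Rightarrow> real ^ 'n ^ 'n) \<Rightarrow>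
     nat \<Rightarrow> (real ^ 'd \<Rightarrow> real ^ 'n) \<Rightarrow> real ^ 'd \<Rightarrow> real ^ 'n" where
  "hyp_op chi P Q N V x = (\<Sum>j\<in>UNIV. P j *v partial_x j V x) + smooth_filter chi N (flux Q V) x"

lemma fourier_multiplier_eq_tsum:
  assumes "finite K" "\<And>k. k \<notin> K \<Longrightarrow> m k = 0"
  shows "fourier_multiplier m f = tsum K (\<lambda>k. m k *\<^sub>R fourier_coeff f k)"
proof (rule ext, unfold vec_eq_iff, rule allI)
  fix x i
  have "(\<Sum>\<^sub>\<infinity>k. complex_of_real (m k) * (fourier_coeff f k $ i) * cis (freq k \<bullet> x)) =
     (\<Sum>\<^sub>\<infinity>k\<in>K. (m k *\<^sub>R fourier_coeff f k) $ i * expi k x)"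
    by (rule infsum_cong_neutral) (use assms in \<open>auto simp: expi_def scaleR_conv_of_real[where 'a=complex]\<close>)
  then show "fourier_multiplier m f x $ i = tsum K (\<lambda>k. m k *\<^sub>R fourier_coeff f k) x $ i"
    using assms(1) by (simp only: fourier_multiplier_def tsum_def vec_lambda_beta infsum_finite)
qed

text \<open>
  The cutoff vanishes outside the band, so the Fourier multiplier is a finite sum.
\<close>

lemma smooth_filter_eq_tsum:
  assumes "admissible_cutoff chi" "N \<ge> 1"
  shows "smooth_filter chi N f = tsum (band N) (\<lambda>k. chi ((1 / real N) *\<^sub>R freq k) *\<^sub>R fourier_coeff f k)"
  unfolding smooth_filter_def
  by (rule fourier_multiplier_eq_tsum) (use cutoff_outside_band[OF assms(1) _ assms(2)] in auto)

lemma sharp_filter_eq_tsum: "sharp_filter N f = tsum (band N) (fourier_coeff f)"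
proof -
  have "sharp_filter N f = tsum (band N) (\<lambda>k. indicator (band N) k *\<^sub>R fourier_coeff f k)"
    unfolding sharp_filter_def band_def[symmetric] by (rule fourier_multiplier_eq_tsum) auto
  also have "\<dots> = tsum (band N) (fourier_coeff f)"
    by (rule ext) (simp add: tsum_def)
  finally show ?thesis .
qed

lemma herm_filtered:
  assumes "admissible_cutoff chi" "herm c"
  shows "herm (\<lambda>k. chi ((1 / real N) *\<^sub>R freq k) *\<^sub>R c k)"
proof -
  have "chi ((1 / real N) *\<^sub>R freq (- k)) = chi ((1 / real N) *\<^sub>R freq k)" for k
    using assms(1) unfolding admissible_cutoff_def by (metis freq_simps(4) scaleR_minus_right)
  then show ?thesis using assms(2) by (simp add: herm_def scaleR_conv_of_real[where 'a=complex])
qed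

lemma fourier_coeff_smooth_filter:
  assumes "admissible_cutoff chi" "N \<ge> 1"
  shows "fourier_coeff (smooth_filter chi N f) k = chi ((1 / real N) *\<^sub>R freq k) *\<^sub>R fourier_coeff f k"
  unfolding smooth_filter_eq_tsum[OF assms]
  by (subst fourier_coeff_tsum[OF finite_band _ herm_filtered[OF assms(1) herm_fourier_coeff]])
     (use cutoff_outside_band[OF assms(1) _ assms(2)] in auto)

lemma continuous_on_polynomial:
  assumes "real_polynomial_function f" "continuous_on S V"
  shows "continuous_on S (\<lambda>x. f (V x))"
proof -
  have "continuous_on UNIV f"
    using assms(1) by (simp add: continuous_on_polymonial_function real_polynomial_function_eq)
  then show ?thesis using assms(2) by (rule continuous_on_compose2) auto
qed

lemma continuous_on_matrix_vector:
  fixes M :: "'x::topological_space \<Rightarrow> real ^ 'n ^ 'm"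
  assumes "\<And>p q. continuous_on S (\<lambda>x. M x $ p $ q)" "continuous_on S w"
  shows "continuous_on S (\<lambda>x. M x *v w x)"
  unfolding matrix_vector_mult_def
  by (intro continuous_on_vec_lambda continuous_on_sum continuous_on_mult assms(1) continuous_on_component assms(2))

context
  fixes s :: real and V :: "real ^ 'd \<Rightarrow> real ^ 'n"
  assumes s: "s > real CARD('d) / 2 + 1" and V: "Hs_differentiable s V"
begin

lemma continuous_flux_term:
  assumes "\<And>p q. real_polynomial_function (\<lambda>v. B v $ p $ q)"
  shows "continuous_on UNIV (\<lambda>x. B (V x) *v partial_x j V x)"
  by (intro continuous_on_matrix_vector continuous_on_polynomial[OF assms] Hs_differentiable_continuous[OF V] Hs_differentiable_partial(1)[OF s V])

lemma continuous_flux: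
  assumes "\<And>j p q. real_polynomial_function (\<lambda>v. Q j v $ p $ q)"
  shows "continuous_on UNIV (flux Q V)"
  unfolding flux_def by (intro continuous_on_sum continuous_flux_term assms)

lemma continuous_linear_part: "continuous_on UNIV (\<lambda>x. \<Sum>j\<in>UNIV. P j *v partial_x j V x)"
  by (intro continuous_on_sum continuous_on_matrix_vector continuous_on_const Hs_differentiable_partial(1)[OF s V])

lemma continuous_hyp_op:
  assumes "admissible_cutoff chi" "N \<ge> 1"
  shows "continuous_on UNIV (hyp_op chi P Q N V)"
  unfolding hyp_op_def smooth_filter_eq_tsum[OF assms]
  by (intro continuous_on_add continuous_linear_part continuous_on_tsum)

lemma fourier_coeff_hyp_op:
  assumes "admissible_cutoff chi" "N \<ge> 1"
  shows "fourier_coeff (hyp_op chi P Q N V) k =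
    (\<Sum>j\<in>UNIV. cmatvec (P j) ((\<i> * of_int (k $ j)) *s fourier_coeff V k)) +
    chi ((1 / real N) *\<^sub>R freq k) *\<^sub>R fourier_coeff (flux Q V) k"
proof -
  have "fourier_coeff (hyp_op chi P Q N V) k = 
    fourier_coeff (\<lambda>x. \<Sum>j\<in>UNIV. P j *v partial_x j V x) k + fourier_coeff (smooth_filter chi N (flux Q V)) k"
    unfolding hyp_op_def
    by (rule fourier_coeff_add[OF continuous_linear_part]) (simp add: smooth_filter_eq_tsum[OF assms] continuous_on_tsum)
  also have "fourier_coeff (\<lambda>x. \<Sum>j\<in>UNIV. P j *v partial_x j V x) k = (\<Sum>j\<in>UNIV. fourier_coeff (\<lambda>x. P j *v partial_x j V x) k)"
    by (intro fourier_coeff_sum continuous_on_matrix_vector continuous_on_const Hs_differentiable_partial(1)[OF s V])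
  also have "\<dots> = (\<Sum>j\<in>UNIV. cmatvec (P j) ((\<i> * of_int (k $ j)) *s fourier_coeff V k))"
    by (simp only: fourier_coeff_matrix[OF Hs_differentiable_partial(1)[OF s V]] Hs_differentiable_partial(2)[OF s V])
  finally show ?thesis by (simp only: fourier_coeff_smooth_filter[OF assms])
qed

lemma smooth_filter_sum:
  assumes "admissible_cutoff chi" "N \<ge> 1" "\<And>j. continuous_on UNIV (g j :: real ^ 'd \<Rightarrow> real ^ 'n)"
  shows "smooth_filter chi N (\<lambda>y. \<Sum>j\<in>(UNIV :: 'd set). g j y) x = (\<Sum>j\<in>UNIV. smooth_filter chi N (g j) x)"
proof -
  let ?t = "\<lambda>k. chi ((1 / real N) *\<^sub>R freq k)"
  have fc: "fourier_coeff (\<lambda>y. \<Sum>j\<in>UNIV. g j y) k = (\<Sum>j\<in>UNIV. fourier_coeff (g j) k)" for k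
    by (rule fourier_coeff_sum) (rule assms)
  have "tsum (band N) (\<lambda>k. ?t k *\<^sub>R (\<Sum>j\<in>UNIV. fourier_coeff (g j) k)) x $ i = 
    (\<Sum>j\<in>UNIV. tsum (band N) (\<lambda>k. ?t k *\<^sub>R fourier_coeff (g j) k) x) $ i" for i
  proof -
    have "(\<Sum>k\<in>band N. (?t k *\<^sub>R (\<Sum>j\<in>UNIV. fourier_coeff (g j) k)) $ i * expi k x) = 
       (\<Sum>k\<in>band N. \<Sum>j\<in>UNIV. (?t k *\<^sub>R fourier_coeff (g j) k) $ i * expi k x)"
      by (simp only: scaleR_sum_right sum_component sum_distrib_right)
    also have "\<dots> = (\<Sum>j\<in>UNIV. \<Sum>k\<in>band N. (?t k *\<^sub>R fourier_coeff (g j) k) $ i * expi k x)"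
      by (rule sum.swap)
    finally show ?thesis
      by (subst (asm) complex_eq_iff) (simp only: tsum_def vec_lambda_beta sum_component Re_sum)
  qed
  then show ?thesis unfolding smooth_filter_eq_tsum[OF assms(1,2)] fc by (simp add: vec_eq_iff)
qed

lemma filtered_nonlinear_eq_hyp_op:
  assumes "admissible_cutoff chi" "N \<ge> 1" and poly: "\<And>j p q. real_polynomial_function (\<lambda>v. A j v $ p $ q)"
  shows "filtered_nonlinear chi A N V = hyp_op chi (\<lambda>j. A j 0) (\<lambda>j v. A j v - A j 0) N V"
proof
  fix x
  have "real_polynomial_function (\<lambda>v. (A j v - A j 0) $ p $ q)" for j p q
    using real_polynomial_function_diff[OF poly[of j p q] real_polynomial_function.intros(2)[of "A j 0 $ p $ q"]] by simp
  from smooth_filter_sum[OF assms(1,2) continuous_flux_term[OF this]]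
  show "filtered_nonlinear chi A N V x = hyp_op chi (\<lambda>j. A j 0) (\<lambda>j v. A j v - A j 0) N V x"
    by (simp add: filtered_nonlinear_def hyp_op_def flux_def[abs_def] sum.distrib)
qed

end

lemma filtered_full_eq_hyp_op: "filtered_full chi A N V = hyp_op chi (\<lambda>_. 0) A N V"
  by (rule ext) (simp add: filtered_full_def hyp_op_def flux_def[abs_def])

lemma cfc_coeffs_of:
  assumes "coeffs_of D g a"
  shows "cfc (\<lambda>x. complex_of_real (g x)) k = a k"
proof -
  have "cfc (\<lambda>x. complex_of_real (g x)) k = cfc (\<lambda>x. \<Sum>l\<in>D. a l * expi l x) k"
    using assms by (simp add: coeffs_of_def)
  also have "\<dots> = (\<Sum>l\<in>D. a l * cfc (expi l) k)"
    by (subst cfc_sum) (auto intro!: continuous_intros simp: cfc_cmult)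
  also have "\<dots> = (\<Sum>l\<in>D. if k = l then a l else 0)"
    by (intro sum.cong refl) (simp add: cfc_expi)
  also have "\<dots> = a k"
    using assms by (auto simp: coeffs_of_def)
  finally show ?thesis .
qed

lemma cfc_mult_trig_sum:
  assumes "continuous_on UNIV h"
  shows "cfc (\<lambda>x. h x * (\<Sum>l\<in>K. w l * expi l x)) k = (\<Sum>l\<in>K. cfc h (k - l) * w l)"
proof -
  have "cfc (\<lambda>x. h x * (\<Sum>l\<in>K. w l * expi l x)) k = cfc (\<lambda>x. \<Sum>l\<in>K. w l * (h x * expi l x)) k"
    by (simp only: sum_distrib_left mult.left_commute)
  also have "\<dots> = (\<Sum>l\<in>K. cfc (\<lambda>x. w l * (h x * expi l x)) k)"
    by (intro cfc_sum continuous_intros assms)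
  finally show ?thesis by (simp only: cfc_cmult cfc_expi_mult mult.commute)
qed

text \<open>
  The part of \<open>Q\<close> at zero acts diagonally; the remainder acts by convolution with coefficients that are
  controlled by \<open>coeffs_of_polynomial\<close>.
\<close>

lemma fourier_coeff_flux_tsum:
  fixes c :: "int ^ 'd \<Rightarrow> complex ^ 'n"
  assumes poly: "\<And>j p q. real_polynomial_function (\<lambda>v. Q j v $ p $ q)"
    and K: "finite K" "\<And>k. k \<in> K \<Longrightarrow> - k \<in> K" and c: "herm c" and k: "k \<in> K"
  defines "\<alpha> \<equiv> \<lambda>j p q. cfc (\<lambda>x. complex_of_real (Q j (tsum K c x) $ p $ q - Q j 0 $ p $ q))"
  shows "fourier_coeff (flux Q (tsum K c)) k =
    (\<Sum>j\<in>UNIV. cmatvec (Q j 0) ((\<i> * of_int (k $ j)) *s c k)) +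
    (\<chi> p. \<Sum>j\<in>UNIV. \<Sum>q\<in>UNIV. \<Sum>l\<in>K. \<alpha> j p q (k - l) * (\<i> * of_int (l $ j) * c l $ q))"
  unfolding vec_eq_iff
proof
  fix p
  let ?V = "tsum K c"
  let ?w = "\<lambda>j q l. \<i> * of_int (l $ j) * c l $ q"
  have cQ: "continuous_on UNIV (\<lambda>x. Q j (?V x) $ p $ q)" for j q
    by (rule continuous_on_polynomial[OF poly continuous_on_tsum])
  have pd: "complex_of_real (partial_x j ?V x $ q) = (\<Sum>l\<in>K. ?w j q l * expi l x)" for j q x
    unfolding partial_tsum by (subst tsum_complex[OF K(2) herm_partial[OF c]]) (simp_all add: mult.assoc)
  have h0: "cfc (\<lambda>x. complex_of_real (Q j (?V x) $ p $ q)) m = (if m = 0 then of_real (Q j 0 $ p $ q) else 0) + \<alpha> j p q m" for j q m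
  proof -
    have "cfc (\<lambda>x. complex_of_real (Q j (?V x) $ p $ q)) m =
      cfc (\<lambda>x. complex_of_real (Q j 0 $ p $ q) * expi 0 x + complex_of_real (Q j (?V x) $ p $ q - Q j 0 $ p $ q)) m"
      by simp
    also have "\<dots> = cfc (\<lambda>x. complex_of_real (Q j 0 $ p $ q) * expi 0 x) m + \<alpha> j p q m"
      unfolding \<alpha>_def by (intro cfc_add continuous_intros cQ)
    finally show ?thesis by (simp only: cfc_cmult cfc_expi) simp
  qed
  have "fourier_coeff (flux Q ?V) k $ p = cfc (\<lambda>x. \<Sum>j\<in>UNIV. \<Sum>q\<in>UNIV. complex_of_real (Q j (?V x) $ p $ q) * (\<Sum>l\<in>K. ?w j q l * expi l x)) k"
    unfolding fourier_coeff_nth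
    by (rule arg_cong[where f="\<lambda>f. cfc f k"]) (simp only: flux_def sum_component matrix_vector_mult_def vec_lambda_beta of_real_sum of_real_mult pd)
  also have "\<dots> = (\<Sum>j\<in>UNIV. \<Sum>q\<in>UNIV. cfc (\<lambda>x. complex_of_real (Q j (?V x) $ p $ q) * (\<Sum>l\<in>K. ?w j q l * expi l x)) k)"
  proof -
    have cc: "continuous_on UNIV (\<lambda>x. complex_of_real (Q j (?V x) $ p $ q) * (\<Sum>l\<in>K. ?w j q l * expi l x))" for j q
      by (intro continuous_intros cQ)
    show ?thesis
      by (subst cfc_sum, rule continuous_on_sum, rule cc, rule sum.cong[OF refl], rule cfc_sum, rule cc)
  qed
  also have "\<dots> = (\<Sum>j\<in>UNIV. \<Sum>q\<in>UNIV. \<Sum>l\<in>K. cfc (\<lambda>x. complex_of_real (Q j (?V x) $ p $ q)) (k - l) * ?w j q l)"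
    by (intro sum.cong refl cfc_mult_trig_sum continuous_intros cQ)
  also have "\<dots> = (\<Sum>j\<in>UNIV. \<Sum>q\<in>UNIV. of_real (Q j 0 $ p $ q) * ?w j q k + (\<Sum>l\<in>K. \<alpha> j p q (k - l) * ?w j q l))"
  proof (intro sum.cong refl)
    fix j q
    have "(\<Sum>l\<in>K. cfc (\<lambda>x. complex_of_real (Q j (?V x) $ p $ q)) (k - l) * ?w j q l) = 
      (\<Sum>l\<in>K. (if k = l then of_real (Q j 0 $ p $ q) * ?w j q l else 0) + \<alpha> j p q (k - l) * ?w j q l)"
      by (intro sum.cong refl) (simp add: h0 distrib_right)
    also have "\<dots> = of_real (Q j 0 $ p $ q) * ?w j q k + (\<Sum>l\<in>K. \<alpha> j p q (k - l) * ?w j q l)"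
      unfolding sum.distrib using K k by simp
    finally show "(\<Sum>l\<in>K. cfc (\<lambda>x. complex_of_real (Q j (?V x) $ p $ q)) (k - l) * ?w j q l) = 
       of_real (Q j 0 $ p $ q) * ?w j q k + (\<Sum>l\<in>K. \<alpha> j p q (k - l) * ?w j q l)" .
  qed
  also have "\<dots> = (\<Sum>j\<in>UNIV. \<Sum>q\<in>UNIV. of_real (Q j 0 $ p $ q) * ?w j q k) + (\<Sum>j\<in>UNIV. \<Sum>q\<in>UNIV. \<Sum>l\<in>K. \<alpha> j p q (k - l) * ?w j q l)"
    by (simp only: sum.distrib)
  finally show "fourier_coeff (flux Q ?V) k $ p = ((\<Sum>j\<in>UNIV. cmatvec (Q j 0) ((\<i> * of_int (k $ j)) *s c k)) +
    (\<chi> p. \<Sum>j\<in>UNIV. \<Sum>q\<in>UNIV. \<Sum>l\<in>K. \<alpha> j p q (k - l) * ?w j q l)) $ p"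
    by (simp only: vector_add_component sum_component cmatvec_def vec_lambda_beta vector_smult_component)
qed

lemma inner_complex_Re: "x \<bullet> y = Re (cnj x * y)" for x y :: complex
  by (simp add: inner_complex_def)

text \<open>
  A real symmetric matrix times an imaginary number is skew-adjoint. Hence constant
  coefficients do not contribute to the energy, in whatever way they are filtered.
\<close>

lemma inner_skew:
  fixes A :: "real ^ 'n ^ 'n"
  assumes "transpose A = A"
  shows "z \<bullet> cmatvec A ((\<i> * of_int r) *s z) = 0"
proof -
  have sym: "A $ q $ p = A $ p $ q" for p q using assms by (metis transpose_def vec_lambda_beta)
  define T where "T p q = Re (cnj (z $ p) * (of_real (A $ p $ q) * (\<i> * of_int r * z $ q)))" for p q
  have neg: "T p q = - T q p" for p q
  proof -
    have "Re (cnj x * (of_real a * (\<i> * of_int r * y))) = - Re (cnj y * (of_real a * (\<i> * of_int r * x)))" for x y a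
      by (simp add: algebra_simps)
    then show ?thesis unfolding T_def sym[of q p] by blast
  qed
  have "(\<Sum>p\<in>UNIV. \<Sum>q\<in>UNIV. T p q) = (\<Sum>p\<in>UNIV. \<Sum>q\<in>UNIV. - T q p)"
    by (rule sum.cong[OF refl], rule sum.cong[OF refl], rule neg)
  also have "\<dots> = - (\<Sum>p\<in>UNIV. \<Sum>q\<in>UNIV. T q p)" by (simp only: sum_negf)
  also have "(\<Sum>p\<in>UNIV. \<Sum>q\<in>UNIV. T q p) = (\<Sum>p\<in>UNIV. \<Sum>q\<in>UNIV. T p q)" by (rule sum.swap)
  finally have "(\<Sum>p\<in>UNIV. \<Sum>q\<in>UNIV. T p q) = 0" by simp
  then show ?thesis
    by (simp only: inner_vec_def inner_complex_Re cmatvec_def vec_lambda_beta vector_smult_component sum_distrib_left Re_sum T_def)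
qed

text \<open>
  The constants of the composition and commutator estimates do not depend on \<open>N\<close>, and neither does \<open>C\<close>. The
  constant matrices \<open>P\<close> and \<open>Q(0)\<close> drop out by skewness, and \<open>Q - Q(0)\<close> is treated by
  \<open>energy_bilinear_bound\<close>; the factor \<open>\<chi>(k/N)\<close> of the filter is divided between the two arguments of the
  quadratic form, which explains the square root in the symbol \<open>m\<close>.
\<close>

lemma energy_estimate:
  fixes chi :: "real ^ 'd \<Rightarrow> real" and Q :: "'d \<Rightarrow> real ^ 'n \<Rightarrow> real ^ 'n ^ 'n"
  assumes chi: "admissible_cutoff chi" and symP: "\<And>j. transpose (P j) = P j"
    and symQ: "\<And>j v. transpose (Q j v) = Q j v"
    and poly: "\<And>j p q. real_polynomial_function (\<lambda>v. Q j v $ p $ q)"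
    and s: "1 \<le> s" and R: "0 \<le> R"
  shows "\<exists>C\<ge>0. \<forall>N\<ge>1. \<forall>c. herm c \<longrightarrow> wnorm (band N) c \<le> R \<longrightarrow>
    \<bar>\<Sum>k\<in>band N. bracket k powr (2 * s) * (c k \<bullet> fourier_coeff (hyp_op chi P Q N (tsum (band N) c)) k)\<bar>
     \<le> C * wnorm (band N) c * (hnorm s (band N) c)\<^sup>2"
proof -
  obtain L where L: "0 \<le> L" and comm: "\<And>N k l. 1 \<le> N \<Longrightarrow> l \<in> band N \<Longrightarrow> 
    \<bar>bracket k powr s * sqrt (chi ((1 / real N) *\<^sub>R freq k)) - bracket l powr s * sqrt (chi ((1 / real N) *\<^sub>R freq l))\<bar> * bracket l
     \<le> L * (bracket (k - l) * bracket l powr s + bracket (k - l) powr s * bracket l)"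
    using symbol_commutator[OF chi s] by blast
  define good where "good j p q C \<longleftrightarrow> C \<ge> 0 \<and> (\<forall>K (c :: int ^ 'd \<Rightarrow> complex ^ 'n). finite K \<longrightarrow> (\<forall>k\<in>K. - k \<in> K) \<longrightarrow> herm c \<longrightarrow> wnorm K c \<le> R \<longrightarrow>
    (\<exists>D a. coeffs_of D (\<lambda>x. Q j (tsum K c x) $ p $ q - Q j 0 $ p $ q) a \<and> wnorm D a \<le> C * wnorm K c \<and> hnorm s D a \<le> C * hnorm s K c))" for j p q C
  define C0 where "C0 j p q = (SOME C. good j p q C)" for j p q
  have "\<exists>C. good j p q C" for j p q
    unfolding good_def by (rule coeffs_of_polynomial[OF poly]) (use s R in auto)
  then have good: "good j p q (C0 j p q)" for j p q unfolding C0_def by (rule someI_ex)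
  have C0: "\<And>j p q. C0 j p q \<ge> 0" using good unfolding good_def by simp
  define C1 where "C1 = (\<Sum>j\<in>UNIV. \<Sum>p\<in>UNIV. \<Sum>q\<in>UNIV. C0 j p q)"
  have C1: "C0 j p q \<le> C1" for j p q
  proof -
    have "C0 j p q \<le> (\<Sum>q\<in>UNIV. C0 j p q)" using C0 by (intro member_le_sum) auto
    also have "\<dots> \<le> (\<Sum>p\<in>UNIV. \<Sum>q\<in>UNIV. C0 j p q)" 
      using C0 by (intro member_le_sum[of p UNIV "\<lambda>p. \<Sum>q\<in>UNIV. C0 j p q"]) (auto intro!: sum_nonneg)
    also have "\<dots> \<le> C1" unfolding C1_def
      using C0 by (intro member_le_sum[of j UNIV "\<lambda>j. \<Sum>p\<in>UNIV. \<Sum>q\<in>UNIV. C0 j p q"]) (auto intro!: sum_nonneg)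
    finally show ?thesis .
  qed
  have C1p: "0 \<le> C1" using C0 C1 order_trans by blast
  define C2 where "C2 = (real CARD('n))\<^sup>2 * ((1 + 2 * L) * C1)"
  show ?thesis
  proof (intro exI[of _ "real CARD('d) * C2"] conjI allI impI)
    show "0 \<le> real CARD('d) * C2" using L C1p by (simp add: C2_def)
    fix N :: nat and c :: "int ^ 'd \<Rightarrow> complex ^ 'n"
    assume N: "1 \<le> N" and c: "herm c" and W: "wnorm (band N) c \<le> R"
    let ?K = "band N :: (int ^ 'd) set"
    let ?V = "tsum ?K c"
    have K: "finite ?K" "\<And>k. k \<in> ?K \<Longrightarrow> - k \<in> ?K" by simp_all
    define \<alpha> where "\<alpha> j p q = cfc (\<lambda>x. complex_of_real (Q j (?V x) $ p $ q - Q j 0 $ p $ q))" for j p q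
    have ex: "\<exists>D. finite D \<and> (\<forall>k. k \<notin> D \<longrightarrow> \<alpha> j p q k = 0) \<and> wnorm D (\<alpha> j p q) \<le> C1 * wnorm ?K c \<and> hnorm s D (\<alpha> j p q) \<le> C1 * hnorm s ?K c" for j p q
    proof -
      obtain D a where a: "coeffs_of D (\<lambda>x. Q j (?V x) $ p $ q - Q j 0 $ p $ q) a" "wnorm D a \<le> C0 j p q * wnorm ?K c" "hnorm s D a \<le> C0 j p q * hnorm s ?K c"
        using good[of j p q, unfolded good_def] K c W by blast
      have "\<alpha> j p q = a" unfolding \<alpha>_def by (rule ext) (rule cfc_coeffs_of[OF a(1)])
      moreover have "C0 j p q * wnorm ?K c \<le> C1 * wnorm ?K c" "C0 j p q * hnorm s ?K c \<le> C1 * hnorm s ?K c"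
        by (intro mult_right_mono C1; simp)+
      ultimately show ?thesis using a by (intro exI[of _ D]) (auto simp: coeffs_of_def)
    qed
    define good' where "good' j p q D \<longleftrightarrow> finite D \<and> (\<forall>k. k \<notin> D \<longrightarrow> \<alpha> j p q k = 0) \<and> wnorm D (\<alpha> j p q) \<le> C1 * wnorm ?K c \<and> hnorm s D (\<alpha> j p q) \<le> C1 * hnorm s ?K c" for j p q D
    define D where "D j p q = (SOME D. good' j p q D)" for j p q
    have "good' j p q (D j p q)" for j p q
      unfolding D_def by (rule someI_ex) (use ex good'_def in blast)
    then have D: "\<And>j p q. finite (D j p q)" "\<And>j p q k. k \<notin> D j p q \<Longrightarrow> \<alpha> j p q k = 0" 
      "\<And>j p q. wnorm (D j p q) (\<alpha> j p q) \<le> C1 * wnorm ?K c" "\<And>j p q. hnorm s (D j p q) (\<alpha> j p q) \<le> C1 * hnorm s ?K c"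
      unfolding good'_def by simp_all
    define E where "E = (\<Union>j. \<Union>p. \<Union>q. D j p q)"
    have E: "finite E" using D(1) by (simp add: E_def)
    have DE: "D j p q \<subseteq> E" for j p q by (auto simp: E_def)
    have zE: "\<alpha> j p q m = 0" if "m \<notin> E" for j p q m using D(2) DE that by blast
    have wE: "wnorm E (\<alpha> j p q) \<le> C1 * wnorm ?K c" for j p q
    proof -
      have "wnorm E (\<alpha> j p q) = wnorm (D j p q) (\<alpha> j p q)"
        by (rule wnorm_enlarge[OF E DE]) (rule D(2))
      then show ?thesis using D(3)[of j p q] by simp
    qed
    have hE: "hnorm s E (\<alpha> j p q) \<le> C1 * hnorm s ?K c" for j p q
    proof -
      have "hnorm s E (\<alpha> j p q) = hnorm s (D j p q) (\<alpha> j p q)"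
        by (rule hnorm_enlarge[OF E DE]) (rule D(2))
      then show ?thesis using D(4)[of j p q] by simp
    qed
    have asym: "\<alpha> j p q m = \<alpha> j q p m" for j p q m
    proof -
      have sy: "Q j v $ p $ q = Q j v $ q $ p" for v
        using arg_cong[OF symQ[of j v], of "\<lambda>A. A $ q $ p"] by (simp add: transpose_def)
      show ?thesis unfolding \<alpha>_def by (simp only: sy)
    qed
    have aherm: "\<alpha> j p q (- m) = cnj (\<alpha> j p q m)" for j p q m
      using cfc_cnj[of "\<lambda>x. complex_of_real (Q j (?V x) $ p $ q - Q j 0 $ p $ q)" "- m"] by (simp add: \<alpha>_def)
    define th where "th k = chi ((1 / real N) *\<^sub>R freq k)" for k
    define m where "m k = bracket k powr s * sqrt (th k)" for k
    have th: "0 \<le> th k" "th k \<le> 1" for k using chi by (auto simp: th_def admissible_cutoff_def)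
    have m: "0 \<le> m k" "m k \<le> bracket k powr s" for k
      using th[of k] by (auto simp: m_def mult_left_le)
    have m2: "(m k)\<^sup>2 = bracket k powr (2 * s) * th k" for k
      using th[of k] by (simp add: m_def power_mult_distrib powr_power)
    define X where "X j k l p q = Re (cnj (c k $ p) * of_real ((m k)\<^sup>2) * \<alpha> j p q (k - l) * (\<i> * of_int (l $ j)) * c l $ q)" for j k l p q
    \<comment> \<open>Any exponent above \<open>d/2 + 1\<close> will do: a trigonometric polynomial lies in every Sobolev space.\<close>
    have nV: "Hs_differentiable (real CARD('d) / 2 + 2) ?V" by (rule Hs_differentiable_tsum) (use c in auto)
    have pwr: "bracket k powr (2 * s) * (c k \<bullet> fourier_coeff (hyp_op chi P Q N ?V) k) = (\<Sum>p\<in>UNIV. \<Sum>j\<in>UNIV. \<Sum>q\<in>UNIV. \<Sum>l\<in>?K. X j k l p q)"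
      if k: "k \<in> ?K" for k
    proof -
      have fk: "fourier_coeff ?V k = c k" using k c by (subst fourier_coeff_tsum) auto
      define S where "S = (\<chi> p. \<Sum>j\<in>UNIV. \<Sum>q\<in>UNIV. \<Sum>l\<in>?K. \<alpha> j p q (k - l) * (\<i> * of_int (l $ j) * c l $ q))"
      have "fourier_coeff (hyp_op chi P Q N ?V) k = (\<Sum>j\<in>UNIV. cmatvec (P j) ((\<i> * of_int (k $ j)) *s c k)) +
         th k *\<^sub>R ((\<Sum>j\<in>UNIV. cmatvec (Q j 0) ((\<i> * of_int (k $ j)) *s c k)) + S)"
        unfolding fourier_coeff_hyp_op[OF _ nV chi N, simplified] fk th_def S_def \<alpha>_def
        by (subst fourier_coeff_flux_tsum[OF poly K c k]) (assumption | rule refl)+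
      then have "c k \<bullet> fourier_coeff (hyp_op chi P Q N ?V) k = th k * (c k \<bullet> S)"
        by (simp add: inner_add_right inner_sum_right inner_skew[OF symP] inner_skew[OF symQ])
      then have "bracket k powr (2 * s) * (c k \<bullet> fourier_coeff (hyp_op chi P Q N ?V) k) = (m k)\<^sup>2 * (c k \<bullet> S)"
        by (simp add: m2)
      also have "\<dots> = (\<Sum>p\<in>UNIV. (m k)\<^sup>2 * Re (cnj (c k $ p) * S $ p))"
        by (simp only: inner_vec_def inner_complex_Re sum_distrib_left)
      also have "\<dots> = (\<Sum>p\<in>UNIV. \<Sum>j\<in>UNIV. \<Sum>q\<in>UNIV. \<Sum>l\<in>?K. X j k l p q)"
      proof (rule sum.cong[OF refl])
        fix p
        have re: "Re (of_real r * z) = r * Re z" for r z by simp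
        have "(m k)\<^sup>2 * Re (cnj (c k $ p) * S $ p) = Re (of_real ((m k)\<^sup>2) * (cnj (c k $ p) * S $ p))"
          by (rule re[symmetric])
        also have "of_real ((m k)\<^sup>2) * (cnj (c k $ p) * S $ p) = (\<Sum>j\<in>UNIV. \<Sum>q\<in>UNIV. \<Sum>l\<in>?K. cnj (c k $ p) * of_real ((m k)\<^sup>2) * \<alpha> j p q (k - l) * (\<i> * of_int (l $ j)) * c l $ q)"
          unfolding S_def vec_lambda_beta sum_distrib_left by (simp only: mult_ac)
        finally show "(m k)\<^sup>2 * Re (cnj (c k $ p) * S $ p) = (\<Sum>j\<in>UNIV. \<Sum>q\<in>UNIV. \<Sum>l\<in>?K. X j k l p q)"
          by (simp only: Re_sum X_def)
      qed
      finally show ?thesis .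
    qed
    have "(\<Sum>k\<in>?K. bracket k powr (2 * s) * (c k \<bullet> fourier_coeff (hyp_op chi P Q N ?V) k)) = 
      (\<Sum>k\<in>?K. \<Sum>p\<in>UNIV. \<Sum>j\<in>UNIV. \<Sum>q\<in>UNIV. \<Sum>l\<in>?K. X j k l p q)"
      by (rule sum.cong[OF refl pwr])
    also have "\<dots> = (\<Sum>k\<in>?K. \<Sum>j\<in>UNIV. \<Sum>p\<in>UNIV. \<Sum>q\<in>UNIV. \<Sum>l\<in>?K. X j k l p q)"
      by (rule sum.cong[OF refl sum.swap])
    also have "\<dots> = (\<Sum>j\<in>UNIV. \<Sum>k\<in>?K. \<Sum>p\<in>UNIV. \<Sum>q\<in>UNIV. \<Sum>l\<in>?K. X j k l p q)"
      by (rule sum.swap)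
    also have "\<dots> = (\<Sum>j\<in>UNIV. \<Sum>k\<in>?K. \<Sum>l\<in>?K. \<Sum>p\<in>UNIV. \<Sum>q\<in>UNIV. X j k l p q)"
    proof (intro sum.cong[OF refl])
      fix j k
      have "(\<Sum>p\<in>UNIV. \<Sum>q\<in>UNIV. \<Sum>l\<in>?K. X j k l p q) = (\<Sum>p\<in>UNIV. \<Sum>l\<in>?K. \<Sum>q\<in>UNIV. X j k l p q)"
        by (rule sum.cong[OF refl sum.swap])
      also have "\<dots> = (\<Sum>l\<in>?K. \<Sum>p\<in>UNIV. \<Sum>q\<in>UNIV. X j k l p q)" by (rule sum.swap)
      finally show "(\<Sum>p\<in>UNIV. \<Sum>q\<in>UNIV. \<Sum>l\<in>?K. X j k l p q) = (\<Sum>l\<in>?K. \<Sum>p\<in>UNIV. \<Sum>q\<in>UNIV. X j k l p q)" .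
    qed
    also have "\<bar>\<dots>\<bar> \<le> (\<Sum>j\<in>(UNIV::'d set). C2 * wnorm ?K c * (hnorm s ?K c)\<^sup>2)"
    proof (rule order_trans[OF sum_abs sum_mono])
      fix j
      show "\<bar>\<Sum>k\<in>?K. \<Sum>l\<in>?K. \<Sum>p\<in>UNIV. \<Sum>q\<in>UNIV. X j k l p q\<bar> \<le> C2 * wnorm ?K c * (hnorm s ?K c)\<^sup>2"
        unfolding X_def C2_def
      proof (rule energy_bilinear_bound[where a="\<alpha> j" and m=m and L=L and E=E])
        show "\<bar>m k - m l\<bar> * bracket l \<le> L * (bracket (k - l) * bracket l powr s + bracket (k - l) powr s * bracket l)" if "l \<in> ?K" for k l
          unfolding m_def th_def by (rule comm[OF N that])
      qed (use K E zE asym aherm m L C1p wE hE in auto)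
    qed
    finally show "\<bar>\<Sum>k\<in>?K. bracket k powr (2 * s) * (c k \<bullet> fourier_coeff (hyp_op chi P Q N ?V) k)\<bar> \<le> real CARD('d) * C2 * wnorm ?K c * (hnorm s ?K c)\<^sup>2"
      by (simp add: mult.assoc)
  qed
qed

section \<open>Local Lipschitz bounds\<close>

text \<open>
  Collects finitely many constants, one for each matrix entry, into one.
\<close>

lemma finite_uniform_constant:
  fixes G :: "'i::finite \<Rightarrow> real \<Rightarrow> bool"
  assumes ex: "\<And>i. \<exists>L\<ge>0. G i L" and mono: "\<And>i L L'. G i L \<Longrightarrow> L \<le> L' \<Longrightarrow> G i L'"
  shows "\<exists>L\<ge>0. \<forall>i. G i L"
proof -
  define f where "f i = (SOME L. 0 \<le> L \<and> G i L)" for i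
  have f: "0 \<le> f i \<and> G i (f i)" for i unfolding f_def by (rule someI_ex) (use ex in blast)
  have "f i \<le> (\<Sum>i\<in>UNIV. f i)" for i using f by (intro member_le_sum) auto
  then have "\<forall>i. G i (\<Sum>i\<in>UNIV. f i)" using f mono by blast
  moreover have "0 \<le> (\<Sum>i\<in>UNIV. f i)" using f by (intro sum_nonneg) auto
  ultimately show ?thesis by blast
qed

lemma polynomial_lipschitz_on_balls:
  fixes f :: "real ^ 'n \<Rightarrow> real"
  assumes "real_polynomial_function f" "0 \<le> R"
  shows "\<exists>L\<ge>0. \<forall>v w. norm v \<le> R \<longrightarrow> norm w \<le> R \<longrightarrow> \<bar>f v\<bar> \<le> L \<and> \<bar>f v - f w\<bar> \<le> L * norm (v - w)"
  using assms(1)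
proof induction
  case (linear f)
  interpret f: bounded_linear f by fact
  obtain K where K: "K \<ge> 0" "\<And>v. norm (f v) \<le> norm v * K" using f.nonneg_bounded by blast
  show ?case
  proof (intro exI[of _ "K * R + K"] conjI allI impI)
    show "0 \<le> K * R + K" using K assms by simp
    fix v w :: "real ^ 'n" assume v: "norm v \<le> R" "norm w \<le> R"
    have "norm v * K \<le> R * K" using v K by (intro mult_right_mono) auto
    then show "\<bar>f v\<bar> \<le> K * R + K" using K(2)[of v] K(1) by (simp add: mult.commute)
    have "\<bar>f v - f w\<bar> \<le> norm (v - w) * K" using K(2)[of "v - w"] by (simp add: f.diff)
    also have "\<dots> \<le> (K * R + K) * norm (v - w)" using K assms by (simp add: algebra_simps)
    finally show "\<bar>f v - f w\<bar> \<le> (K * R + K) * norm (v - w)" .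
  qed
next
  case (const c)
  show ?case by (rule exI[of _ "\<bar>c\<bar>"]) auto
next
  case (add f g)
  from add.IH obtain L M where L: "L \<ge> 0" "\<And>v w. norm v \<le> R \<Longrightarrow> norm w \<le> R \<Longrightarrow> \<bar>f v\<bar> \<le> L \<and> \<bar>f v - f w\<bar> \<le> L * norm (v - w)"
    and M: "M \<ge> 0" "\<And>v w. norm v \<le> R \<Longrightarrow> norm w \<le> R \<Longrightarrow> \<bar>g v\<bar> \<le> M \<and> \<bar>g v - g w\<bar> \<le> M * norm (v - w)" by metis
  show ?case
  proof (intro exI[of _ "L + M"] conjI allI impI)
    fix v w :: "real ^ 'n" assume v: "norm v \<le> R" "norm w \<le> R"
    show "\<bar>f v + g v\<bar> \<le> L + M" using L(2)[OF v] M(2)[OF v] by linarith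
    show "\<bar>f v + g v - (f w + g w)\<bar> \<le> (L + M) * norm (v - w)"
      using L(2)[OF v] M(2)[OF v] unfolding distrib_right by linarith
  qed (use L M in simp)
next
  case (mult f g)
  from mult.IH obtain L M where L: "L \<ge> 0" "\<And>v w. norm v \<le> R \<Longrightarrow> norm w \<le> R \<Longrightarrow> \<bar>f v\<bar> \<le> L \<and> \<bar>f v - f w\<bar> \<le> L * norm (v - w)"
    and M: "M \<ge> 0" "\<And>v w. norm v \<le> R \<Longrightarrow> norm w \<le> R \<Longrightarrow> \<bar>g v\<bar> \<le> M \<and> \<bar>g v - g w\<bar> \<le> M * norm (v - w)" by metis
  show ?case
  proof (intro exI[of _ "2 * (L * M)"] conjI allI impI)
    show "0 \<le> 2 * (L * M)" using L M by simp
    fix v w :: "real ^ 'n" assume v: "norm v \<le> R" "norm w \<le> R"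
    have LM: "0 \<le> L * M" using L M by simp
    have "\<bar>f v\<bar> * \<bar>g v\<bar> \<le> L * M" using L(2)[OF v] M(2)[OF v] by (intro mult_mono) auto
    then show "\<bar>f v * g v\<bar> \<le> 2 * (L * M)" using LM by (simp add: abs_mult)
    have "f v * g v - f w * g w = (f v - f w) * g v + f w * (g v - g w)" by (simp add: algebra_simps)
    then have "\<bar>f v * g v - f w * g w\<bar> \<le> \<bar>f v - f w\<bar> * \<bar>g v\<bar> + \<bar>f w\<bar> * \<bar>g v - g w\<bar>"
      using abs_triangle_ineq[of "(f v - f w) * g v" "f w * (g v - g w)"] by (simp add: abs_mult)
    also have "\<dots> \<le> (L * norm (v - w)) * M + L * (M * norm (v - w))"
      using L(2)[OF v] L(2)[OF v(2,1)] M(2)[OF v] L(1) M(1) by (intro add_mono mult_mono) auto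
    finally show "\<bar>f v * g v - f w * g w\<bar> \<le> 2 * (L * M) * norm (v - w)" by (simp add: algebra_simps)
  qed
qed

lemma matrix_vector_diff_le:
  fixes A B :: "real ^ 'n ^ 'n"
  assumes "\<And>p q. \<bar>A $ p $ q - B $ p $ q\<bar> \<le> a" "\<And>p q. \<bar>B $ p $ q\<bar> \<le> b" "norm v \<le> R" "norm (v - w) \<le> d" "0 \<le> a" "0 \<le> b"
  shows "norm (A *v v - B *v w) \<le> (real CARD('n))\<^sup>2 * (a * R + b * d)"
proof -
  have "norm (A *v v - B *v w) \<le> (\<Sum>p\<in>UNIV. norm ((A *v v - B *v w) $ p))" by (rule norm_vec_le_sum)
  also have "\<dots> \<le> (\<Sum>p\<in>(UNIV::'n set). \<Sum>q\<in>(UNIV::'n set). a * R + b * d)"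
  proof (rule sum_mono)
    fix p
    have "(A *v v - B *v w) $ p = (\<Sum>q\<in>UNIV. (A $ p $ q - B $ p $ q) * v $ q + B $ p $ q * (v - w) $ q)"
      by (simp add: matrix_vector_mult_def algebra_simps flip: sum_subtractf sum.distrib)
    also have "norm \<dots> \<le> (\<Sum>q\<in>(UNIV::'n set). a * R + b * d)"
    proof (rule order_trans[OF norm_sum sum_mono])
      fix q
      have "\<bar>v $ q\<bar> \<le> R" "\<bar>(v - w) $ q\<bar> \<le> d"
        using component_le_norm_cart[of v q] component_le_norm_cart[of "v - w" q] assms by linarith+
      then have "\<bar>A $ p $ q - B $ p $ q\<bar> * \<bar>v $ q\<bar> \<le> a * R" "\<bar>B $ p $ q\<bar> * \<bar>(v - w) $ q\<bar> \<le> b * d"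
        using assms by (auto intro!: mult_mono)
      then show "norm ((A $ p $ q - B $ p $ q) * v $ q + B $ p $ q * (v - w) $ q) \<le> a * R + b * d"
        using abs_triangle_ineq[of "(A $ p $ q - B $ p $ q) * v $ q" "B $ p $ q * (v - w) $ q"]
        unfolding real_norm_def abs_mult by linarith
    qed
    finally show "norm ((A *v v - B *v w) $ p) \<le> (\<Sum>q\<in>(UNIV::'n set). a * R + b * d)" .
  qed
  finally show ?thesis by (simp add: power2_eq_square mult.assoc)
qed

lemma norm_tsum_le: "norm (tsum K c x :: real ^ 'n) \<le> real CARD('n) * (\<Sum>k\<in>K. norm (c k))"
proof -
  have "norm (tsum K c x) \<le> (\<Sum>i\<in>UNIV. norm (tsum K c x $ i))" by (rule norm_vec_le_sum)
  also have "\<dots> \<le> (\<Sum>i\<in>(UNIV::'n set). \<Sum>k\<in>K. norm (c k))"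
  proof (rule sum_mono)
    fix i
    have "norm (tsum K c x $ i) \<le> cmod (\<Sum>k\<in>K. c k $ i * expi k x)"
      unfolding tsum_def vec_lambda_beta real_norm_def by (rule abs_Re_le_cmod)
    also have "\<dots> \<le> (\<Sum>k\<in>K. norm (c k))"
      by (rule order_trans[OF norm_sum sum_mono]) (simp add: norm_mult Finite_Cartesian_Product.norm_nth_le)
    finally show "norm (tsum K c x $ i) \<le> (\<Sum>k\<in>K. norm (c k))" .
  qed
  finally show ?thesis by simp
qed

lemma tsum_diff: "tsum K (\<lambda>k. a k - b k) x = tsum K a x - tsum K b x"
  by (simp add: tsum_def vec_eq_iff left_diff_distrib sum_subtractf)

text \<open>
  For fixed \<open>N\<close> the filter is bounded on continuous functions, because it is a finite sum of
  coefficients. The constant depends on \<open>N\<close>; it serves for existence and uniqueness, and never for the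
  estimates of the theorem.
\<close>

lemma hyp_op_lipschitz:
  fixes chi :: "real ^ 'd \<Rightarrow> real" and Q :: "'d \<Rightarrow> real ^ 'n \<Rightarrow> real ^ 'n ^ 'n"
  assumes chi: "admissible_cutoff chi" and N: "N \<ge> 1" and s: "s > real CARD('d) / 2 + 1"
    and poly: "\<And>j p q. real_polynomial_function (\<lambda>v. Q j v $ p $ q)" and R: "0 \<le> R"
  shows "\<exists>L\<ge>0. \<forall>V W d. Hs_differentiable s V \<longrightarrow> Hs_differentiable s W \<longrightarrow>
    (\<forall>x. norm (V x) \<le> R \<and> norm (W x) \<le> R \<and> norm (V x - W x) \<le> d) \<longrightarrow>
    (\<forall>j x. norm (partial_x j V x) \<le> R \<and> norm (partial_x j V x - partial_x j W x) \<le> d) \<longrightarrow>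
    (\<forall>x. norm (hyp_op chi P Q N V x - hyp_op chi P Q N W x) \<le> L * d)"
proof -
  let ?n = "real CARD('n)" and ?K = "band N :: (int ^ 'd) set"
  have "\<exists>L\<ge>0. \<forall>v w. norm v \<le> R \<longrightarrow> norm w \<le> R \<longrightarrow> \<bar>(case i of (j, p, q) \<Rightarrow> Q j v $ p $ q)\<bar> \<le> L \<and> 
     \<bar>(case i of (j, p, q) \<Rightarrow> Q j v $ p $ q) - (case i of (j, p, q) \<Rightarrow> Q j w $ p $ q)\<bar> \<le> L * norm (v - w)" for i
  proof -
    obtain j p q where i: "i = (j, p, q)" by (cases i)
    show ?thesis unfolding i prod.case by (rule polynomial_lipschitz_on_balls[OF poly R])
  qed
  then have "\<exists>L\<ge>0. \<forall>i. \<forall>v w. norm v \<le> R \<longrightarrow> norm w \<le> R \<longrightarrow> \<bar>(case i of (j, p, q) \<Rightarrow> Q j v $ p $ q)\<bar> \<le> L \<and> 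
     \<bar>(case i of (j, p, q) \<Rightarrow> Q j v $ p $ q) - (case i of (j, p, q) \<Rightarrow> Q j w $ p $ q)\<bar> \<le> L * norm (v - w)"
    by (rule finite_uniform_constant) (meson mult_right_mono norm_ge_zero order_trans)
  then obtain L where L: "0 \<le> L" and LQ: "\<forall>i. \<forall>v w. norm v \<le> R \<longrightarrow> norm w \<le> R \<longrightarrow> \<bar>(case i of (j, p, q) \<Rightarrow> Q j v $ p $ q)\<bar> \<le> L \<and> 
     \<bar>(case i of (j, p, q) \<Rightarrow> Q j v $ p $ q) - (case i of (j, p, q) \<Rightarrow> Q j w $ p $ q)\<bar> \<le> L * norm (v - w)" by blast
  have LQ': "\<bar>Q j v $ p $ q\<bar> \<le> L \<and> \<bar>Q j v $ p $ q - Q j w $ p $ q\<bar> \<le> L * norm (v - w)"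
    if "norm v \<le> R" "norm w \<le> R" for j p q v w
    using LQ[rule_format, of v w "(j, p, q)"] that by simp
  define M where "M = (\<Sum>j\<in>UNIV. \<Sum>p\<in>UNIV. \<Sum>q\<in>UNIV. \<bar>P j $ p $ q\<bar>)"
  have M: "\<bar>P j $ p $ q\<bar> \<le> M" for j p q
  proof -
    have "\<bar>P j $ p $ q\<bar> \<le> (\<Sum>q\<in>UNIV. \<bar>P j $ p $ q\<bar>)" by (intro member_le_sum) auto
    also have "\<dots> \<le> (\<Sum>p\<in>UNIV. \<Sum>q\<in>UNIV. \<bar>P j $ p $ q\<bar>)" 
      by (intro member_le_sum[of p UNIV "\<lambda>p. \<Sum>q\<in>UNIV. \<bar>P j $ p $ q\<bar>"]) (auto intro!: sum_nonneg)
    also have "\<dots> \<le> M" unfolding M_def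
      by (intro member_le_sum[of j UNIV "\<lambda>j. \<Sum>p\<in>UNIV. \<Sum>q\<in>UNIV. \<bar>P j $ p $ q\<bar>"]) (auto intro!: sum_nonneg)
    finally show ?thesis .
  qed
  then have M0: "0 \<le> M" using abs_ge_zero order_trans by blast
  define L1 where "L1 = real CARD('d) * (?n\<^sup>2 * (L * R + L))"
  define L2 where "L2 = real CARD('d) * (?n\<^sup>2 * M)"
  define L3 where "L3 = L2 + ?n * (real (card ?K) * (?n * L1))"
  have L123: "0 \<le> L1" "0 \<le> L2" "0 \<le> L3" using L R M0 by (auto simp: L1_def L2_def L3_def)
  show ?thesis
  proof (intro exI[of _ L3] conjI allI impI)
    show "0 \<le> L3" by fact
    fix V W :: "real ^ 'd \<Rightarrow> real ^ 'n" and d and x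
    assume V: "Hs_differentiable s V" and W: "Hs_differentiable s W"
      and b: "\<forall>x. norm (V x) \<le> R \<and> norm (W x) \<le> R \<and> norm (V x - W x) \<le> d"
      and bp: "\<forall>j x. norm (partial_x j V x) \<le> R \<and> norm (partial_x j V x - partial_x j W x) \<le> d"
    have d: "0 \<le> d" using b norm_ge_zero order_trans by blast
    have fl: "norm (flux Q V y - flux Q W y) \<le> L1 * d" for y
    proof -
      have "flux Q V y - flux Q W y = (\<Sum>j\<in>UNIV. Q j (V y) *v partial_x j V y - Q j (W y) *v partial_x j W y)"
        by (simp add: flux_def sum_subtractf)
      also have "norm \<dots> \<le> (\<Sum>j\<in>(UNIV::'d set). ?n\<^sup>2 * ((L * d) * R + L * d))"
      proof (rule order_trans[OF norm_sum sum_mono])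
        fix j
        have "L * norm (V y - W y) \<le> L * d" using b L by (intro mult_left_mono) auto
        then have q1: "\<bar>Q j (V y) $ p $ q - Q j (W y) $ p $ q\<bar> \<le> L * d" for p q
          using LQ'[of "V y" "W y" j p q] b by fastforce
        have q2: "\<bar>Q j (W y) $ p $ q\<bar> \<le> L" for p q
          using LQ'[of "W y" "W y" j p q] b by auto
        show "norm (Q j (V y) *v partial_x j V y - Q j (W y) *v partial_x j W y) \<le> ?n\<^sup>2 * ((L * d) * R + L * d)"
          by (rule matrix_vector_diff_le[OF q1 q2]) (use bp L d in auto)
      qed
      also have "\<dots> = L1 * d" by (simp add: L1_def algebra_simps)
      finally show ?thesis .
    qed
    have fc: "norm (fourier_coeff (flux Q V) k - fourier_coeff (flux Q W) k) \<le> ?n * (L1 * d)" for k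
    proof -
      have "fourier_coeff (flux Q V) k - fourier_coeff (flux Q W) k = fourier_coeff (\<lambda>y. flux Q V y - flux Q W y) k"
        by (rule fourier_coeff_diff[symmetric]; rule continuous_flux[OF s]) (use V W poly in auto)
      then show ?thesis using norm_fourier_coeff_le[of "\<lambda>y. flux Q V y - flux Q W y" "L1 * d" k] fl by simp
    qed
    have n0: "hyp_op chi P Q N V x - hyp_op chi P Q N W x = 
      (\<Sum>j\<in>UNIV. P j *v partial_x j V x - P j *v partial_x j W x) + (smooth_filter chi N (flux Q V) x - smooth_filter chi N (flux Q W) x)"
      by (simp add: hyp_op_def sum_subtractf)
    have n1: "norm (\<Sum>j\<in>UNIV. P j *v partial_x j V x - P j *v partial_x j W x) \<le> L2 * d"
    proof -
      have "norm (\<Sum>j\<in>UNIV. P j *v partial_x j V x - P j *v partial_x j W x) \<le> (\<Sum>j\<in>(UNIV::'d set). ?n\<^sup>2 * (0 * R + M * d))"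
        by (rule order_trans[OF norm_sum sum_mono], rule matrix_vector_diff_le) (use bp M M0 in auto)
      then show ?thesis by (simp add: L2_def algebra_simps)
    qed
    have n2: "norm (smooth_filter chi N (flux Q V) x - smooth_filter chi N (flux Q W) x) \<le> (?n * (real (card ?K) * (?n * L1))) * d"
    proof -
      let ?th = "\<lambda>k. chi ((1 / real N) *\<^sub>R freq k)"
      have "smooth_filter chi N (flux Q V) x - smooth_filter chi N (flux Q W) x = 
         tsum ?K (\<lambda>k. ?th k *\<^sub>R (fourier_coeff (flux Q V) k - fourier_coeff (flux Q W) k)) x"
        by (simp only: smooth_filter_eq_tsum[OF chi N] scaleR_diff_right tsum_diff)
      also have "norm \<dots> \<le> ?n * (\<Sum>k\<in>?K. norm (?th k *\<^sub>R (fourier_coeff (flux Q V) k - fourier_coeff (flux Q W) k)))"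
        by (rule norm_tsum_le)
      also have "\<dots> \<le> ?n * (\<Sum>k\<in>?K. ?n * (L1 * d))"
      proof (intro mult_left_mono sum_mono)
        fix k
        have "\<bar>?th k\<bar> \<le> 1" using chi by (auto simp: admissible_cutoff_def)
        then have "\<bar>?th k\<bar> * norm (fourier_coeff (flux Q V) k - fourier_coeff (flux Q W) k) \<le> 1 * (?n * (L1 * d))"
          using fc[of k] by (intro mult_mono) auto
        then show "norm (?th k *\<^sub>R (fourier_coeff (flux Q V) k - fourier_coeff (flux Q W) k)) \<le> ?n * (L1 * d)" by simp
      qed simp
      finally show ?thesis by (simp add: mult.assoc)
    qed
    show "norm (hyp_op chi P Q N V x - hyp_op chi P Q N W x) \<le> L3 * d"
      unfolding L3_def distrib_right n0 by (rule order_trans[OF norm_triangle_ineq add_mono[OF n1 n2]])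
  qed
qed

lemma Hs_differentiable_zero: "Hs_differentiable s (\<lambda>x :: real ^ 'd. 0 :: real ^ 'n)"
proof -
  have "(\<lambda>x. 0) = (tsum {} (\<lambda>_. 0) :: real ^ 'd \<Rightarrow> real ^ 'n)" by (rule ext) (simp add: tsum_def vec_eq_iff)
  then show ?thesis using Hs_differentiable_tsum[of "{}" "\<lambda>_. 0" s] by (simp add: herm_def)
qed

lemma partial_const [simp]: "partial_x j (\<lambda>x. c) x = 0"
  by (simp add: partial_x_def frechet_derivative_const)

lemma flux_zero: "flux Q (\<lambda>x. 0) = (\<lambda>x. 0)"
  by (rule ext) (simp add: flux_def)

lemma hyp_op_zero:
  assumes "admissible_cutoff chi" "N \<ge> 1"
  shows "hyp_op chi P Q N (\<lambda>x :: real ^ 'd. 0) x = (0 :: real ^ 'n)"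
proof -
  have "fourier_coeff (\<lambda>x :: real ^ 'd. 0 :: real ^ 'n) = (\<lambda>k. 0)"
    by (rule ext) (simp add: vec_eq_iff fourier_coeff_nth)
  moreover have "tsum K (\<lambda>k. 0) x = (0 :: real ^ 'n)" for K by (simp add: tsum_def vec_eq_iff)
  ultimately show ?thesis
    by (simp add: hyp_op_def flux_zero smooth_filter_eq_tsum[OF assms])
qed

text \<open>
  The Lipschitz bound, compared with the zero function.
\<close>

lemma hyp_op_bounded:
  fixes chi :: "real ^ 'd \<Rightarrow> real" and Q :: "'d \<Rightarrow> real ^ 'n \<Rightarrow> real ^ 'n ^ 'n"
  assumes chi: "admissible_cutoff chi" and N: "N \<ge> 1" and s: "s > real CARD('d) / 2 + 1"
    and poly: "\<And>j p q. real_polynomial_function (\<lambda>v. Q j v $ p $ q)" and R: "0 \<le> R"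
  shows "\<exists>B\<ge>0. \<forall>V. Hs_differentiable s V \<longrightarrow> (\<forall>x. norm (V x) \<le> R) \<longrightarrow> (\<forall>j x. norm (partial_x j V x) \<le> R) \<longrightarrow>
    (\<forall>x. norm (hyp_op chi P Q N V x) \<le> B)"
proof -
  obtain L where L: "0 \<le> L" and LL: "\<forall>V W d. Hs_differentiable s V \<longrightarrow> Hs_differentiable s W \<longrightarrow>
    (\<forall>x. norm (V x) \<le> R \<and> norm (W x) \<le> R \<and> norm (V x - W x) \<le> d) \<longrightarrow>
    (\<forall>j x. norm (partial_x j V x) \<le> R \<and> norm (partial_x j V x - partial_x j W x) \<le> d) \<longrightarrow>
    (\<forall>x. norm (hyp_op chi P Q N V x - hyp_op chi P Q N W x) \<le> L * d)"
    using hyp_op_lipschitz[where P=P and Q=Q, OF chi N s poly R] by blast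
  show ?thesis
  proof (intro exI[of _ "L * R"] conjI allI impI)
    show "0 \<le> L * R" using L R by simp
    fix V :: "real ^ 'd \<Rightarrow> real ^ 'n" and x assume V: "Hs_differentiable s V" "\<forall>x. norm (V x) \<le> R" "\<forall>j x. norm (partial_x j V x) \<le> R"
    have "norm (hyp_op chi P Q N V x - hyp_op chi P Q N (\<lambda>x. 0) x) \<le> L * R"
      by (rule LL[rule_format, OF V(1) Hs_differentiable_zero]) (use V R in auto)
    then show "norm (hyp_op chi P Q N V x) \<le> L * R" by (simp add: hyp_op_zero[OF chi N])
  qed
qed

section \<open>Fourier coefficients of classical solutions\<close>

lemma cfc_tendsto_dominated:
  fixes g :: "nat \<Rightarrow> real ^ 'd \<Rightarrow> complex"
  assumes cg: "\<And>n. continuous_on UNIV (g n)" and ch: "continuous_on UNIV h"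
    and lim: "\<And>x. (\<lambda>n. g n x) \<longlonglongrightarrow> h x" and bd: "\<And>n x. cmod (g n x) \<le> B"
  shows "(\<lambda>n. cfc (g n) k) \<longlonglongrightarrow> cfc h k"
proof -
  let ?e = "\<lambda>x. cis (- (freq k \<bullet> x))"
  have c: "continuous_on UNIV (\<lambda>x. g n x * ?e x)" "continuous_on UNIV (\<lambda>x. h x * ?e x)" for n
    by (intro continuous_intros cg ch)+
  have "(\<lambda>n. LINT x:period_cell|lborel. g n x * ?e x) \<longlonglongrightarrow> (LINT x:period_cell|lborel. h x * ?e x)"
    unfolding set_lebesgue_integral_def
  proof (rule integral_dominated_convergence)
    show "integrable lborel (\<lambda>x::real^'d. indicat_real period_cell x *\<^sub>R B)"
      using set_integrable_continuous_cell(1)[of "\<lambda>_::real^'d. B"] by (simp add: set_integrable_def)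
    show "(\<lambda>x. indicat_real period_cell x *\<^sub>R (h x * ?e x)) \<in> borel_measurable lborel"
      using set_integrable_continuous_cell(1)[OF c(2)] unfolding set_integrable_def by (rule borel_measurable_integrable)
    show "(\<lambda>x. indicat_real period_cell x *\<^sub>R (g n x * ?e x)) \<in> borel_measurable lborel" for n
      using set_integrable_continuous_cell(1)[OF c(1)] unfolding set_integrable_def by (rule borel_measurable_integrable)
    show "AE x in lborel. (\<lambda>n. indicat_real period_cell x *\<^sub>R (g n x * ?e x)) \<longlonglongrightarrow> indicat_real period_cell x *\<^sub>R (h x * ?e x)"
      by (intro AE_I2 tendsto_intros lim)
    show "AE x in lborel. norm (indicat_real period_cell x *\<^sub>R (g n x * ?e x)) \<le> indicat_real period_cell x *\<^sub>R B" for n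
      using bd by (intro AE_I2) (auto simp: norm_mult indicator_def)
  qed
  then show ?thesis
    unfolding cfc_def set_integrable_continuous_cell(3)[OF c(1)] set_integrable_continuous_cell(3)[OF c(2)]
    by (rule tendsto_mult_left)
qed

lemma has_vector_derivative_limit_iff:
  "(f has_vector_derivative D) (at t) \<longleftrightarrow> ((\<lambda>h. (1 / h) *\<^sub>R (f (t + h) - f t)) \<longlongrightarrow> D) (at 0)"
proof -
  have e: "norm (f (t + h) - f t - h *\<^sub>R D) / norm h = norm ((1 / h) *\<^sub>R (f (t + h) - f t) - D)" if "h \<noteq> 0" for h
  proof -
    have "(1 / h) *\<^sub>R (f (t + h) - f t) - D = (1 / h) *\<^sub>R (f (t + h) - f t - h *\<^sub>R D)"
      using that by (simp add: scaleR_diff_right)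
    then show ?thesis by simp
  qed
  have "(f has_vector_derivative D) (at t) \<longleftrightarrow> ((\<lambda>h. norm (f (t + h) - f t - h *\<^sub>R D) / norm h) \<longlongrightarrow> 0) (at 0)"
    unfolding has_vector_derivative_def has_derivative_at by (simp add: bounded_linear_scaleR_left)
  also have "\<dots> \<longleftrightarrow> ((\<lambda>h. norm ((1 / h) *\<^sub>R (f (t + h) - f t) - D)) \<longlongrightarrow> 0) (at 0)"
    by (rule tendsto_cong, unfold eventually_at_filter, intro always_eventually allI impI, rule e)
  also have "\<dots> \<longleftrightarrow> ((\<lambda>h. (1 / h) *\<^sub>R (f (t + h) - f t)) \<longlongrightarrow> D) (at 0)"
    by (simp add: tendsto_norm_zero_iff LIM_zero_iff)
  finally show ?thesis .
qed

lemma partial_x_diff: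
  assumes "V differentiable (at x)" "W differentiable (at x)"
  shows "partial_x j (\<lambda>x. V x - W x) x = partial_x j V x - partial_x j W x"
proof -
  have "((\<lambda>x. V x - W x) has_derivative (\<lambda>h. frechet_derivative V (at x) h - frechet_derivative W (at x) h)) (at x)"
    using assms by (intro has_derivative_diff) (auto simp: frechet_derivative_works)
  from frechet_derivative_at[OF this] show ?thesis by (simp add: partial_x_def fun_eq_iff)
qed

text \<open>
  The operator of either problem at a fixed \<open>N\<close>. It agrees with \<open>hyp_op\<close> on the functions that occur as
  values of classical solutions. The identification uses linearity of the filter, which is available for
  continuous arguments only; for arbitrary functions the integrals may fail to be additive.
\<close>

locale filtered_problem =
  fixes chi :: "real ^ 'd \<Rightarrow> real" and P :: "'d \<Rightarrow> real ^ 'n ^ 'n" and Q :: "'d \<Rightarrow> real ^ 'n \<Rightarrow> real ^ 'n ^ 'n"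
    and N :: nat and s :: real and F :: "(real ^ 'd \<Rightarrow> real ^ 'n) \<Rightarrow> real ^ 'd \<Rightarrow> real ^ 'n"
  assumes chi: "admissible_cutoff chi" and N: "N \<ge> 1" and s: "s > real CARD('d) / 2 + 1"
    and symP: "\<And>j. transpose (P j) = P j"
    and poly: "\<And>j p q. real_polynomial_function (\<lambda>v. Q j v $ p $ q)"
    and F: "\<And>V. Hs_differentiable s V \<Longrightarrow> F V = hyp_op chi P Q N V"
begin

abbreviation "K \<equiv> band N :: (int ^ 'd) set"

lemma classical_Hs_differentiable: "classical_solution F u0 s I U \<Longrightarrow> t \<in> I \<Longrightarrow> Hs_differentiable s (U t)"
  by (simp add: classical_solution_def Hs_differentiable_def C0_Hs_def)

lemma continuous_F: "Hs_differentiable s V \<Longrightarrow> continuous_on UNIV (F V)"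
  using continuous_hyp_op[OF s _ chi N] F by simp

text \<open>
  Continuity in time with values in \<open>H\<^sup>s\<close> and the Sobolev embedding bound solution and gradient, and
  hence the time derivative, uniformly in space near a given time.
\<close>

lemma classical_local_bound:
  assumes U: "classical_solution F u0 s I U" and t: "t \<in> I"
  shows "\<exists>\<delta>>0. \<exists>B\<ge>0. \<forall>\<tau>. \<bar>\<tau> - t\<bar> < \<delta> \<longrightarrow> \<tau> \<in> I \<and> (\<forall>x. norm (F (U \<tau>) x) \<le> B)"
proof -
  have I: "open I" using U by (simp add: classical_solution_def)
  have "((\<lambda>\<tau>. Hs_norm s (\<lambda>x. U \<tau> x - U t x)) \<longlongrightarrow> 0) (at t within I)"
    using U t by (simp add: classical_solution_def C0_Hs_def)
  then have lim: "((\<lambda>\<tau>. Hs_norm s (\<lambda>x. U \<tau> x - U t x)) \<longlongrightarrow> 0) (at t)"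
    using at_within_open[OF t I] by simp
  have ev1: "\<forall>\<^sub>F \<tau> in at t. Hs_norm s (\<lambda>x. U \<tau> x - U t x) < 1"
    by (rule order_tendstoD(2)[OF lim]) simp
  have "Hs_norm s (\<lambda>x. U t x - U t x) = 0"
    by (simp add: Hs_norm_def fourier_coeff_def zero_vec_def[symmetric])
  with ev1 have ev2: "\<forall>\<^sub>F \<tau> in nhds t. Hs_norm s (\<lambda>x. U \<tau> x - U t x) < 1"
    by (simp add: eventually_nhds_conv_at)
  have "\<forall>\<^sub>F \<tau> in nhds t. \<tau> \<in> I" using I t by (rule eventually_nhds_in_open)
  with ev2 have "\<forall>\<^sub>F \<tau> in nhds t. \<tau> \<in> I \<and> Hs_norm s (\<lambda>x. U \<tau> x - U t x) < 1" by eventually_elim simp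
  then obtain \<delta> where \<delta>: "\<delta> > 0" "\<And>\<tau>. dist \<tau> t < \<delta> \<Longrightarrow> \<tau> \<in> I \<and> Hs_norm s (\<lambda>x. U \<tau> x - U t x) < 1"
    unfolding eventually_nhds_metric by blast
  obtain b where b: "b > 0" and bb: "\<forall>V :: real ^ 'd \<Rightarrow> real ^ 'n. Hs_differentiable s V \<longrightarrow>
    (\<forall>x j. norm (V x) \<le> b * Hs_norm s V \<and> norm (partial_x j V x) \<le> b * Hs_norm s V)"
    using Hs_differentiable_bounds[OF s, where 'n='n] by blast
  define R where "R = b * (Hs_norm s (U t) + 1)"
  have R: "0 \<le> R" using b by (simp add: R_def)
  obtain B where B: "B \<ge> 0" and BB: "\<forall>V. Hs_differentiable s V \<longrightarrow> (\<forall>x. norm (V x) \<le> R) \<longrightarrow> (\<forall>j x. norm (partial_x j V x) \<le> R) \<longrightarrow>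
    (\<forall>x. norm (hyp_op chi P Q N V x) \<le> B)"
    using hyp_op_bounded[where P=P and Q=Q, OF chi N s poly R] by blast
  have "\<tau> \<in> I \<and> norm (F (U \<tau>) x) \<le> B" if "\<bar>\<tau> - t\<bar> < \<delta>" for \<tau> x
  proof -
    have \<tau>: "\<tau> \<in> I" "Hs_norm s (\<lambda>x. U \<tau> x - U t x) < 1" using \<delta>(2)[of \<tau>] that by (auto simp: dist_real_def)
    have n\<tau>: "Hs_differentiable s (U \<tau>)" and nt: "Hs_differentiable s (U t)" using classical_Hs_differentiable[OF U] \<tau> t by auto
    note nd = Hs_differentiable_diff[OF n\<tau> nt]
    have le: "b * Hs_norm s (\<lambda>x. U \<tau> x - U t x) \<le> b" using b \<tau> by (simp add: mult_left_le)
    have "norm (U \<tau> y) \<le> R" for y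
    proof -
      have "norm (U \<tau> y - U t y) \<le> b" using bb[rule_format, OF nd, of y undefined] le by linarith
      moreover have "norm (U t y) \<le> b * Hs_norm s (U t)" using bb[rule_format, OF nt, of y] by blast
      ultimately show ?thesis using norm_triangle_sub[of "U \<tau> y" "U t y"] by (simp add: R_def distrib_left)
    qed
    moreover have "norm (partial_x j (U \<tau>) y) \<le> R" for j y
    proof -
      have "partial_x j (\<lambda>x. U \<tau> x - U t x) y = partial_x j (U \<tau>) y - partial_x j (U t) y"
        by (rule partial_x_diff) (use n\<tau> nt in \<open>auto simp: Hs_differentiable_def\<close>)
      then have "norm (partial_x j (U \<tau>) y - partial_x j (U t) y) \<le> b" using bb[rule_format, OF nd, of y j] le by auto
      moreover have "norm (partial_x j (U t) y) \<le> b * Hs_norm s (U t)" using bb[rule_format, OF nt, of y j] by blast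
      ultimately show ?thesis using norm_triangle_sub[of "partial_x j (U \<tau>) y" "partial_x j (U t) y"] by (simp add: R_def distrib_left)
    qed
    ultimately show ?thesis using BB n\<tau> F \<tau> by simp
  qed
  then show ?thesis using \<delta>(1) B by blast
qed

text \<open>
  The time derivative of a classical solution is a pointwise limit. It may be
  taken under the Fourier integral by dominated convergence, since the difference quotients are
  bounded by \<open>classical_local_bound\<close>.
\<close>

lemma classical_fourier_ode:
  assumes U: "classical_solution F u0 s I U" and t: "t \<in> I"
  shows "((\<lambda>\<tau>. fourier_coeff (U \<tau>) k) has_vector_derivative - fourier_coeff (F (U t)) k) (at t)"
proof -
  obtain \<delta> B where \<delta>: "\<delta> > 0" and B: "B \<ge> 0" and bd: "\<And>\<tau>. \<bar>\<tau> - t\<bar> < \<delta> \<Longrightarrow> \<tau> \<in> I \<and> (\<forall>x. norm (F (U \<tau>) x) \<le> B)"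
    using classical_local_bound[OF U t] by blast
  have dU: "((\<lambda>\<tau>. U \<tau> x) has_vector_derivative - F (U \<tau>) x) (at \<tau>)" if "\<tau> \<in> I" for x \<tau>
    using U that by (simp add: classical_solution_def)
  have lip: "norm (U (t + h) x - U t x) \<le> B * \<bar>h\<bar>" if "\<bar>h\<bar> < \<delta>" for h x
  proof -
    have "norm (U (t + h) x - U t x) \<le> B * norm (t + h - t)"
    proof (rule differentiable_bound[where f="\<lambda>\<tau>. U \<tau> x" and S="{t - \<delta><..<t + \<delta>}" and f'="\<lambda>\<tau> h. h *\<^sub>R - F (U \<tau>) x"])
      fix \<tau> assume "\<tau> \<in> {t - \<delta><..<t + \<delta>}"
      then have \<tau>: "\<bar>\<tau> - t\<bar> < \<delta>" by auto
      show "((\<lambda>\<tau>. U \<tau> x) has_derivative (\<lambda>h. h *\<^sub>R - F (U \<tau>) x)) (at \<tau> within {t - \<delta><..<t + \<delta>})"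
        using dU bd[OF \<tau>] unfolding has_vector_derivative_def by (meson has_derivative_at_withinI)
      show "onorm (\<lambda>h. h *\<^sub>R - F (U \<tau>) x) \<le> B"
      proof (rule onorm_bound[OF B])
        fix h
        have "\<bar>h\<bar> * norm (F (U \<tau>) x) \<le> \<bar>h\<bar> * B" using bd[OF \<tau>] by (intro mult_left_mono) auto
        then show "norm (h *\<^sub>R - F (U \<tau>) x) \<le> B * norm h" by (simp add: mult.commute)
      qed
    qed (use that \<delta> in auto)
    then show ?thesis by simp
  qed
  have nU: "Hs_differentiable s (U t)" using classical_Hs_differentiable[OF U t] .
  have lim: "((\<lambda>h. (1 / h) *\<^sub>R (U (t + h) x - U t x)) \<longlongrightarrow> - F (U t) x) (at 0)" for x
    using dU[OF t] by (simp add: has_vector_derivative_limit_iff)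
  have cfl: "((\<lambda>h. cfc (\<lambda>x. complex_of_real (((1 / h) *\<^sub>R (U (t + h) x - U t x)) $ i)) k) \<longlongrightarrow> 
    cfc (\<lambda>x. complex_of_real ((- F (U t) x) $ i)) k) (at 0)" for i
  proof -
    have at: "at (0::real) = at 0 within {- \<delta><..<\<delta>}" using \<delta> by (intro at_within_open[symmetric]) auto
    show ?thesis unfolding at tendsto_at_iff_sequentially o_def
    proof (intro allI impI)
      fix X :: "nat \<Rightarrow> real" assume X: "\<forall>n. X n \<in> {- \<delta><..<\<delta>} - {0}" and X0: "X \<longlonglongrightarrow> 0"
      then have Xn: "X n \<noteq> 0" "\<bar>X n\<bar> < \<delta>" for n by (auto simp: abs_less_iff) (metis greaterThanLessThan_iff minus_less_iff)
      show "(\<lambda>n. cfc (\<lambda>x. complex_of_real (((1 / X n) *\<^sub>R (U (t + X n) x - U t x)) $ i)) k) \<longlonglongrightarrow> 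
         cfc (\<lambda>x. complex_of_real ((- F (U t) x) $ i)) k"
      proof (rule cfc_tendsto_dominated)
        fix n
        have "t + X n \<in> I" using bd[of "t + X n"] Xn by simp
        then have "continuous_on UNIV (U (t + X n))" using classical_Hs_differentiable[OF U] Hs_differentiable_continuous by blast
        then show "continuous_on UNIV (\<lambda>x. complex_of_real (((1 / X n) *\<^sub>R (U (t + X n) x - U t x)) $ i))"
          by (intro continuous_intros Hs_differentiable_continuous[OF nU])
        fix x
        have "\<bar>((1 / X n) *\<^sub>R (U (t + X n) x - U t x)) $ i\<bar> \<le> norm ((1 / X n) *\<^sub>R (U (t + X n) x - U t x))"
          by (rule component_le_norm_cart)
        also have "\<dots> \<le> B" using lip[of "X n" x] Xn[of n] by (simp add: divide_simps mult.commute)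
        finally show "cmod (complex_of_real (((1 / X n) *\<^sub>R (U (t + X n) x - U t x)) $ i)) \<le> B"
          by (simp only: norm_of_real)
      next
        show "continuous_on UNIV (\<lambda>x. complex_of_real ((- F (U t) x) $ i))"
          by (intro continuous_intros continuous_F[OF nU])
        fix x
        have fl: "filterlim X (at 0) sequentially"
          using X0 Xn by (intro filterlim_atI) auto
        show "(\<lambda>n. complex_of_real (((1 / X n) *\<^sub>R (U (t + X n) x - U t x)) $ i)) \<longlonglongrightarrow> complex_of_real ((- F (U t) x) $ i)"
          by (intro tendsto_of_real tendsto_vec_nth filterlim_compose[OF lim fl])
      qed
    qed
  qed
  have "((\<lambda>h. (1 / h) *\<^sub>R (fourier_coeff (U (t + h)) k - fourier_coeff (U t) k)) \<longlongrightarrow> - fourier_coeff (F (U t)) k) (at 0)"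
  proof (rule vec_tendstoI)
    fix i
    have lhs: "((1 / h) *\<^sub>R (fourier_coeff (U (t + h)) k - fourier_coeff (U t) k)) $ i = 
       cfc (\<lambda>x. complex_of_real (((1 / h) *\<^sub>R (U (t + h) x - U t x)) $ i)) k" if "\<bar>h\<bar> < \<delta>" for h
    proof -
      have "Hs_differentiable s (U (t + h))" using bd[of "t + h"] that classical_Hs_differentiable[OF U] by simp
      then have "fourier_coeff (\<lambda>x. (1 / h) *\<^sub>R (U (t + h) x - U t x)) k = (1 / h) *\<^sub>R (fourier_coeff (U (t + h)) k - fourier_coeff (U t) k)"
        using nU by (simp only: fourier_coeff_scaleR fourier_coeff_diff Hs_differentiable_continuous)
      then show ?thesis by (simp only: fourier_coeff_nth[symmetric])
    qed
    have rhs: "(- fourier_coeff (F (U t)) k) $ i = cfc (\<lambda>x. complex_of_real ((- F (U t) x) $ i)) k"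
      by (simp only: fourier_coeff_minus[symmetric] fourier_coeff_nth)
    have "\<forall>\<^sub>F h in at 0. \<bar>h\<bar> < \<delta>"
      using \<delta> unfolding eventually_at by (intro exI[of _ \<delta>]) (auto simp: dist_real_def)
    then have "\<forall>\<^sub>F h in at 0. ((1 / h) *\<^sub>R (fourier_coeff (U (t + h)) k - fourier_coeff (U t) k)) $ i = 
       cfc (\<lambda>x. complex_of_real (((1 / h) *\<^sub>R (U (t + h) x - U t x)) $ i)) k"
      by eventually_elim (rule lhs)
    from tendsto_cong[OF this] show "((\<lambda>h. ((1 / h) *\<^sub>R (fourier_coeff (U (t + h)) k - fourier_coeff (U t) k)) $ i) \<longlongrightarrow> (- fourier_coeff (F (U t)) k) $ i) (at 0)"
      unfolding rhs using cfl[of i] by blast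
  qed
  then show ?thesis by (simp only: has_vector_derivative_limit_iff)
qed

text \<open>
  Outside the band only the constant part of the operator survives, so \<open>|U\<^sub>k|\<^sup>2\<close> is conserved by
  \<open>inner_skew\<close>, and the initial value has no such frequencies.
\<close>

lemma classical_band_limited:
  assumes U: "classical_solution F (sharp_filter N U0) s I U" and t: "t \<in> I"
  shows "k \<notin> K \<Longrightarrow> fourier_coeff (U t) k = 0" "U t = tsum K (fourier_coeff (U t))"
proof -
  have I: "open I" "is_interval I" "0 \<in> I" and U0: "U 0 = sharp_filter N U0"
    using U by (auto simp: classical_solution_def)
  show z: "fourier_coeff (U t) k = 0" if k: "k \<notin> K" for k
  proof -
    have d: "((\<lambda>\<tau>. fourier_coeff (U \<tau>) k \<bullet> fourier_coeff (U \<tau>) k) has_vector_derivative 0) (at \<tau> within I)" if \<tau>: "\<tau> \<in> I" for \<tau>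
    proof -
      have n: "Hs_differentiable s (U \<tau>)" by (rule classical_Hs_differentiable[OF U \<tau>])
      have "fourier_coeff (F (U \<tau>)) k = (\<Sum>j\<in>UNIV. cmatvec (P j) ((\<i> * of_int (k $ j)) *s fourier_coeff (U \<tau>) k))"
        using cutoff_outside_band[OF chi k N] by (simp add: F[OF n] fourier_coeff_hyp_op[OF s n chi N])
      then have "fourier_coeff (U \<tau>) k \<bullet> fourier_coeff (F (U \<tau>)) k = 0"
        by (simp add: inner_sum_right inner_skew[OF symP])
      then have "((\<lambda>\<tau>. fourier_coeff (U \<tau>) k \<bullet> fourier_coeff (U \<tau>) k) has_vector_derivative 0) (at \<tau>)"
        using bounded_bilinear.has_vector_derivative[OF bounded_bilinear_inner classical_fourier_ode[OF U \<tau>, of k] classical_fourier_ode[OF U \<tau>, of k]]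
        by (simp add: inner_commute)
      then show ?thesis by (rule has_vector_derivative_at_within)
    qed
    have "convex I" using I is_interval_convex by blast
    from has_vector_derivative_zero_constant[OF this d] obtain c where c: "\<And>\<tau>. \<tau> \<in> I \<Longrightarrow> fourier_coeff (U \<tau>) k \<bullet> fourier_coeff (U \<tau>) k = c" by blast
    have "fourier_coeff (U 0) k = 0"
      unfolding U0 sharp_filter_eq_tsum using k by (subst fourier_coeff_tsum) (auto simp: herm_fourier_coeff)
    then have "c = 0" using c[OF I(3)] by simp
    then show ?thesis using c[OF t] by simp
  qed
  show "U t = tsum K (fourier_coeff (U t))"
  proof (rule fourier_coeff_inject)
    have n: "Hs_differentiable s (U t)" by (rule classical_Hs_differentiable[OF U t])
    show "continuous_on UNIV (U t)" by (rule Hs_differentiable_continuous[OF n])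
    show "U t (x + axis j (2 * pi)) = U t x" for x j using n by (simp add: Hs_differentiable_def Hs_periodic[of _ s])
    show "fourier_coeff (U t) k = fourier_coeff (tsum K (fourier_coeff (U t))) k" for k
      using z[of k] by (subst fourier_coeff_tsum) (auto simp: herm_fourier_coeff)
  qed (simp_all add: continuous_on_tsum)
qed

end

section \<open>Global solutions of ordinary differential equations with a Lipschitz field\<close>

instance bcontfun :: (metric_space, banach) banach ..

text \<open>
  The oriented integral from \<open>0\<close> to \<open>t\<close>; for negative \<open>t\<close> the interval \<open>{0..t}\<close> is empty.
\<close>

definition primitive :: "(real \<Rightarrow> 'a::banach) \<Rightarrow> real \<Rightarrow> 'a" where
  "primitive h t = (if 0 \<le> t then integral {0..t} h else - integral {t..0} h)"

lemma primitive_0 [simp]: "primitive h 0 = 0"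
  by (simp add: primitive_def)

lemma primitive_diff:
  assumes "continuous_on UNIV f" "continuous_on UNIV g"
  shows "primitive (\<lambda>t. f t - g t) t = primitive f t - primitive g t"
proof -
  have "f integrable_on {a..b}" "g integrable_on {a..b}" for a b :: real
    using assms by (auto intro!: integrable_continuous_real intro: continuous_on_subset)
  then show ?thesis by (simp add: primitive_def integral_diff)
qed

lemma has_vector_derivative_primitive:
  assumes h: "continuous_on UNIV h"
  shows "(primitive h has_vector_derivative h t) (at t)"
proof -
  define b where "b = \<bar>t\<bar> + 1"
  have int: "h integrable_on {x..y}" for x y :: real
    using h by (auto intro!: integrable_continuous_real intro: continuous_on_subset)
  have eq: "primitive h \<tau> = integral {- b..\<tau>} h - integral {- b..0} h" if "\<tau> \<in> {- b..b}" for \<tau>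
  proof (cases "0 \<le> \<tau>")
    case True
    have "integral {- b..0} h + integral {0..\<tau>} h = integral {- b..\<tau>} h"
      by (rule Henstock_Kurzweil_Integration.integral_combine[OF _ True int]) (simp add: b_def)
    then show ?thesis using True by (simp add: primitive_def algebra_simps)
  next
    case False
    have "integral {- b..\<tau>} h + integral {\<tau>..0} h = integral {- b..0} h"
      by (rule Henstock_Kurzweil_Integration.integral_combine[OF _ _ int]) (use that False in auto)
    then show ?thesis using False by (simp add: primitive_def algebra_simps)
  qed
  have t: "t \<in> {- b..b}" by (auto simp: b_def)
  have "((\<lambda>u. integral {- b..u} h) has_vector_derivative h t) (at t within {- b..b})"
    by (rule integral_has_vector_derivative[OF continuous_on_subset[OF h] t]) simp
  from has_vector_derivative_diff[OF this has_vector_derivative_const[of "integral {- b..0} h"]]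
  have "((\<lambda>u. integral {- b..u} h - integral {- b..0} h) has_vector_derivative h t) (at t within {- b..b})" by simp
  then have d: "(primitive h has_vector_derivative h t) (at t within {- b..b})"
    using has_vector_derivative_transform[OF t, of "primitive h" "\<lambda>u. integral {- b..u} h - integral {- b..0} h" "h t"] eq by blast
  have i: "t \<in> interior {- b..b}" by (auto simp: b_def interior_atLeastAtMost_real)
  show ?thesis using d unfolding at_within_interior[OF i] .
qed

lemma primitive_exp_bound:
  assumes h: "continuous_on UNIV h" and r: "0 < r" and C: "0 \<le> C"
    and bd: "\<And>\<tau>. norm (h \<tau>) \<le> C * exp (r * \<bar>\<tau>\<bar>)"
  shows "norm (primitive h t) \<le> C / r * exp (r * \<bar>t\<bar>)"
proof -
  have cp: "continuous_on S (primitive h)" for S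
    using has_vector_derivative_primitive[OF h] by (meson continuous_at_imp_continuous_on has_vector_derivative_continuous)
  consider "t = 0" | "0 < t" | "t < 0" by linarith
  then show ?thesis
  proof cases
    case 1 then show ?thesis using C r by simp
  next
    case 2
    have "norm (primitive h t - primitive h 0) \<le> C / r * exp (r * t) - C / r * exp (r * 0)"
    proof (rule differentiable_bound_general[OF 2 cp])
      show "continuous_on {0..t} (\<lambda>x. C / r * exp (r * x))" by (intro continuous_intros)
      show "(primitive h has_vector_derivative h x) (at x)" for x by (rule has_vector_derivative_primitive[OF h])
      show "((\<lambda>x. C / r * exp (r * x)) has_vector_derivative C * exp (r * x)) (at x)" for x
        unfolding has_real_derivative_iff_has_vector_derivative[symmetric]
        using r by (auto intro!: derivative_eq_intros)
      show "norm (h x) \<le> C * exp (r * x)" if "0 < x" for x using bd[of x] that by simp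
    qed
    then show ?thesis using 2 C r by (simp add: field_simps)
  next
    case 3
    have "norm (primitive h 0 - primitive h t) \<le> - (C / r * exp (- r * 0)) - - (C / r * exp (- r * t))"
    proof (rule differentiable_bound_general[OF 3 cp])
      show "continuous_on {t..0} (\<lambda>x. - (C / r * exp (- r * x)))" by (intro continuous_intros)
      show "(primitive h has_vector_derivative h x) (at x)" for x by (rule has_vector_derivative_primitive[OF h])
      show "((\<lambda>x. - (C / r * exp (- r * x))) has_vector_derivative C * exp (- r * x)) (at x)" for x
        unfolding has_real_derivative_iff_has_vector_derivative[symmetric]
        using r by (auto intro!: derivative_eq_intros)
      show "norm (h x) \<le> C * exp (- r * x)" if "x < 0" for x using bd[of x] that by simp
    qed
    then have "norm (primitive h t) \<le> C / r * exp (- r * t) - C / r" by simp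
    moreover have "0 \<le> C / r" using C r by simp
    ultimately have "norm (primitive h t) \<le> C / r * exp (- r * t)" by linarith
    then show ?thesis using 3 by simp
  qed
qed

text \<open>
  The integral equation is solved on the whole line by one application of Banach's fixed point
  theorem: in the norm weighted with \<open>exp (- r |t|)\<close> the integral operator has Lipschitz constant at most
  \<open>L / r \<le> 1/2\<close>. The unknown is the bounded function \<open>g t = exp (- r |t|) y t\<close>.
\<close>

theorem global_lipschitz_ode:
  fixes G :: "'a::banach \<Rightarrow> 'a"
  assumes lip: "\<And>x y. norm (G x - G y) \<le> L * norm (x - y)" and L: "0 \<le> L"
  shows "\<exists>y. y 0 = y0 \<and> (\<forall>t. (y has_vector_derivative G (y t)) (at t))"
proof -
  define r where "r = 2 * L + 1"
  have r: "0 < r" using L by (simp add: r_def)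
  define e where "e t = exp (r * \<bar>t\<bar>)" for t :: real
  have e: "1 \<le> e t" "0 < e t" for t using r by (simp_all add: e_def)
  have ce: "continuous_on S e" for S unfolding e_def by (intro continuous_intros)
  have cG: "continuous_on S G" for S
    by (rule lipschitz_on_continuous_on[of L]) (auto simp: lipschitz_on_def dist_norm lip L)
  define f where "f g \<tau> = G (e \<tau> *\<^sub>R apply_bcontfun g \<tau>)" for g :: "real \<Rightarrow>\<^sub>C 'a" and \<tau>
  have cb: "continuous_on S (apply_bcontfun g)" for S and g :: "real \<Rightarrow>\<^sub>C 'a"
    by (rule continuous_on_apply_bcontfun)
  have cf: "continuous_on UNIV (f g)" for g
    unfolding f_def by (intro continuous_on_compose2[OF cG] continuous_intros ce cb) auto
  have fb: "norm (f g \<tau>) \<le> (norm (G 0) + L * norm g) * exp (r * \<bar>\<tau>\<bar>)" for g \<tau>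
  proof -
    have "norm (f g \<tau>) \<le> norm (G 0) + norm (f g \<tau> - G 0)" by (rule norm_triangle_sub)
    also have "norm (f g \<tau> - G 0) \<le> L * norm (e \<tau> *\<^sub>R apply_bcontfun g \<tau> - 0)" unfolding f_def by (rule lip)
    also have "\<dots> \<le> L * (e \<tau> * norm g)" using e[of \<tau>] L norm_bounded[of g \<tau>] by (intro mult_left_mono) auto
    finally have "norm (f g \<tau>) \<le> norm (G 0) * 1 + L * norm g * e \<tau>" by (simp add: mult_ac)
    also have "\<dots> \<le> norm (G 0) * e \<tau> + L * norm g * e \<tau>" using e by (intro add_right_mono mult_left_mono) auto
    finally show ?thesis by (simp add: e_def distrib_right)
  qed
  define T where "T g t = (1 / e t) *\<^sub>R (y0 + primitive (f g) t)" for g t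
  have cp: "continuous_on S (primitive (f g))" for S g
    using has_vector_derivative_primitive[OF cf] by (meson continuous_at_imp_continuous_on has_vector_derivative_continuous)
  have Tb: "T g \<in> bcontfun" for g
  proof (rule bcontfun_normI)
    show "continuous_on UNIV (T g)"
      unfolding T_def by (intro continuous_intros ce cp) (simp add: e_def)
    let ?C = "norm (G 0) + L * norm g"
    fix t
    have C: "0 \<le> ?C" using L by simp
    have "norm (y0 + primitive (f g) t) \<le> norm y0 + ?C / r * e t"
      using primitive_exp_bound[OF cf r C fb, where t=t] norm_triangle_ineq[of y0 "primitive (f g) t"] unfolding e_def by linarith
    also have "\<dots> \<le> norm y0 * e t + ?C / r * e t" using e[of t] by (intro add_right_mono) (simp add: mult_le_cancel_left1)
    finally have "norm (y0 + primitive (f g) t) \<le> (norm y0 + ?C / r) * e t" by (simp only: distrib_right)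
    then show "norm (T g t) \<le> norm y0 + ?C / r" using e(2)[of t] by (simp add: T_def divide_simps mult.commute)
  qed
  have Ta: "apply_bcontfun (Bcontfun (T g)) = T g" for g by (rule Bcontfun_inverse[OF Tb])
  have "\<exists>!g. Bcontfun (T g) = g"
  proof (rule banach_fix_type[of "1/2"])
    show "\<forall>g h. dist (Bcontfun (T g)) (Bcontfun (T h)) \<le> 1 / 2 * dist g h"
    proof (intro allI dist_bound)
      fix g h :: "real \<Rightarrow>\<^sub>C 'a" and t
      have c: "continuous_on UNIV (\<lambda>\<tau>. f g \<tau> - f h \<tau>)" by (intro continuous_intros cf)
      have C: "0 \<le> L * dist g h" using L by simp
      have b: "norm (f g \<tau> - f h \<tau>) \<le> L * dist g h * exp (r * \<bar>\<tau>\<bar>)" for \<tau>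
      proof -
        have "norm (f g \<tau> - f h \<tau>) \<le> L * norm (e \<tau> *\<^sub>R apply_bcontfun g \<tau> - e \<tau> *\<^sub>R apply_bcontfun h \<tau>)"
          unfolding f_def by (rule lip)
        also have "\<dots> = L * (e \<tau> * dist (apply_bcontfun g \<tau>) (apply_bcontfun h \<tau>))"
          using e(2)[of \<tau>] by (simp add: dist_norm flip: scaleR_diff_right)
        also have "\<dots> \<le> L * (e \<tau> * dist g h)" using L e[of \<tau>] dist_bounded[of g \<tau> h] by (intro mult_left_mono) auto
        finally show ?thesis by (simp add: e_def mult_ac)
      qed
      have "dist (T g t) (T h t) = norm ((1 / e t) *\<^sub>R (primitive (f g) t - primitive (f h) t))"
        by (simp add: T_def dist_norm flip: scaleR_diff_right)
      also have "\<dots> = (1 / e t) * norm (primitive (\<lambda>\<tau>. f g \<tau> - f h \<tau>) t)"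
        using e(2)[of t] by (simp add: primitive_diff[OF cf cf])
      also have "\<dots> \<le> (1 / e t) * (L * dist g h / r * exp (r * \<bar>t\<bar>))"
        using e(2)[of t] by (intro mult_left_mono primitive_exp_bound[OF c r C b]) auto
      also have "\<dots> = (L / r) * dist g h" using e(2)[of t] by (simp add: e_def)
      also have "\<dots> \<le> 1 / 2 * dist g h" using L by (intro mult_right_mono) (simp_all add: r_def field_simps)
      finally show "dist (apply_bcontfun (Bcontfun (T g)) t) (apply_bcontfun (Bcontfun (T h)) t) \<le> 1 / 2 * dist g h"
        by (simp only: Ta)
    qed
  qed auto
  then obtain g where g: "Bcontfun (T g) = g" by blast
  define y where "y t = e t *\<^sub>R apply_bcontfun g t" for t
  have y: "y t = y0 + primitive (f g) t" for t
  proof -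
    have "apply_bcontfun g t = T g t" using Ta[of g] g by simp
    then show ?thesis using e(2)[of t] by (simp add: y_def T_def)
  qed
  have "(y has_vector_derivative G (y t)) (at t)" for t
  proof -
    have "((\<lambda>t. y0 + primitive (f g) t) has_vector_derivative 0 + f g t) (at t)"
      by (intro has_vector_derivative_add has_vector_derivative_const has_vector_derivative_primitive cf)
    moreover have "f g t = G (y t)" by (simp add: f_def y_def)
    moreover have "y = (\<lambda>t. y0 + primitive (f g) t)" using y by (rule ext)
    ultimately show ?thesis by simp
  qed
  then show ?thesis using y[of 0] by (intro exI[of _ y]) auto
qed

section \<open>The system for the Fourier coefficients\<close>

text \<open>
  The hermitian coefficients of the real function \<open>tsum K c\<close>, for arbitrary \<open>c\<close>. Replacing \<open>c\<close> by them extends statements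
  about hermitian coefficients to arbitrary \<open>c\<close>.
\<close>

definition herm_part :: "(int ^ 'd \<Rightarrow> complex ^ 'n) \<Rightarrow> int ^ 'd \<Rightarrow> complex ^ 'n" where
  "herm_part c k = (\<chi> i. (c k $ i + cnj (c (- k) $ i)) / 2)"

lemma herm_herm_part: "herm (herm_part c)"
  by (simp add: herm_def herm_part_def add.commute)

lemma tsum_herm_part:
  assumes "\<And>k. k \<in> K \<Longrightarrow> - k \<in> K"
  shows "tsum K (herm_part c) = tsum K c"
proof (rule ext, unfold vec_eq_iff, rule allI)
  fix x i
  let ?S = "\<Sum>k\<in>K. c k $ i * expi k x"
  have "cnj ?S = (\<Sum>k\<in>K. cnj (c (- k) $ i) * cnj (expi (- k) x))"
    unfolding cnj_sum complex_cnj_mult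
    by (rule sum.reindex_bij_witness[where i=uminus and j=uminus]) (use assms in auto)
  also have "\<dots> = (\<Sum>k\<in>K. cnj (c (- k) $ i) * expi k x)"
    by (simp add: expi_minus)
  finally have c: "cnj ?S = (\<Sum>k\<in>K. cnj (c (- k) $ i) * expi k x)" .
  have "(\<Sum>k\<in>K. herm_part c k $ i * expi k x) = (\<Sum>k\<in>K. (c k $ i * expi k x + cnj (c (- k) $ i) * expi k x) / 2)"
    by (intro sum.cong refl) (simp add: herm_part_def field_simps)
  also have "\<dots> = (?S + cnj ?S) / 2" unfolding c by (simp only: sum.distrib flip: sum_divide_distrib)
  finally have "(\<Sum>k\<in>K. herm_part c k $ i * expi k x) = (?S + cnj ?S) / 2" .
  moreover have "Re ((z + cnj z) / 2) = Re z" for z by simp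
  ultimately show "tsum K (herm_part c) x $ i = tsum K c x $ i"
    by (simp only: tsum_def vec_lambda_beta)
qed

lemma tsum_cong: "(\<And>k. k \<in> K \<Longrightarrow> a k = b k) \<Longrightarrow> tsum K a x = tsum K b x"
  by (simp only: tsum_def cong: sum.cong)

lemma Hs_differentiable_band_tsum: "Hs_differentiable s (tsum (band N) c)"
proof -
  have "Hs_differentiable s (tsum (band N) (herm_part c))" by (rule Hs_differentiable_tsum) (auto simp: herm_herm_part)
  then show ?thesis by (subst (asm) tsum_herm_part) auto
qed

lemma norm_vector_smult: "norm (z *s v :: complex ^ 'n) = cmod z * norm v"
  by (simp add: norm_vec_def norm_mult L2_set_right_distrib)

lemma linear_mode: "bounded_linear (\<lambda>z :: complex ^ 'n. (\<chi> i. Re (z $ i * w)) :: real ^ 'n)"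
proof -
  have "linear (\<lambda>z :: complex ^ 'n. (\<chi> i. Re (z $ i * w)) :: real ^ 'n)"
    by (rule linearI) (simp_all add: vec_eq_iff algebra_simps)
  then show ?thesis by (simp add: linear_conv_bounded_linear)
qed

lemma tsum_eq_sum_modes: "tsum K c x = (\<Sum>k\<in>K. \<chi> i. Re (c k $ i * expi k x))"
  by (simp only: tsum_def vec_eq_iff sum_component vec_lambda_beta Re_sum) simp

lemma has_vector_derivative_tsum:
  assumes "\<And>k. k \<in> K \<Longrightarrow> ((\<lambda>t. c t k) has_vector_derivative c' k) (at t)"
  shows "((\<lambda>t. tsum K (c t) x) has_vector_derivative tsum K c' x) (at t)"
  unfolding tsum_eq_sum_modes
  by (intro has_vector_derivative_sum bounded_linear.has_vector_derivative[OF linear_mode] assms)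

context filtered_problem
begin

text \<open>
  The right-hand side of the system for the coefficients. The zero outside the band is the true
  coefficient of \<open>F (tsum K c)\<close> there, see \<open>F_tsum_band\<close>.
\<close>

definition field :: "(int ^ 'd \<Rightarrow> complex ^ 'n) \<Rightarrow> int ^ 'd \<Rightarrow> complex ^ 'n" where
  "field c k = (if k \<in> K then - fourier_coeff (F (tsum K c)) k else 0)"

lemma herm_field: "herm (field c)"
  using herm_fourier_coeff[of "F (tsum K c)"] by (auto simp: herm_def field_def)

lemma F_tsum_band:
  shows "F (tsum K c) x = - tsum K (field c) x"
proof -
  let ?V = "tsum K c"
  have n: "Hs_differentiable s ?V" by (rule Hs_differentiable_band_tsum)
  have z: "fourier_coeff (F ?V) k = 0" if k: "k \<notin> K" for k
  proof -
    have "fourier_coeff (tsum K (herm_part c)) k = 0" using k by (subst fourier_coeff_tsum) (auto simp: herm_herm_part)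
    then have "fourier_coeff ?V k = 0" by (subst (asm) tsum_herm_part) auto
    then show ?thesis using cutoff_outside_band[OF chi k N]
      by (simp add: F[OF n] fourier_coeff_hyp_op[OF s n chi N]) (simp add: cmatvec_def vec_eq_iff)
  qed
  have "F ?V = tsum K (fourier_coeff (F ?V))"
  proof (rule fourier_coeff_inject)
    show "continuous_on UNIV (F ?V)" by (rule continuous_F[OF n])
    show "F ?V (x + axis j (2 * pi)) = F ?V x" for x j
      by (simp add: F[OF n] hyp_op_def partial_tsum smooth_filter_eq_tsum[OF chi N])
    show "fourier_coeff (F ?V) k = fourier_coeff (tsum K (fourier_coeff (F ?V))) k" for k
      using z[of k] by (subst fourier_coeff_tsum) (auto simp: herm_fourier_coeff)
  qed (simp_all add: continuous_on_tsum)
  then have e: "F ?V x = tsum K (fourier_coeff (F ?V)) x" by simp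
  have "tsum K (field c) x = tsum K (\<lambda>k. 0 - fourier_coeff (F ?V) k) x"
    by (rule tsum_cong) (simp add: field_def)
  also have "\<dots> = tsum K (\<lambda>k. 0) x - F ?V x" unfolding e by (rule tsum_diff)
  also have "tsum K (\<lambda>k. 0) x = 0" by (simp add: tsum_def vec_eq_iff)
  finally show ?thesis by simp
qed

lemma fourier_coeff_tsum_field: "fourier_coeff (tsum K (field c)) k = field c k"
  by (subst fourier_coeff_tsum) (auto simp: herm_field field_def)

lemma field_lipschitz:
  assumes r: "0 \<le> r"
  shows "\<exists>L\<ge>0. \<forall>c d. (\<forall>k\<in>K. norm (c k) \<le> r \<and> norm (d k) \<le> r) \<longrightarrow>
    (\<forall>k. norm (field c k - field d k) \<le> L * (\<Sum>l\<in>K. norm (c l - d l)))"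
proof -
  let ?n = "real CARD('n)"
  define R where "R = ?n * (real (card K) * (real N * r))"
  have R: "0 \<le> R" using r by (simp add: R_def)
  obtain L where L: "L \<ge> 0" and LL: "\<forall>V W d. Hs_differentiable s V \<longrightarrow> Hs_differentiable s W \<longrightarrow>
    (\<forall>x. norm (V x) \<le> R \<and> norm (W x) \<le> R \<and> norm (V x - W x) \<le> d) \<longrightarrow>
    (\<forall>j x. norm (partial_x j V x) \<le> R \<and> norm (partial_x j V x - partial_x j W x) \<le> d) \<longrightarrow>
    (\<forall>x. norm (hyp_op chi P Q N V x - hyp_op chi P Q N W x) \<le> L * d)"
    using hyp_op_lipschitz[where P=P and Q=Q, OF chi N s poly R] by blast
  have N1: "1 \<le> real N" using N by simp
  have kj: "\<bar>real_of_int (k $ j)\<bar> \<le> real N" if "k \<in> K" for k j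
  proof -
    have "- int N \<le> k $ j \<and> k $ j \<le> int N" using that by (auto simp: band_def)
    then show ?thesis by (simp add: abs_le_iff)
  qed
  have b0: "norm (tsum K a x) \<le> ?n * (real N * S)" if "(\<Sum>k\<in>K. norm (a k)) \<le> S" for a :: "int ^ 'd \<Rightarrow> complex ^ 'n" and x S
  proof -
    have "0 \<le> S" using that sum_nonneg[of K "\<lambda>k. norm (a k)"] by force
    then have "(\<Sum>k\<in>K. norm (a k)) \<le> real N * S" using that N1 mult_right_mono[OF N1, of S] by linarith
    then have "?n * (\<Sum>k\<in>K. norm (a k)) \<le> ?n * (real N * S)" by (intro mult_left_mono) auto
    then show ?thesis using norm_tsum_le[of K a x] by linarith
  qed
  have b1: "norm (tsum K (\<lambda>k. (\<i> * of_int (k $ j)) *s a k) x) \<le> ?n * (real N * S)" if "(\<Sum>k\<in>K. norm (a k)) \<le> S" 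
    for a :: "int ^ 'd \<Rightarrow> complex ^ 'n" and j x S
  proof -
    have "(\<Sum>k\<in>K. norm ((\<i> * of_int (k $ j)) *s a k)) \<le> (\<Sum>k\<in>K. real N * norm (a k))"
      using kj by (intro sum_mono) (auto simp: norm_vector_smult norm_mult intro!: mult_right_mono)
    also have "\<dots> \<le> real N * S" using that by (simp flip: sum_distrib_left) (intro mult_left_mono, auto)
    finally have "?n * (\<Sum>k\<in>K. norm ((\<i> * of_int (k $ j)) *s a k)) \<le> ?n * (real N * S)" by (intro mult_left_mono) auto
    then show ?thesis using norm_tsum_le[of K "\<lambda>k. (\<i> * of_int (k $ j)) *s a k" x] by linarith
  qed
  show ?thesis
  proof (intro exI[of _ "?n * (L * (?n * real N))"] conjI allI impI)
    show "0 \<le> ?n * (L * (?n * real N))" using L by simp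
    fix c d :: "int ^ 'd \<Rightarrow> complex ^ 'n" and k
    assume cd: "\<forall>k\<in>K. norm (c k) \<le> r \<and> norm (d k) \<le> r"
    define \<delta> where "\<delta> = (\<Sum>l\<in>K. norm (c l - d l))"
    have \<delta>: "0 \<le> \<delta>" by (simp add: \<delta>_def sum_nonneg)
    have sc: "(\<Sum>k\<in>K. norm (c k)) \<le> real (card K) * r" "(\<Sum>k\<in>K. norm (d k)) \<le> real (card K) * r"
      using cd by (auto intro!: sum_bounded_above)
    have R': "R = ?n * (real N * (real (card K) * r))" by (simp add: R_def mult_ac)
    have sd: "(\<Sum>k\<in>K. norm (c k - d k)) \<le> \<delta>" by (simp add: \<delta>_def)
    have pd: "partial_x j (tsum K c) x - partial_x j (tsum K d) x = tsum K (\<lambda>k. (\<i> * of_int (k $ j)) *s (c k - d k)) x" for j x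
      unfolding partial_tsum tsum_diff[symmetric]
      by (rule arg_cong[where f="\<lambda>a. tsum K a x"]) (simp add: fun_eq_iff vec_eq_iff right_diff_distrib)
    have "norm (hyp_op chi P Q N (tsum K c) x - hyp_op chi P Q N (tsum K d) x) \<le> L * (?n * (real N * \<delta>))" for x
    proof (rule LL[rule_format])
      show "Hs_differentiable s (tsum K c)" "Hs_differentiable s (tsum K d)" by (rule Hs_differentiable_band_tsum)+
      show "norm (tsum K c x) \<le> R \<and> norm (tsum K d x) \<le> R \<and> norm (tsum K c x - tsum K d x) \<le> ?n * (real N * \<delta>)" for x
        unfolding R' tsum_diff[symmetric] using b0[OF sc(1)] b0[OF sc(2)] b0[OF sd] by blast
      show "norm (partial_x j (tsum K c) x) \<le> R \<and> norm (partial_x j (tsum K c) x - partial_x j (tsum K d) x) \<le> ?n * (real N * \<delta>)" for j x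
        unfolding pd unfolding partial_tsum R' using b1[OF sc(1)] b1[OF sd] by blast
    qed
    then have le: "norm (F (tsum K d) x - F (tsum K c) x) \<le> L * (?n * (real N * \<delta>))" for x
      using F[OF Hs_differentiable_band_tsum] by (simp add: norm_minus_commute)
    have "norm (field c k - field d k) \<le> ?n * (L * (?n * (real N * \<delta>)))"
    proof (cases "k \<in> K")
      case True
      have "field c k - field d k = fourier_coeff (F (tsum K d)) k - fourier_coeff (F (tsum K c)) k"
        using True by (simp add: field_def)
      also have "\<dots> = fourier_coeff (\<lambda>x. F (tsum K d) x - F (tsum K c) x) k"
        by (rule fourier_coeff_diff[symmetric]; rule continuous_F[OF Hs_differentiable_band_tsum])
      finally show ?thesis using norm_fourier_coeff_le[where k=k, OF le] by simp
    next
      case False then show ?thesis using L \<delta> by (simp add: field_def)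
    qed
    then show "norm (field c k - field d k) \<le> ?n * (L * (?n * real N)) * (\<Sum>l\<in>K. norm (c l - d l))"
      by (simp add: \<delta>_def mult.assoc)
  qed
qed

text \<open>
  Projecting the coefficients onto a ball makes the field globally Lipschitz without changing it inside
  the ball. Families of coefficients do not form a normed space, so the system is solved for the corresponding
  real function in the Banach space of bounded continuous functions; the coefficients of a real
  function are hermitian automatically.
\<close>

lemma truncated_system:
  assumes r: "0 \<le> r" and c0: "herm c0" "\<And>k. k \<notin> K \<Longrightarrow> c0 k = 0"
  shows "\<exists>c. c 0 = c0 \<and> (\<forall>t. herm (c t) \<and> (\<forall>k. k \<notin> K \<longrightarrow> c t k = 0)) \<and>
    (\<forall>t k. ((\<lambda>\<tau>. c \<tau> k) has_vector_derivative field (\<lambda>l. closest_point (cball 0 r) (c t l)) k) (at t))"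
proof -
  define \<rho> where "\<rho> a l = closest_point (cball 0 r) (a l)" for a :: "int ^ 'd \<Rightarrow> complex ^ 'n" and l
  have \<rho>1: "norm (\<rho> a l) \<le> r" for a l
    using closest_point_in_set[of "cball 0 r :: (complex ^ 'n) set" "a l"] r by (simp add: \<rho>_def)
  have \<rho>2: "norm (\<rho> a l - \<rho> b l) \<le> norm (a l - b l)" for a b l
    using closest_point_lipschitz[of "cball 0 r :: (complex ^ 'n) set" "a l" "b l"] r by (simp add: \<rho>_def dist_norm)
  obtain L where L: "L \<ge> 0" and LL: "\<forall>c d. (\<forall>k\<in>K. norm (c k) \<le> r \<and> norm (d k) \<le> r) \<longrightarrow>
    (\<forall>k. norm (field c k - field d k) \<le> L * (\<Sum>l\<in>K. norm (c l - d l)))"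
    using field_lipschitz[OF r] by blast
  let ?n = "real CARD('n)"
  have bc: "tsum K a \<in> bcontfun" for a :: "int ^ 'd \<Rightarrow> complex ^ 'n"
    by (rule bcontfun_normI[OF continuous_on_tsum norm_tsum_le])
  define hat where "hat z = fourier_coeff (apply_bcontfun z)" for z :: "(real ^ 'd) \<Rightarrow>\<^sub>C (real ^ 'n)"
  define G where "G z = Bcontfun (tsum K (field (\<rho> (hat z))))" for z
  have Ga: "apply_bcontfun (G z) = tsum K (field (\<rho> (hat z)))" for z
    unfolding G_def by (rule Bcontfun_inverse[OF bc])
  have blin: "bounded_linear (\<lambda>z. hat z k)" for k
  proof (rule bounded_linear_intro[of _ ?n])
    fix z w :: "(real ^ 'd) \<Rightarrow>\<^sub>C (real ^ 'n)" and r
    show "hat (z + w) k = hat z k + hat w k"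
      by (simp add: hat_def plus_bcontfun.rep_eq fourier_coeff_add)
    show "hat (r *\<^sub>R z) k = r *\<^sub>R hat z k"
      by (simp add: hat_def scaleR_bcontfun.rep_eq fourier_coeff_scaleR)
    show "norm (hat z k) \<le> norm z * ?n"
      unfolding hat_def using norm_fourier_coeff_le[where k=k, OF norm_bounded[of z]] by (simp add: mult.commute)
  qed
  have hat_diff: "norm (hat z k - hat w k) \<le> ?n * norm (z - w)" for z w k
  proof -
    have "hat z k - hat w k = hat (z - w) k"
      using linear_diff[OF bounded_linear.linear[OF blin[of k]]] by simp
    then show ?thesis unfolding hat_def using norm_fourier_coeff_le[where k=k, OF norm_bounded[of "z - w"]] by simp
  qed
  have lipG: "norm (G z - G w) \<le> (?n * (real (card K) * (L * (real (card K) * ?n)))) * norm (z - w)" for z w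
  proof (rule norm_bound)
    fix x
    have "apply_bcontfun (G z - G w) x = tsum K (\<lambda>k. field (\<rho> (hat z)) k - field (\<rho> (hat w)) k) x"
      by (simp add: Ga tsum_diff)
    also have "norm \<dots> \<le> ?n * (\<Sum>k\<in>K. norm (field (\<rho> (hat z)) k - field (\<rho> (hat w)) k))" by (rule norm_tsum_le)
    also have "\<dots> \<le> ?n * (\<Sum>k\<in>K. L * (\<Sum>l\<in>K. ?n * norm (z - w)))"
    proof (intro mult_left_mono sum_mono)
      fix k
      have "norm (field (\<rho> (hat z)) k - field (\<rho> (hat w)) k) \<le> L * (\<Sum>l\<in>K. norm (\<rho> (hat z) l - \<rho> (hat w) l))"
        using LL \<rho>1 by blast
      also have "\<dots> \<le> L * (\<Sum>l\<in>K. ?n * norm (z - w))"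
        by (intro mult_left_mono sum_mono L order_trans[OF \<rho>2 hat_diff])
      finally show "norm (field (\<rho> (hat z)) k - field (\<rho> (hat w)) k) \<le> L * (\<Sum>l\<in>K. ?n * norm (z - w))" .
    qed simp
    finally show "norm (apply_bcontfun (G z - G w) x) \<le> (?n * (real (card K) * (L * (real (card K) * ?n)))) * norm (z - w)"
      by (simp add: mult_ac)
  qed
  have "0 \<le> ?n * (real (card K) * (L * (real (card K) * ?n)))" using L by simp
  from global_lipschitz_ode[where G=G and ?y0.0="Bcontfun (tsum K c0)", OF lipG this]
  obtain y where y0: "y 0 = Bcontfun (tsum K c0)" and y: "\<And>t. (y has_vector_derivative G (y t)) (at t)" by blast
  define c where "c t = hat (y t)" for t
  have dc: "((\<lambda>\<tau>. c \<tau> k) has_vector_derivative field (\<rho> (c t)) k) (at t)" for t k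
  proof -
    have "hat (G (y t)) k = field (\<rho> (c t)) k" by (simp add: hat_def[of "G _"] Ga c_def fourier_coeff_tsum_field)
    then show ?thesis using bounded_linear.has_vector_derivative[OF blin y[of t], of k] by (simp add: c_def)
  qed
  have c00: "c 0 = c0"
  proof
    fix k
    show "c 0 k = c0 k"
      unfolding c_def hat_def y0 Bcontfun_inverse[OF bc]
      by (subst fourier_coeff_tsum) (use c0 in auto)
  qed
  have supp: "c t k = 0" if k: "k \<notin> K" for t k
  proof -
    have d: "((\<lambda>\<tau>. c \<tau> k) has_vector_derivative 0) (at t within UNIV)" for t using dc[where t=t and k=k] k by (simp add: field_def)
    obtain v where v: "\<And>t. t \<in> UNIV \<Longrightarrow> c t k = v"
      by (rule has_vector_derivative_zero_constant[where f="\<lambda>\<tau>. c \<tau> k", OF convex_UNIV d]) blast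
    have "c t k = c 0 k" using v[OF UNIV_I, of t] v[OF UNIV_I, of 0] by (rule trans[OF _ sym])
    then show ?thesis using c00 c0(2)[OF k] by simp
  qed
  have "herm (c t)" for t by (simp add: c_def hat_def herm_fourier_coeff)
  then show ?thesis using c00 supp dc unfolding \<rho>_def by blast
qed

end

section \<open>Continuity in time, and the equivalence with the system for the coefficients\<close>

lemma gronwall_le:
  fixes D :: "real \<Rightarrow> real"
  assumes t: "0 \<le> t" and D: "\<And>\<tau>. 0 \<le> \<tau> \<Longrightarrow> \<tau> \<le> t \<Longrightarrow> (D has_real_derivative D' \<tau>) (at \<tau>)"
    and le: "\<And>\<tau>. 0 \<le> \<tau> \<Longrightarrow> \<tau> \<le> t \<Longrightarrow> D' \<tau> \<le> M * D \<tau>"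
  shows "D t \<le> D 0 * exp (M * t)"
proof -
  have "D t * exp (- M * t) \<le> D 0 * exp (- M * 0)"
  proof (rule DERIV_nonpos_imp_nonincreasing[OF t])
    fix x assume x: "0 \<le> x" "x \<le> t"
    have "((\<lambda>x. D x * exp (- M * x)) has_real_derivative (D' x - M * D x) * exp (- M * x)) (at x)"
      by (auto intro!: derivative_eq_intros D[OF x] simp: algebra_simps)
    moreover have "(D' x - M * D x) * exp (- M * x) \<le> 0"
      using le[OF x] by (intro mult_nonpos_nonneg) auto
    ultimately show "\<exists>y. ((\<lambda>x. D x * exp (- M * x)) has_real_derivative y) (at x) \<and> y \<le> 0" by blast
  qed
  then have "D t * exp (- M * t) * exp (M * t) \<le> D 0 * exp (M * t)" by (intro mult_right_mono) auto
  then show ?thesis by (simp add: mult.assoc flip: exp_add)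
qed

lemma herm_diff: "herm a \<Longrightarrow> herm b \<Longrightarrow> herm (\<lambda>k. a k - b k)"
  by (simp add: herm_def)

lemma herm_scaleR: "herm a \<Longrightarrow> herm (\<lambda>k. r *\<^sub>R a k)"
  by (simp add: herm_def scaleR_conv_of_real[where 'a=complex])

lemma tsum_scaleR: "tsum K (\<lambda>k. r *\<^sub>R a k) x = r *\<^sub>R tsum K a x"
  by (simp add: tsum_def vec_eq_iff sum_distrib_left mult_scaleR_left[where 'a=complex])

lemma Hs_tsum_band:
  assumes "herm c"
  shows "tsum (band N) c \<in> Hs s" "Hs_norm s (tsum (band N) c) = hnorm s (band N) c"
  unfolding hnorm_def by (rule tsum_Hs; use assms in simp)+

lemma tendsto_hnorm:
  assumes "finite K" "\<And>k. k \<in> K \<Longrightarrow> ((\<lambda>t. c t k) \<longlongrightarrow> l k) G"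
  shows "((\<lambda>t. hnorm s K (c t)) \<longlongrightarrow> hnorm s K l) G"
  unfolding hnorm_def L2_set_def by (intro tendsto_intros assms)

lemma hnorm_zero [simp]: "hnorm s K (\<lambda>k. 0) = 0"
  by (simp add: hnorm_def L2_set_0')

lemma C0_Hs_tsum:
  fixes c :: "real \<Rightarrow> int ^ 'd \<Rightarrow> complex ^ 'n"
  assumes h: "\<And>t. t \<in> I \<Longrightarrow> herm (c t)" and c: "\<And>k. k \<in> band N \<Longrightarrow> continuous_on I (\<lambda>t. c t k)"
  shows "C0_Hs s I (\<lambda>t. tsum (band N) (c t))"
  unfolding C0_Hs_def
proof (intro conjI ballI)
  fix t assume t: "t \<in> I"
  show "tsum (band N) (c t) \<in> Hs s" by (rule Hs_tsum_band[OF h[OF t]])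
  have eq: "Hs_norm s (\<lambda>x. tsum (band N) (c \<tau>) x - tsum (band N) (c t) x) = hnorm s (band N) (\<lambda>k. c \<tau> k - c t k)" if "\<tau> \<in> I" for \<tau>
    unfolding tsum_diff[symmetric] using Hs_tsum_band(2)[OF herm_diff[OF h[OF that] h[OF t]]] .
  have "((\<lambda>\<tau>. hnorm s (band N) (\<lambda>k. c \<tau> k - c t k)) \<longlongrightarrow> hnorm s (band N) (\<lambda>k :: int ^ 'd. 0 :: complex ^ 'n)) (at t within I)"
  proof (rule tendsto_hnorm)
    fix k :: "int ^ 'd" assume "k \<in> band N"
    then have "((\<lambda>\<tau>. c \<tau> k) \<longlongrightarrow> c t k) (at t within I)" using c t by (simp add: continuous_on_def)
    from tendsto_diff[OF this tendsto_const[of "c t k"]] show "((\<lambda>\<tau>. c \<tau> k - c t k) \<longlongrightarrow> 0) (at t within I)" by simp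
  qed simp
  then have "((\<lambda>\<tau>. hnorm s (band N) (\<lambda>k. c \<tau> k - c t k)) \<longlongrightarrow> 0) (at t within I)" by simp
  moreover have "\<forall>\<^sub>F \<tau> in at t within I. hnorm s (band N) (\<lambda>k. c \<tau> k - c t k) = Hs_norm s (\<lambda>x. tsum (band N) (c \<tau>) x - tsum (band N) (c t) x)"
    unfolding eventually_at_filter by (intro always_eventually allI impI) (simp add: eq)
  ultimately show "((\<lambda>\<tau>. Hs_norm s (\<lambda>x. tsum (band N) (c \<tau>) x - tsum (band N) (c t) x)) \<longlongrightarrow> 0) (at t within I)"
    by (rule Lim_transform_eventually)
qed

text \<open>
  All weights are at least one.
\<close>

lemma hnorm_component_le:
  assumes "finite K" "k \<in> K" "0 \<le> s"
  shows "norm (c k) \<le> hnorm s K c"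
proof -
  have "1 * norm (c k) \<le> bracket k powr s * norm (c k)"
    using bracket_ge_1[of k] assms(3) by (intro mult_right_mono ge_one_powr_ge_zero) auto
  also have "\<dots> \<le> hnorm s K c" unfolding hnorm_def using assms by (intro member_le_L2_set)
  finally show ?thesis by simp
qed

context filtered_problem
begin

lemma s_pos: "0 \<le> s"
proof -
  have "0 \<le> real CARD('d) / 2 + 1" by simp
  then show ?thesis using s by linarith
qed

lemma classical_from_coefficients:
  assumes I: "open I" "is_interval I" "0 \<in> I" and h: "\<And>t. t \<in> I \<Longrightarrow> herm (c t)"
    and d: "\<And>t k. t \<in> I \<Longrightarrow> k \<in> K \<Longrightarrow> ((\<lambda>\<tau>. c \<tau> k) has_vector_derivative field (c t) k) (at t)"
  shows "classical_solution F (tsum K (c 0)) s I (\<lambda>t. tsum K (c t))"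
proof -
  have "continuous_on I (\<lambda>t. c t k)" if "k \<in> K" for k
    using has_vector_derivative_continuous[OF d[OF _ that]] by (intro continuous_at_imp_continuous_on) blast
  then have "C0_Hs s I (\<lambda>t. tsum K (c t))" by (intro C0_Hs_tsum h)
  moreover have "((\<lambda>\<tau>. tsum K (c \<tau>) x) has_vector_derivative - F (tsum K (c t)) x) (at t)" if "t \<in> I" for t x
    unfolding F_tsum_band minus_minus by (rule has_vector_derivative_tsum) (rule d[OF that])
  ultimately show ?thesis using I by (simp add: classical_solution_def differentiable_tsum)
qed

context
  fixes U0 I U
  assumes U: "classical_solution F (sharp_filter N U0) s I U"
begin

abbreviation "co t \<equiv> fourier_coeff (U t)"

lemma classical_interval: "open I" "is_interval I" "0 \<in> I"
  using U by (simp_all add: classical_solution_def)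

lemma classical_coefficient_ode:
  assumes "t \<in> I" "k \<in> K"
  shows "((\<lambda>\<tau>. co \<tau> k) has_vector_derivative field (co t) k) (at t)"
proof -
  have "field (co t) k = - fourier_coeff (F (U t)) k"
    using assms(2) classical_band_limited(2)[OF U assms(1)] by (simp add: field_def)
  then show ?thesis using classical_fourier_ode[OF U assms(1), of k] by simp
qed

lemma continuous_classical_coefficient:
  "k \<in> K \<Longrightarrow> continuous_on I (\<lambda>t. co t k)"
  using has_vector_derivative_continuous[OF classical_coefficient_ode] by (intro continuous_at_imp_continuous_on) blast

lemma classical_Hs:
  assumes "t \<in> I"
  shows "U t \<in> Hs \<sigma>" "Hs_norm \<sigma> (U t) = hnorm \<sigma> K (co t)"
proof -
  note e = classical_band_limited(2)[OF U assms]
  show "U t \<in> Hs \<sigma>" by (subst e) (rule Hs_tsum_band[OF herm_fourier_coeff])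
  show "Hs_norm \<sigma> (U t) = hnorm \<sigma> K (co t)" by (subst e) (rule Hs_tsum_band[OF herm_fourier_coeff])
qed

lemma continuous_field_classical:
  assumes t: "t \<in> I"
  shows "((\<lambda>\<tau>. field (co \<tau>) k) \<longlongrightarrow> field (co t) k) (at t)"
proof -
  have cont: "((\<lambda>\<tau>. co \<tau> k) \<longlongrightarrow> co t k) (at t)" if "k \<in> K" for k
    using has_vector_derivative_continuous[OF classical_coefficient_ode[OF t that]] by (simp add: continuous_at)
  define r where "r = (\<Sum>k\<in>K. norm (co t k)) + 1"
  have r0: "0 \<le> r" by (simp add: r_def sum_nonneg add_nonneg_nonneg)
  obtain L where L: "L \<ge> 0" and LL: "\<forall>c d. (\<forall>k\<in>K. norm (c k) \<le> r \<and> norm (d k) \<le> r) \<longrightarrow>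
    (\<forall>k. norm (field c k - field d k) \<le> L * (\<Sum>l\<in>K. norm (c l - d l)))"
    using field_lipschitz[OF r0] by blast
  have "((\<lambda>\<tau>. \<Sum>k\<in>K. norm (co \<tau> k)) \<longlongrightarrow> (\<Sum>k\<in>K. norm (co t k))) (at t)" by (intro tendsto_intros cont)
  then have ev: "\<forall>\<^sub>F \<tau> in at t. (\<Sum>k\<in>K. norm (co \<tau> k)) < r"
    by (rule order_tendstoD) (simp add: r_def)
  have mem: "norm (a k) \<le> (\<Sum>k\<in>K. norm (a k))" if "k \<in> K" for a :: "int ^ 'd \<Rightarrow> complex ^ 'n" and k
    using that by (intro member_le_sum) auto
  have ev': "\<forall>\<^sub>F \<tau> in at t. norm (field (co \<tau>) k - field (co t) k) \<le> L * (\<Sum>l\<in>K. norm (co \<tau> l - co t l))"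
    using ev
  proof eventually_elim
    case (elim \<tau>)
    have "norm (co \<tau> k) \<le> r \<and> norm (co t k) \<le> r" if "k \<in> K" for k
      using mem[OF that, of "co \<tau>"] mem[OF that, of "co t"] elim by (auto simp: r_def)
    then show ?case using LL by blast
  qed
  have "((\<lambda>\<tau>. L * (\<Sum>l\<in>K. norm (co \<tau> l - co t l))) \<longlongrightarrow> L * (\<Sum>l\<in>K. norm (co t l - co t l))) (at t)"
    by (intro tendsto_intros cont)
  then have "((\<lambda>\<tau>. L * (\<Sum>l\<in>K. norm (co \<tau> l - co t l))) \<longlongrightarrow> 0) (at t)" by simp
  then have "((\<lambda>\<tau>. field (co \<tau>) k - field (co t) k) \<longlongrightarrow> 0) (at t)" by (rule Lim_null_comparison[OF ev'])
  then show ?thesis by (simp add: LIM_zero_iff)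
qed

text \<open>
  On trigonometric polynomials with frequencies in the band, convergence in any \<open>H\<^sup>\<sigma>\<close> is convergence of
  finitely many coefficients.
\<close>

lemma classical_C1: "C1_Hs \<sigma> I U"
  unfolding C1_Hs_def
proof (intro conjI exI ballI)
  have c0: "C0_Hs \<sigma> I (\<lambda>t. tsum K (co t))"
    by (intro C0_Hs_tsum herm_fourier_coeff continuous_classical_coefficient)
  have rep: "U t = tsum K (co t)" if "t \<in> I" for t by (rule classical_band_limited(2)[OF U that])
  show "C0_Hs \<sigma> I U"
    unfolding C0_Hs_def
  proof (intro conjI ballI)
    fix t assume t: "t \<in> I"
    show "U t \<in> Hs \<sigma>" by (rule classical_Hs[OF t])
    have "((\<lambda>\<tau>. Hs_norm \<sigma> (\<lambda>x. tsum K (co \<tau>) x - tsum K (co t) x)) \<longlongrightarrow> 0) (at t within I)"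
      using c0 t by (simp add: C0_Hs_def)
    moreover have "\<forall>\<^sub>F \<tau> in at t within I. Hs_norm \<sigma> (\<lambda>x. tsum K (co \<tau>) x - tsum K (co t) x) = Hs_norm \<sigma> (\<lambda>x. U \<tau> x - U t x)"
      unfolding eventually_at_filter by (intro always_eventually allI impI) (simp only: rep[OF t, symmetric] rep[symmetric])
    ultimately show "((\<lambda>\<tau>. Hs_norm \<sigma> (\<lambda>x. U \<tau> x - U t x)) \<longlongrightarrow> 0) (at t within I)"
      by (rule Lim_transform_eventually)
  qed
  show "C0_Hs \<sigma> I (\<lambda>t. tsum K (field (co t)))"
  proof (rule C0_Hs_tsum[OF herm_field])
    fix k
    have "isCont (\<lambda>t. field (co t) k) t" if "t \<in> I" for t using continuous_field_classical[OF that, of k] by (simp add: isCont_def)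
    then show "continuous_on I (\<lambda>t. field (co t) k)" by (intro continuous_at_imp_continuous_on) blast
  qed
  fix t assume t: "t \<in> I"
  let ?e = "\<lambda>h k. (1 / h) *\<^sub>R (co (t + h) k - co t k) - field (co t) k"
  have "((\<lambda>h. hnorm \<sigma> K (?e h)) \<longlongrightarrow> hnorm \<sigma> K (\<lambda>k. 0 :: complex ^ 'n)) (at 0)"
  proof (rule tendsto_hnorm)
    fix k assume "k \<in> K"
    then have "((\<lambda>h. (1 / h) *\<^sub>R (co (t + h) k - co t k)) \<longlongrightarrow> field (co t) k) (at 0)"
      using classical_coefficient_ode[OF t] by (simp add: has_vector_derivative_limit_iff)
    from tendsto_diff[OF this tendsto_const[of "field (co t) k"]] show "((\<lambda>h. ?e h k) \<longlongrightarrow> 0) (at 0)" by simp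
  qed simp
  then have "((\<lambda>h. hnorm \<sigma> K (?e h)) \<longlongrightarrow> 0) (at 0)" by simp
  moreover have "\<forall>\<^sub>F h in at 0. hnorm \<sigma> K (?e h) = Hs_norm \<sigma> (\<lambda>x. (1 / h) *\<^sub>R (U (t + h) x - U t x) - tsum K (field (co t)) x)"
  proof -
    obtain \<delta> where \<delta>: "\<delta> > 0" "\<And>\<tau>. dist \<tau> t < \<delta> \<Longrightarrow> \<tau> \<in> I"
      using classical_interval(1) t unfolding open_dist by blast
    have eq: "hnorm \<sigma> K (?e h) = Hs_norm \<sigma> (\<lambda>x. (1 / h) *\<^sub>R (U (t + h) x - U t x) - tsum K (field (co t)) x)" if "t + h \<in> I" for h
    proof -
      have x: "(1 / h) *\<^sub>R (U (t + h) x - U t x) - tsum K (field (co t)) x = tsum K (?e h) x" for x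
        unfolding tsum_diff tsum_scaleR by (simp only: rep[OF t, symmetric] rep[OF that, symmetric])
      have "herm (?e h)" by (intro herm_diff herm_scaleR herm_fourier_coeff herm_field)
      from Hs_tsum_band(2)[OF this] show ?thesis unfolding x by simp
    qed
    show ?thesis unfolding eventually_at
      by (intro exI[of _ \<delta>] conjI \<delta>(1) ballI impI) (rule eq, rule \<delta>(2), simp add: dist_real_def)
  qed
  ultimately show "((\<lambda>h. Hs_norm \<sigma> (\<lambda>x. (1 / h) *\<^sub>R (U (t + h) x - U t x) - tsum K (field (co t)) x)) \<longlongrightarrow> 0) (at 0)"
    by (rule Lim_transform_eventually)
qed

end

section \<open>Uniqueness\<close>

text \<open>
  The factor \<open>g\<close> is \<open>1\<close> or \<open>- 1\<close> in the application: reversing time reduces negative times to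
  positive ones.
\<close>

lemma coefficient_system_unique:
  assumes t: "0 \<le> t" and g: "\<bar>g\<bar> \<le> 1"
    and a: "\<And>\<tau> k. 0 \<le> \<tau> \<Longrightarrow> \<tau> \<le> t \<Longrightarrow> k \<in> K \<Longrightarrow> ((\<lambda>\<tau>. a \<tau> k) has_vector_derivative g *\<^sub>R field (a \<tau>) k) (at \<tau>)"
    and b: "\<And>\<tau> k. 0 \<le> \<tau> \<Longrightarrow> \<tau> \<le> t \<Longrightarrow> k \<in> K \<Longrightarrow> ((\<lambda>\<tau>. b \<tau> k) has_vector_derivative g *\<^sub>R field (b \<tau>) k) (at \<tau>)"
    and ab: "\<And>k. k \<in> K \<Longrightarrow> a 0 k = b 0 k" and k: "k \<in> K"
  shows "a t k = b t k"
proof -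
  have ca: "continuous_on {0..t} (\<lambda>\<tau>. a \<tau> k)" if "k \<in> K" for k
    using has_vector_derivative_continuous[OF a[OF _ _ that]] by (intro continuous_at_imp_continuous_on) auto
  have cb: "continuous_on {0..t} (\<lambda>\<tau>. b \<tau> k)" if "k \<in> K" for k
    using has_vector_derivative_continuous[OF b[OF _ _ that]] by (intro continuous_at_imp_continuous_on) auto
  let ?m = "\<lambda>\<tau>. (\<Sum>k\<in>K. norm (a \<tau> k)) + (\<Sum>k\<in>K. norm (b \<tau> k))"
  have "continuous_on {0..t} ?m" by (intro continuous_intros ca cb)
  from continuous_attains_sup[OF compact_Icc _ this] obtain \<tau>0 where \<tau>0: "\<And>\<tau>. \<tau> \<in> {0..t} \<Longrightarrow> ?m \<tau> \<le> ?m \<tau>0"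
    using t by fastforce
  define r where "r = ?m \<tau>0"
  have r0: "0 \<le> r" by (simp add: r_def sum_nonneg add_nonneg_nonneg)
  have bd: "norm (a \<tau> k) \<le> r \<and> norm (b \<tau> k) \<le> r" if "\<tau> \<in> {0..t}" "k \<in> K" for \<tau> k
  proof -
    have "norm (a \<tau> k) \<le> (\<Sum>k\<in>K. norm (a \<tau> k))" "norm (b \<tau> k) \<le> (\<Sum>k\<in>K. norm (b \<tau> k))"
      using that by (auto intro!: member_le_sum)
    moreover have "0 \<le> (\<Sum>k\<in>K. norm (a \<tau> k))" "0 \<le> (\<Sum>k\<in>K. norm (b \<tau> k))" by (auto intro!: sum_nonneg)
    ultimately show ?thesis using \<tau>0[OF that(1)] unfolding r_def by linarith
  qed
  obtain L where L: "L \<ge> 0" and LL: "\<forall>c d. (\<forall>k\<in>K. norm (c k) \<le> r \<and> norm (d k) \<le> r) \<longrightarrow>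
    (\<forall>k. norm (field c k - field d k) \<le> L * (\<Sum>l\<in>K. norm (c l - d l)))"
    using field_lipschitz[OF r0] by blast
  define D where "D \<tau> = (\<Sum>k\<in>K. (a \<tau> k - b \<tau> k) \<bullet> (a \<tau> k - b \<tau> k))" for \<tau>
  define D' where "D' \<tau> = (\<Sum>k\<in>K. 2 * ((a \<tau> k - b \<tau> k) \<bullet> (g *\<^sub>R field (a \<tau>) k - g *\<^sub>R field (b \<tau>) k)))" for \<tau>
  have "D t \<le> D 0 * exp ((2 * L * real (card K)) * t)"
  proof (rule gronwall_le[OF t])
    fix \<tau> assume \<tau>: "0 \<le> \<tau>" "\<tau> \<le> t"
    have "(D has_vector_derivative D' \<tau>) (at \<tau>)"
      unfolding D_def D'_def
    proof (rule has_vector_derivative_sum)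
      fix k assume k: "k \<in> K"
      have d: "((\<lambda>\<tau>. a \<tau> k - b \<tau> k) has_vector_derivative (g *\<^sub>R field (a \<tau>) k - g *\<^sub>R field (b \<tau>) k)) (at \<tau>)"
        by (intro has_vector_derivative_diff a b \<tau> k)
      from bounded_bilinear.has_vector_derivative[OF bounded_bilinear_inner d d]
      show "((\<lambda>\<tau>. (a \<tau> k - b \<tau> k) \<bullet> (a \<tau> k - b \<tau> k)) has_vector_derivative 2 * ((a \<tau> k - b \<tau> k) \<bullet> (g *\<^sub>R field (a \<tau>) k - g *\<^sub>R field (b \<tau>) k))) (at \<tau>)"
        by (simp add: inner_commute)
    qed
    then show "(D has_real_derivative D' \<tau>) (at \<tau>)" by (simp add: has_real_derivative_iff_has_vector_derivative)
    let ?S = "\<Sum>l\<in>K. norm (a \<tau> l - b \<tau> l)"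
    have "D' \<tau> \<le> (\<Sum>k\<in>K. 2 * (norm (a \<tau> k - b \<tau> k) * (L * ?S)))"
      unfolding D'_def
    proof (intro sum_mono mult_left_mono)
      fix k
      have "norm (g *\<^sub>R field (a \<tau>) k - g *\<^sub>R field (b \<tau>) k) = \<bar>g\<bar> * norm (field (a \<tau>) k - field (b \<tau>) k)"
        by (simp flip: scaleR_diff_right)
      also have "\<dots> \<le> 1 * (L * ?S)" using LL bd \<tau> g by (intro mult_mono) auto
      finally have "norm (a \<tau> k - b \<tau> k) * norm (g *\<^sub>R field (a \<tau>) k - g *\<^sub>R field (b \<tau>) k) \<le> norm (a \<tau> k - b \<tau> k) * (L * ?S)"
        by (intro mult_left_mono) auto
      then show "(a \<tau> k - b \<tau> k) \<bullet> (g *\<^sub>R field (a \<tau>) k - g *\<^sub>R field (b \<tau>) k) \<le> norm (a \<tau> k - b \<tau> k) * (L * ?S)"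
        using norm_cauchy_schwarz[of "a \<tau> k - b \<tau> k" "g *\<^sub>R field (a \<tau>) k - g *\<^sub>R field (b \<tau>) k"] by linarith
    qed simp
    also have "\<dots> = 2 * L * ?S\<^sup>2"
      by (simp add: power2_eq_square mult_ac flip: sum_distrib_left sum_distrib_right)
    also have "?S\<^sup>2 \<le> real (card K) * D \<tau>"
      using sum_squared_le_sum_of_squares[of "\<lambda>l. norm (a \<tau> l - b \<tau> l)" K] by (simp add: D_def power2_norm_eq_inner mult.commute)
    then have "2 * L * ?S\<^sup>2 \<le> 2 * L * (real (card K) * D \<tau>)" using L by (intro mult_left_mono) auto
    finally show "D' \<tau> \<le> (2 * L * real (card K)) * D \<tau>" by (simp add: mult.assoc)
  qed
  moreover have "D 0 = 0" using ab by (simp add: D_def)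
  ultimately have "D t \<le> 0" by simp
  moreover have "(a t k - b t k) \<bullet> (a t k - b t k) \<le> D t" unfolding D_def using k by (intro member_le_sum) auto
  ultimately have "(a t k - b t k) \<bullet> (a t k - b t k) = 0" using inner_ge_zero[of "a t k - b t k"] by linarith
  then show ?thesis by simp
qed

lemma classical_unique:
  assumes U: "classical_solution F (sharp_filter N U0) s I U" and V: "classical_solution F (sharp_filter N U0) s J V"
    and t: "t \<in> I" "t \<in> J"
  shows "U t = V t"
proof -
  note IU = classical_interval[OF U] and IV = classical_interval[OF V]
  define g where "g = (if 0 \<le> t then 1 else - 1 :: real)"
  have gt: "g * \<bar>t\<bar> = t" and gg: "\<bar>g\<bar> = 1" "\<bar>g\<bar> \<le> 1" by (auto simp: g_def)
  have mem: "g * \<tau> \<in> I \<and> g * \<tau> \<in> J" if "0 \<le> \<tau>" "\<tau> \<le> \<bar>t\<bar>" for \<tau>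
  proof (cases "0 \<le> t")
    case True
    then show ?thesis using that t IU(3) IV(3) mem_is_interval_1_I[OF IU(2)] mem_is_interval_1_I[OF IV(2)] unfolding g_def by (metis abs_of_nonneg mult_1)
  next
    case False
    then have "t \<le> - \<tau>" "- \<tau> \<le> 0" using that by auto
    then have "- \<tau> \<in> I" "- \<tau> \<in> J" using t IU(3) IV(3) mem_is_interval_1_I[OF IU(2)] mem_is_interval_1_I[OF IV(2)] by blast+
    then show ?thesis using False by (simp add: g_def)
  qed
  have chain: "((\<lambda>\<tau>. f (g * \<tau>)) has_vector_derivative g *\<^sub>R D) (at \<tau>)" if "(f has_vector_derivative D) (at (g * \<tau>))" for f :: "real \<Rightarrow> complex ^ 'n" and D \<tau>
  proof -
    have "((\<lambda>\<tau>. g * \<tau>) has_vector_derivative g) (at \<tau>)"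
      unfolding has_real_derivative_iff_has_vector_derivative[symmetric] by (auto intro!: derivative_eq_intros)
    from vector_diff_chain_at[OF this that] show ?thesis by (simp add: o_def)
  qed
  have co: "fourier_coeff (U (g * \<bar>t\<bar>)) k = fourier_coeff (V (g * \<bar>t\<bar>)) k" if k: "k \<in> K" for k
  proof (rule coefficient_system_unique[where g=g and a="\<lambda>\<tau>. fourier_coeff (U (g * \<tau>))" and b="\<lambda>\<tau>. fourier_coeff (V (g * \<tau>))"])
    show "((\<lambda>\<tau>. fourier_coeff (U (g * \<tau>)) k) has_vector_derivative g *\<^sub>R field (fourier_coeff (U (g * \<tau>))) k) (at \<tau>)"
      if "0 \<le> \<tau>" "\<tau> \<le> \<bar>t\<bar>" "k \<in> K" for \<tau> k
      by (rule chain[OF classical_coefficient_ode[OF U]]) (use mem that in auto)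
    show "((\<lambda>\<tau>. fourier_coeff (V (g * \<tau>)) k) has_vector_derivative g *\<^sub>R field (fourier_coeff (V (g * \<tau>))) k) (at \<tau>)"
      if "0 \<le> \<tau>" "\<tau> \<le> \<bar>t\<bar>" "k \<in> K" for \<tau> k
      by (rule chain[OF classical_coefficient_ode[OF V]]) (use mem that in auto)
    show "fourier_coeff (U (g * 0)) k = fourier_coeff (V (g * 0)) k" for k
      using U V by (simp add: classical_solution_def)
  qed (use gg k in auto)
  have "U t = tsum K (fourier_coeff (U t))" by (rule classical_band_limited(2)[OF U t(1)])
  also have "\<dots> = tsum K (fourier_coeff (V t))"
    by (rule ext, rule tsum_cong) (use co gt in simp)
  also have "\<dots> = V t" by (rule classical_band_limited(2)[OF V t(2), symmetric])
  finally show ?thesis .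
qed

end

section \<open>Growth of Sobolev norms\<close>

text \<open>
  Gronwall's inequality for the squared norm. Two Sobolev norms occur: the one that grows, of order
  \<open>\<sigma>\<close>, and the one of order \<open>s\<close> whose bound \<open>m\<close> controls \<open>wnorm\<close> and thereby the rate. The rate depends linearly
  on \<open>m\<close>; the bound \<open>M\<close> only determines the constant \<open>\<kappa>\<close>.
\<close>

lemma sobolev_growth:
  fixes chi :: "real ^ 'd \<Rightarrow> real" and Q :: "'d \<Rightarrow> real ^ 'n \<Rightarrow> real ^ 'n ^ 'n"
  assumes chi: "admissible_cutoff chi" and symP: "\<And>j. transpose (P j) = P j"
    and symQ: "\<And>j v. transpose (Q j v) = Q j v"
    and poly: "\<And>j p q. real_polynomial_function (\<lambda>v. Q j v $ p $ q)"
    and s: "s > real CARD('d) / 2 + 1" and \<sigma>: "1 \<le> \<sigma>" and M: "0 \<le> M"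
  shows "\<exists>\<kappa>\<ge>0. \<forall>N F c m t. filtered_problem chi P Q N s F \<longrightarrow> 0 \<le> t \<longrightarrow> m \<le> M \<longrightarrow>
    (\<forall>\<tau>\<in>{0..t}. herm (c \<tau>) \<and> hnorm s (band N) (c \<tau>) \<le> m \<and>
       (\<forall>k\<in>band N. ((\<lambda>\<tau>. c \<tau> k) has_vector_derivative filtered_problem.field N F (c \<tau>) k) (at \<tau>))) \<longrightarrow>
    hnorm \<sigma> (band N) (c t) \<le> hnorm \<sigma> (band N) (c 0) * exp (\<kappa> * m * t)"
proof -
  obtain B where B: "B > 0" "\<forall>F a. finite F \<longrightarrow> (\<forall>k. 0 \<le> a k) \<longrightarrow>
    (\<Sum>k\<in>F. bracket (k :: int ^ 'd) * a k) \<le> B * L2_set (\<lambda>k. bracket k powr s * a k) F"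
    using sobolev_finite[OF s] by blast
  have BW: "wnorm (band N) c \<le> B * hnorm s (band N) c" for N and c :: "int ^ 'd \<Rightarrow> complex ^ 'n"
    unfolding wnorm_def hnorm_def using B(2) by simp
  have "0 \<le> B * M" using B M by simp
  from energy_estimate[where P=P and Q=Q, OF chi symP symQ poly \<sigma> this] obtain C where C: "C \<ge> 0" and CC: "\<forall>N\<ge>1. \<forall>c. herm c \<longrightarrow> wnorm (band N) c \<le> B * M \<longrightarrow>
    \<bar>\<Sum>k\<in>band N. bracket k powr (2 * \<sigma>) * (c k \<bullet> fourier_coeff (hyp_op chi P Q N (tsum (band N) c)) k)\<bar>
     \<le> C * wnorm (band N) c * (hnorm \<sigma> (band N) c)\<^sup>2" by blast
  show ?thesis
  proof (intro exI[of _ "C * B"] conjI allI impI)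
    show "0 \<le> C * B" using C B by simp
    fix N F m t and c :: "real \<Rightarrow> int ^ 'd \<Rightarrow> complex ^ 'n"
    assume fp: "filtered_problem chi P Q N s F" and t: "0 \<le> t" and m: "m \<le> M"
      and c: "\<forall>\<tau>\<in>{0..t}. herm (c \<tau>) \<and> hnorm s (band N) (c \<tau>) \<le> m \<and>
       (\<forall>k\<in>band N. ((\<lambda>\<tau>. c \<tau> k) has_vector_derivative filtered_problem.field N F (c \<tau>) k) (at \<tau>))"
    interpret filtered_problem chi P Q N s F by fact
    define D where "D \<tau> = (\<Sum>k\<in>K. bracket k powr (2 * \<sigma>) * (c \<tau> k \<bullet> c \<tau> k))" for \<tau>
    define D' where "D' \<tau> = (\<Sum>k\<in>K. bracket k powr (2 * \<sigma>) * (2 * (c \<tau> k \<bullet> field (c \<tau>) k)))" for \<tau>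
    have Dh: "D \<tau> = (hnorm \<sigma> K (c \<tau>))\<^sup>2" for \<tau>
      unfolding D_def hnorm_def L2_set_def
      by (simp add: sum_nonneg power_mult_distrib powr_power power2_norm_eq_inner)
    have "D t \<le> D 0 * exp ((2 * (C * B * m)) * t)"
    proof (rule gronwall_le[OF t])
      fix \<tau> assume \<tau>: "0 \<le> \<tau>" "\<tau> \<le> t"
      then have h: "herm (c \<tau>)" and le: "hnorm s K (c \<tau>) \<le> m"
        and d: "\<And>k. k \<in> K \<Longrightarrow> ((\<lambda>\<tau>. c \<tau> k) has_vector_derivative field (c \<tau>) k) (at \<tau>)" using c by auto
      have "(D has_vector_derivative D' \<tau>) (at \<tau>)"
        unfolding D_def D'_def
      proof (rule has_vector_derivative_sum)
        fix k assume k: "k \<in> K"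
        from bounded_bilinear.has_vector_derivative[OF bounded_bilinear_inner d[OF k] d[OF k]]
        have "((\<lambda>\<tau>. c \<tau> k \<bullet> c \<tau> k) has_vector_derivative 2 * (c \<tau> k \<bullet> field (c \<tau>) k)) (at \<tau>)"
          by (simp add: inner_commute)
        then show "((\<lambda>\<tau>. bracket k powr (2 * \<sigma>) * (c \<tau> k \<bullet> c \<tau> k)) has_vector_derivative bracket k powr (2 * \<sigma>) * (2 * (c \<tau> k \<bullet> field (c \<tau>) k))) (at \<tau>)"
          by (rule has_vector_derivative_mult_right)
      qed
      then show "(D has_real_derivative D' \<tau>) (at \<tau>)" by (simp add: has_real_derivative_iff_has_vector_derivative)
      have W: "wnorm K (c \<tau>) \<le> B * m"
        using BW[of N "c \<tau>"] mult_left_mono[OF le, of B] B by linarith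
      have "B * m \<le> B * M" using B m by (intro mult_left_mono) auto
      then have W': "wnorm K (c \<tau>) \<le> B * M" using W by linarith
      have "D' \<tau> = - 2 * (\<Sum>k\<in>K. bracket k powr (2 * \<sigma>) * (c \<tau> k \<bullet> fourier_coeff (hyp_op chi P Q N (tsum K (c \<tau>))) k))"
        unfolding D'_def sum_distrib_left
        by (intro sum.cong refl) (simp add: field_def F[OF Hs_differentiable_band_tsum])
      also have "\<dots> \<le> 2 * (C * wnorm K (c \<tau>) * (hnorm \<sigma> K (c \<tau>))\<^sup>2)"
        using CC[rule_format, OF N h W'] by linarith
      also have "\<dots> \<le> 2 * (C * (B * m) * (hnorm \<sigma> K (c \<tau>))\<^sup>2)"
        using W C by (intro mult_left_mono mult_right_mono) auto
      finally show "D' \<tau> \<le> (2 * (C * B * m)) * D \<tau>" by (simp add: Dh mult_ac)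
    qed
    also have "\<dots> = (hnorm \<sigma> K (c 0) * exp (C * B * m * t))\<^sup>2"
      by (simp add: Dh power_mult_distrib exp_double[symmetric] mult.assoc)
    finally have "(hnorm \<sigma> K (c t))\<^sup>2 \<le> (hnorm \<sigma> K (c 0) * exp (C * B * m * t))\<^sup>2" by (simp only: Dh)
    then show "hnorm \<sigma> K (c t) \<le> hnorm \<sigma> K (c 0) * exp (C * B * m * t)"
      by (rule power2_le_imp_le) simp
  qed
qed

lemma hnorm_sharp_le:
  assumes "f \<in> Hs s"
  shows "hnorm s (band N) (fourier_coeff f) \<le> Hs_norm s f"
proof -
  have "(\<Sum>k\<in>band N. (bracket k powr s * norm (fourier_coeff f k))\<^sup>2) = (\<Sum>k\<in>band N. bracket k powr (2 * s) * (norm (fourier_coeff f k))\<^sup>2)"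
    by (intro sum.cong refl) (simp add: power_mult_distrib powr_power)
  also have "\<dots> \<le> (\<Sum>\<^sub>\<infinity>k. bracket k powr (2 * s) * (norm (fourier_coeff f k))\<^sup>2)"
    by (rule finite_sum_le_infsum) (use assms in \<open>auto simp: Hs_def\<close>)
  finally show ?thesis by (simp add: hnorm_def L2_set_def Hs_norm_def)
qed

section \<open>Existence on a time interval of controlled length\<close>

context filtered_problem
begin

lemma sharp_filter_coefficients:
  "k \<in> K \<Longrightarrow> fourier_coeff (sharp_filter N U0) k = fourier_coeff U0 k"
  "k \<notin> K \<Longrightarrow> fourier_coeff (sharp_filter N U0) k = 0"
  unfolding sharp_filter_eq_tsum by (subst fourier_coeff_tsum; simp add: herm_fourier_coeff)+

lemma sharp_filter_eq: "sharp_filter N U0 = tsum K (fourier_coeff (sharp_filter N U0))"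
  unfolding sharp_filter_eq_tsum by (rule ext, rule tsum_cong, subst fourier_coeff_tsum) (simp_all add: herm_fourier_coeff)

text \<open>
  Covers initial values of norm zero, for which the solution has to exist for all positive times.
\<close>

lemma zero_solution:
  assumes "\<And>k. k \<in> K \<Longrightarrow> fourier_coeff U0 k = 0"
  shows "classical_solution F (sharp_filter N U0) s UNIV (\<lambda>t. tsum K (\<lambda>k. 0))"
proof -
  have z: "tsum K (\<lambda>k. 0) = (\<lambda>x :: real ^ 'd. 0 :: real ^ 'n)" by (rule ext) (simp add: tsum_def vec_eq_iff)
  have "F (\<lambda>x. 0) = (\<lambda>x. 0)" using F[OF Hs_differentiable_zero] hyp_op_zero[OF chi N, of P Q] by (simp add: fun_eq_iff)
  then have f: "field (\<lambda>k. 0) k = 0" for k by (simp add: field_def z) (simp add: vec_eq_iff fourier_coeff_nth)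
  have "classical_solution F (tsum K ((\<lambda>t k. 0) (0::real))) s UNIV (\<lambda>t. tsum K ((\<lambda>t k. 0) t))"
    by (rule classical_from_coefficients) (auto simp: f herm_def)
  moreover have "sharp_filter N U0 = tsum K (\<lambda>k. 0)"
    unfolding sharp_filter_eq_tsum by (rule ext, rule tsum_cong) (rule assms)
  ultimately show ?thesis by simp
qed

text \<open>
  The solution of the truncated system solves the true system as long as its norm is at most the
  radius \<open>r = 2 |U\<^sup>0| + 1\<close>. As long as the norm is at most \<open>2 |U\<^sup>0|\<close>, the growth bound keeps it
  strictly below \<open>2 |U\<^sup>0|\<close> up to time \<open>T / |U\<^sup>0|\<close>, so it never reaches this value. By continuity it stays below
  \<open>r\<close> on a slightly larger open interval.
\<close>

lemma controlled_solution:
  assumes \<kappa>: "\<And>c m t. 0 \<le> t \<Longrightarrow> m \<le> 2 * M \<Longrightarrow>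
    (\<forall>\<tau>\<in>{0..t}. herm (c \<tau>) \<and> hnorm s K (c \<tau>) \<le> m \<and>
       (\<forall>k\<in>K. ((\<lambda>\<tau>. c \<tau> k) has_vector_derivative field (c \<tau>) k) (at \<tau>))) \<Longrightarrow>
    hnorm s K (c t) \<le> hnorm s K (c 0) * exp (\<kappa> * m * t)"
    and kp: "0 < \<kappa>" and T: "0 < T" "exp (2 * \<kappa> * T) < 2"
    and U0: "U0 \<in> Hs s" "Hs_norm s U0 \<le> M"
  shows "\<exists>J V. classical_solution F (sharp_filter N U0) s J V \<and> time_interval T (Hs_norm s U0) \<subseteq> J \<and>
    (\<forall>t\<in>time_interval T (Hs_norm s U0). Hs_norm s (V t) \<le> Hs_norm s U0 * exp (2 * \<kappa> * Hs_norm s U0 * t))"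
proof (cases "Hs_norm s U0 = 0")
  case True
  have "norm (fourier_coeff U0 k) \<le> 0" if "k \<in> K" for k
    using hnorm_component_le[OF finite_band that s_pos, of "fourier_coeff U0"] hnorm_sharp_le[OF U0(1), of N] True by linarith
  then have z: "\<And>k. k \<in> K \<Longrightarrow> fourier_coeff U0 k = 0" by simp
  have "Hs_norm s (tsum K (\<lambda>k. 0) :: real ^ 'd \<Rightarrow> real ^ 'n) = 0"
    by (subst Hs_tsum_band) (simp_all add: herm_def)
  then show ?thesis using zero_solution[OF z] True by (intro exI[of _ UNIV] exI[of _ "\<lambda>t. tsum K (\<lambda>k. 0)"]) simp
next
  case False
  define \<rho> where "\<rho> = Hs_norm s U0"
  have \<rho>: "0 < \<rho>" "\<rho> \<le> M" using False U0 Hs_norm_nonneg[of s U0] by (auto simp: \<rho>_def less_le)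
  define r where "r = 2 * \<rho> + 1"
  define c0 where "c0 = fourier_coeff (sharp_filter N U0)"
  have "0 \<le> r" using \<rho> by (simp add: r_def)
  from truncated_system[OF this, of c0] obtain c where c00: "c 0 = c0"
    and ch: "\<And>t. herm (c t)" and dc: "\<And>t k. ((\<lambda>\<tau>. c \<tau> k) has_vector_derivative field (\<lambda>l. closest_point (cball 0 r) (c t l)) k) (at t)"
    and supp: "\<And>t k. k \<notin> K \<Longrightarrow> c t k = 0"
    using sharp_filter_coefficients(2)[of _ U0] by (auto simp: c0_def herm_fourier_coeff)
  define H where "H t = hnorm s K (c t)" for t
  have cH: "isCont H t" for t
    unfolding H_def isCont_def
    by (rule tendsto_hnorm) (use has_vector_derivative_continuous[OF dc] in \<open>auto simp: continuous_at\<close>)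
  have ode: "((\<lambda>\<tau>. c \<tau> k) has_vector_derivative field (c t) k) (at t)" if "H t \<le> r" for t k
  proof -
    have "norm (c t l) \<le> r" for l
    proof (cases "l \<in> K")
      case True
      then show ?thesis using hnorm_component_le[OF finite_band True s_pos, of "c t"] that by (simp add: H_def)
    next
      case False then show ?thesis using supp \<rho> by (simp add: r_def)
    qed
    then have "closest_point (cball 0 r) (c t l) = c t l" for l by (intro closest_point_self) simp
    then show ?thesis using dc[where t=t and k=k] by simp
  qed
  have H0: "H 0 \<le> \<rho>"
  proof -
    have "H 0 = hnorm s K (fourier_coeff U0)"
      unfolding H_def c00 c0_def hnorm_def by (rule L2_set_cong) (simp_all add: sharp_filter_coefficients)
    then show ?thesis using hnorm_sharp_le[OF U0(1), of N] by (simp add: \<rho>_def)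
  qed
  have growth: "H t \<le> \<rho> * exp (2 * \<kappa> * \<rho> * t)" if t: "0 \<le> t" and le: "\<And>\<tau>. \<tau> \<in> {0..t} \<Longrightarrow> H \<tau> \<le> 2 * \<rho>" for t
  proof -
    have "hnorm s K (c t) \<le> hnorm s K (c 0) * exp (\<kappa> * (2 * \<rho>) * t)"
    proof (rule \<kappa>[OF t])
      show "2 * \<rho> \<le> 2 * M" using \<rho> by simp
      show "\<forall>\<tau>\<in>{0..t}. herm (c \<tau>) \<and> hnorm s K (c \<tau>) \<le> 2 * \<rho> \<and> (\<forall>k\<in>K. ((\<lambda>\<tau>. c \<tau> k) has_vector_derivative field (c \<tau>) k) (at \<tau>))"
      proof
        fix \<tau> assume "\<tau> \<in> {0..t}"
        then have l: "H \<tau> \<le> 2 * \<rho>" by (rule le)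
        then have "H \<tau> \<le> r" by (simp add: r_def)
        then show "herm (c \<tau>) \<and> hnorm s K (c \<tau>) \<le> 2 * \<rho> \<and> (\<forall>k\<in>K. ((\<lambda>\<tau>. c \<tau> k) has_vector_derivative field (c \<tau>) k) (at \<tau>))"
          using l ch ode by (simp add: H_def)
      qed
    qed
    also have "\<dots> \<le> \<rho> * exp (\<kappa> * (2 * \<rho>) * t)" using H0 by (intro mult_right_mono) (auto simp: H_def)
    finally show ?thesis by (simp add: H_def mult_ac)
  qed
  define T' where "T' = T / \<rho>"
  have T': "0 < T'" "\<rho> * T' = T" using T \<rho> by (simp_all add: T'_def)
  have small: "\<rho> * exp (2 * \<kappa> * \<rho> * t) < 2 * \<rho>" if "t \<le> T'" for t
  proof -
    have "2 * \<kappa> * (\<rho> * t) \<le> 2 * \<kappa> * (\<rho> * T')" using that \<rho> kp by (intro mult_left_mono) auto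
    then have "exp (2 * \<kappa> * \<rho> * t) \<le> exp (2 * \<kappa> * T)" by (simp only: T'(2) mult.assoc exp_le_cancel_iff)
    then have "exp (2 * \<kappa> * \<rho> * t) < 2" using T(2) by linarith
    then show ?thesis using \<rho> by simp
  qed
  have boot: "H t < 2 * \<rho>" if t: "t \<in> {0..T'}" for t
  proof (rule ccontr)
    assume "\<not> H t < 2 * \<rho>"
    then have big: "2 * \<rho> \<le> H t" by simp
    have cHon: "continuous_on S H" for S using cH by (intro continuous_at_imp_continuous_on) auto
    let ?A = "{0..T'} \<inter> H -` {2 * \<rho>}"
    have hit: "\<exists>x\<ge>0. x \<le> \<tau> \<and> H x = 2 * \<rho>" if "0 \<le> \<tau>" "2 * \<rho> \<le> H \<tau>" for \<tau>
      using IVT'[of H 0 "2 * \<rho>" \<tau>] H0 \<rho> that cHon by auto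
    obtain x0 where "0 \<le> x0" "x0 \<le> t" "H x0 = 2 * \<rho>" using hit[OF _ big] t by auto
    then have "x0 \<in> ?A" using t by auto
    then have "?A \<noteq> {}" by blast
    moreover have "compact ?A" by (intro compact_Int_closed compact_Icc continuous_closed_vimage closed_singleton cH)
    ultimately have "\<exists>t1\<in>?A. \<forall>\<tau>\<in>?A. t1 \<le> \<tau>" by (intro compact_attains_inf)
    \<comment> \<open>The first time at which the norm equals \<open>2 \<rho>\<close>: up to this time the growth bound applies.\<close>
    then obtain t1 where t1: "t1 \<in> ?A" "\<And>\<tau>. \<tau> \<in> ?A \<Longrightarrow> t1 \<le> \<tau>" by blast
    have Hle: "H \<tau> \<le> 2 * \<rho>" if \<tau>1: "\<tau> \<in> {0..t1}" for \<tau>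
    proof (rule ccontr)
      assume "\<not> H \<tau> \<le> 2 * \<rho>"
      then obtain x where x: "0 \<le> x" "x \<le> \<tau>" "H x = 2 * \<rho>" using hit[of \<tau>] \<tau>1 by auto
      then have "t1 \<le> x" using t1 \<tau>1 by (intro t1(2)) auto
      then have "x = \<tau>" using x \<tau>1 by simp
      then show False using x \<open>\<not> H \<tau> \<le> 2 * \<rho>\<close> by simp
    qed
    have "0 \<le> t1" using t1(1) by simp
    from growth[OF this Hle] have "H t1 \<le> \<rho> * exp (2 * \<kappa> * \<rho> * t1)" .
    also have "\<dots> < 2 * \<rho>" using t1(1) by (intro small) auto
    finally show False using t1(1) by simp
  qed
  have "\<exists>\<delta>>0. \<forall>\<tau>. dist \<tau> t < \<delta> \<longrightarrow> H \<tau> < r" if "t \<in> {0..T'}" for t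
  proof -
    have "(H \<longlongrightarrow> H t) (nhds t)" using cH[of t] by (simp add: isCont_def tendsto_at_iff_tendsto_nhds)
    then have "\<forall>\<^sub>F \<tau> in nhds t. H \<tau> < r" by (rule order_tendstoD) (use boot[OF that] in \<open>simp add: r_def\<close>)
    then show ?thesis by (simp add: eventually_nhds_metric)
  qed
  from this[of 0] this[of T'] T' obtain \<delta>1 \<delta>2 where \<delta>: "\<delta>1 > 0" "\<And>\<tau>. dist \<tau> 0 < \<delta>1 \<Longrightarrow> H \<tau> < r" 
    "\<delta>2 > 0" "\<And>\<tau>. dist \<tau> T' < \<delta>2 \<Longrightarrow> H \<tau> < r" by auto
  define J where "J = {- \<delta>1<..<T' + \<delta>2}"
  have HJ: "H \<tau> < r" if "\<tau> \<in> J" for \<tau>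
  proof -
    consider "\<tau> < 0" | "\<tau> \<in> {0..T'}" | "T' < \<tau>" by fastforce
    then show ?thesis
    proof cases
      case 1 then show ?thesis using that \<delta>(2)[of \<tau>] by (simp add: J_def dist_real_def)
    next
      case 2 then show ?thesis using boot[OF 2] by (simp add: r_def)
    next
      case 3 then show ?thesis using that \<delta>(4)[of \<tau>] by (simp add: J_def dist_real_def)
    qed
  qed
  have "classical_solution F (tsum K (c 0)) s J (\<lambda>t. tsum K (c t))"
  proof (rule classical_from_coefficients)
    show "open J" "is_interval J" "0 \<in> J" using \<delta> T' by (auto simp: J_def is_interval_oo)
    show "((\<lambda>\<tau>. c \<tau> k) has_vector_derivative field (c t) k) (at t)" if "t \<in> J" for t k
      using HJ[OF that] by (intro ode) simp
  qed (rule ch)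
  then have "classical_solution F (sharp_filter N U0) s J (\<lambda>t. tsum K (c t))"
    unfolding c00 c0_def by (simp only: sharp_filter_eq[symmetric])
  moreover have ti: "time_interval T (Hs_norm s U0) = {0..T'}" using False by (simp add: time_interval_def T'_def \<rho>_def)
  moreover have "{0..T'} \<subseteq> J" using \<delta> by (auto simp: J_def)
  moreover have "Hs_norm s (tsum K (c t)) \<le> \<rho> * exp (2 * \<kappa> * \<rho> * t)" if "t \<in> {0..T'}" for t
  proof -
    have "H t \<le> \<rho> * exp (2 * \<kappa> * \<rho> * t)" using that boot by (intro growth) (auto intro: less_imp_le)
    then show ?thesis by (simp add: Hs_tsum_band(2)[OF ch] H_def)
  qed
  ultimately show ?thesis unfolding \<rho>_def[symmetric] by (intro exI[of _ J] exI[of _ "\<lambda>t. tsum K (c t)"]) simp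
qed

end

section \<open>Maximal solutions\<close>

text \<open>
  By uniqueness any two solutions agree on the intersection of their intervals, so all solutions can
  be glued to one on the union of the intervals. A maximal solution cannot live on a smaller interval, since the
  glued solution would extend it.
\<close>

lemma maximal_solution_exists:
  assumes ex: "classical_solution F u0 s I0 U0"
    and uniq: "\<And>I U J V t. classical_solution F u0 s I U \<Longrightarrow> classical_solution F u0 s J V \<Longrightarrow> t \<in> I \<Longrightarrow> t \<in> J \<Longrightarrow> U t = V t"
  shows "\<exists>I U. maximal_solution F u0 s I U \<and>
    (\<forall>J V. maximal_solution F u0 s J V \<longrightarrow> J = I \<and> (\<forall>t\<in>I. V t = U t)) \<and>
    (\<forall>J V. classical_solution F u0 s J V \<longrightarrow> J \<subseteq> I \<and> (\<forall>t\<in>J. V t = U t))"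
proof -
  define I where "I = \<Union>{J. \<exists>V. classical_solution F u0 s J V}"
  define sol where "sol t = (SOME JV. classical_solution F u0 s (fst JV) (snd JV) \<and> t \<in> fst JV)" for t
  define U where "U t = snd (sol t) t" for t
  have UV: "U t = V t" if V: "classical_solution F u0 s J V" and t: "t \<in> J" for J V t
  proof -
    have "\<exists>JV. classical_solution F u0 s (fst JV) (snd JV) \<and> t \<in> fst JV" using V t by (intro exI[of _ "(J, V)"]) simp
    then have "classical_solution F u0 s (fst (sol t)) (snd (sol t)) \<and> t \<in> fst (sol t)" unfolding sol_def by (rule someI_ex)
    then show ?thesis unfolding U_def using uniq V t by blast
  qed
  have sub: "J \<subseteq> I" if "classical_solution F u0 s J V" for J V using that by (auto simp: I_def)
  have cover: "\<exists>J V. classical_solution F u0 s J V \<and> t \<in> J" if "t \<in> I" for t using that by (auto simp: I_def)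
  have oI: "open I" unfolding I_def by (rule open_Union) (auto simp: classical_solution_def)
  have cU: "classical_solution F u0 s I U"
    unfolding classical_solution_def
  proof (intro conjI ballI allI)
    show "open I" by (rule oI)
    have "connected I" unfolding I_def
      by (rule connected_Union) (auto simp: classical_solution_def is_interval_connected)
    then show "is_interval I" by (simp add: is_interval_connected_1)
    show "0 \<in> I" using ex by (auto simp: I_def classical_solution_def)
    show "U 0 = u0" using UV[OF ex] ex by (simp add: classical_solution_def)
    show "C0_Hs s I U" unfolding C0_Hs_def
    proof (intro conjI ballI)
      fix t assume t: "t \<in> I"
      then obtain J V where V: "classical_solution F u0 s J V" "t \<in> J" using cover by blast
      then have oJ: "open J" by (simp add: classical_solution_def)
      show "U t \<in> Hs s" using V UV[OF V] by (simp add: classical_solution_def C0_Hs_def)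
      have "((\<lambda>\<tau>. Hs_norm s (\<lambda>x. V \<tau> x - V t x)) \<longlongrightarrow> 0) (at t within J)"
        using V by (simp add: classical_solution_def C0_Hs_def)
      then have "((\<lambda>\<tau>. Hs_norm s (\<lambda>x. V \<tau> x - V t x)) \<longlongrightarrow> 0) (at t)" using at_within_open[OF V(2) oJ] by simp
      moreover have "\<forall>\<^sub>F \<tau> in at t. Hs_norm s (\<lambda>x. V \<tau> x - V t x) = Hs_norm s (\<lambda>x. U \<tau> x - U t x)"
        using eventually_at_topological[of "\<lambda>\<tau>. \<tau> \<in> J" t UNIV] oJ V(2)
        by (rule_tac eventually_mono[of "\<lambda>\<tau>. \<tau> \<in> J"]) (auto simp: UV[OF V(1)] V)
      ultimately have "((\<lambda>\<tau>. Hs_norm s (\<lambda>x. U \<tau> x - U t x)) \<longlongrightarrow> 0) (at t)" by (rule Lim_transform_eventually)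
      then show "((\<lambda>\<tau>. Hs_norm s (\<lambda>x. U \<tau> x - U t x)) \<longlongrightarrow> 0) (at t within I)"
        by (rule tendsto_within_subset) simp
    qed
    fix t x assume t: "t \<in> I"
    then obtain J V where V: "classical_solution F u0 s J V" "t \<in> J" using cover by blast
    then have oJ: "open J" by (simp add: classical_solution_def)
    show "U t differentiable (at x)" using V UV[OF V] by (simp add: classical_solution_def)
    have "((\<lambda>\<tau>. V \<tau> x) has_vector_derivative - F (V t) x) (at t)" using V by (simp add: classical_solution_def)
    then show "((\<lambda>\<tau>. U \<tau> x) has_vector_derivative - F (U t) x) (at t)"
      unfolding UV[OF V] by (rule has_vector_derivative_transform_within_open[OF _ oJ V(2)]) (simp add: UV[OF V(1)])
  qed
  have mU: "maximal_solution F u0 s I U"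
    unfolding maximal_solution_def using cU sub by blast
  have unique: "J = I \<and> (\<forall>t\<in>I. V t = U t)" if "maximal_solution F u0 s J V" for J V
  proof -
    have V: "classical_solution F u0 s J V" and nx: "\<And>J' W. J \<subset> J' \<Longrightarrow> classical_solution F u0 s J' W \<Longrightarrow> \<forall>t\<in>J. W t = V t \<Longrightarrow> False"
      using that unfolding maximal_solution_def by blast+
    have eq: "\<forall>t\<in>J. U t = V t" using UV[OF V] by blast
    have "J = I"
    proof (rule ccontr)
      assume "J \<noteq> I"
      then have "J \<subset> I" using sub[OF V] by blast
      then show False using cU eq by (rule nx)
    qed
    then show ?thesis using eq by simp
  qed
  have "J \<subseteq> I \<and> (\<forall>t\<in>J. V t = U t)" if V: "classical_solution F u0 s J V" for J V
    using sub[OF V] UV[OF V] by simp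
  with mU unique show ?thesis by (rule_tac exI[of _ I], rule_tac exI[of _ U]) blast
qed

lemma (in filtered_problem) maximal_solution_of_classical:
  assumes "classical_solution F (sharp_filter N U0) s J0 V0"
  shows "\<exists>I U. maximal_solution F (sharp_filter N U0) s I U \<and>
    (\<forall>J V. maximal_solution F (sharp_filter N U0) s J V \<longrightarrow> J = I \<and> (\<forall>t\<in>I. V t = U t)) \<and>
    (\<forall>J V. classical_solution F (sharp_filter N U0) s J V \<longrightarrow> J \<subseteq> I \<and> (\<forall>t\<in>J. V t = U t))"
proof (rule maximal_solution_exists[OF assms])
  fix I U J V t
  assume "classical_solution F (sharp_filter N U0) s I U" "classical_solution F (sharp_filter N U0) s J V" "t \<in> I" "t \<in> J"
  then show "U t = V t" by (rule classical_unique)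
qed

theorem proposition2p5:
  fixes A :: "'d::finite \<Rightarrow> real ^ 'n::finite \<Rightarrow> real ^ 'n ^ 'n"
    and chi :: "real ^ 'd \<Rightarrow> real"
    and s :: real
  assumes sym: "\<And>j v. transpose (A j v) = A j v"
    and poly: "\<And>j p q. real_polynomial_function (\<lambda>v. A j v $ p $ q)"
    and cutoff: "admissible_cutoff chi"
    and s: "s > real CARD('d) / 2 + 1"
  shows
    "(\<forall>M>0. \<exists>C>0. \<exists>T>0.
        \<forall>F \<in> {filtered_full chi A, filtered_nonlinear chi A}. \<forall>N\<ge>1.
        \<forall>U0::real ^ 'd \<Rightarrow> real ^ 'n. U0 \<in> Hs s \<and> Hs_norm s U0 \<le> M \<longrightarrow>
          (\<exists>I U. maximal_solution (F N) (sharp_filter N U0) s I U \<and>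
             (\<forall>J V. maximal_solution (F N) (sharp_filter N U0) s J V \<longrightarrow>
                J = I \<and> (\<forall>t\<in>I. V t = U t)) \<and>
             time_interval T (Hs_norm s U0) \<subseteq> I \<and>
             (\<forall>t \<in> time_interval T (Hs_norm s U0).
                Hs_norm s (U t) \<le> Hs_norm s U0 * exp (C * Hs_norm s U0 * t) \<and>
                Hs_norm s U0 * exp (C * Hs_norm s U0 * t) \<le> 2 * Hs_norm s U0) \<and>
             (\<forall>s'\<ge>s. C1_Hs s' I U)))
     \<and>
     (\<forall>s'\<ge>s. \<forall>Mstar>0. \<exists>Cstar>0.
        \<forall>F \<in> {filtered_full chi A, filtered_nonlinear chi A}. \<forall>N\<ge>1.
        \<forall>U0::real ^ 'd \<Rightarrow> real ^ 'n. U0 \<in> Hs s \<longrightarrow>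
          (\<forall>I U. maximal_solution (F N) (sharp_filter N U0) s I U \<longrightarrow>
             (\<forall>Tstar\<in>I. 0 < Tstar \<and>
                (SUP t\<in>{0..Tstar}. Hs_enorm s (U t)) \<le> ennreal Mstar \<longrightarrow>
                (\<forall>t\<in>{0..Tstar}. Hs_enorm s' (U t) \<le>
                    Hs_enorm s' U0 * ennreal (exp (Cstar * Mstar * t))))))"
proof -
  define P1 where "P1 = (\<lambda>_ :: 'd. 0 :: real ^ 'n ^ 'n)"
  define P2 where "P2 j = A j 0" for j
  define Q2 where "Q2 j v = A j v - A j 0" for j v
  have symP1: "transpose (P1 j) = P1 j" for j by (simp add: P1_def transpose_def vec_eq_iff)
  have symP2: "transpose (P2 j) = P2 j" for j by (simp add: P2_def sym)
  have symQ2: "transpose (Q2 j v) = Q2 j v" for j v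
    using sym[of j v] sym[of j 0] by (simp add: Q2_def transpose_def vec_eq_iff)
  have polyQ2: "real_polynomial_function (\<lambda>v. Q2 j v $ p $ q)" for j p q
    using real_polynomial_function_diff[OF poly[of j p q] real_polynomial_function.intros(2)[of "A j 0 $ p $ q"]] by (simp add: Q2_def)
  have fp1: "filtered_problem chi P1 A N s (filtered_full chi A N)" if "1 \<le> N" for N
    by unfold_locales (use cutoff s poly symP1 that in \<open>auto simp: filtered_full_eq_hyp_op P1_def\<close>)
  have fp2: "filtered_problem chi P2 Q2 N s (filtered_nonlinear chi A N)" if "1 \<le> N" for N
  proof
    fix V :: "real ^ 'd \<Rightarrow> real ^ 'n" assume "Hs_differentiable s V"
    from filtered_nonlinear_eq_hyp_op[OF s this cutoff that poly]
    show "filtered_nonlinear chi A N V = hyp_op chi P2 Q2 N V" by (simp add: P2_def[abs_def] Q2_def[abs_def])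
  qed (use cutoff s polyQ2 symP2 that in auto)
  have s1: "1 \<le> s"
  proof -
    have "0 \<le> real CARD('d) / 2" by simp
    then show ?thesis using s by linarith
  qed
  \<comment> \<open>The growth bound of \<open>sobolev_growth\<close> with rate \<open>\<kappa>\<close>, for one operator.\<close>
  define G where "G \<sigma> M \<kappa> N F \<longleftrightarrow> (\<forall>(c :: real \<Rightarrow> int ^ 'd \<Rightarrow> complex ^ 'n) m t. 0 \<le> t \<longrightarrow> m \<le> M \<longrightarrow>
    (\<forall>\<tau>\<in>{0..t}. herm (c \<tau>) \<and> hnorm s (band N) (c \<tau>) \<le> m \<and>
       (\<forall>k\<in>band N. ((\<lambda>\<tau>. c \<tau> k) has_vector_derivative filtered_problem.field N F (c \<tau>) k) (at \<tau>))) \<longrightarrow>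
    hnorm \<sigma> (band N) (c t) \<le> hnorm \<sigma> (band N) (c 0) * exp (\<kappa> * m * t))" for \<sigma> M \<kappa> N F
  have Gmono: "G \<sigma> M \<kappa>' N F" if "G \<sigma> M \<kappa> N F" "\<kappa> \<le> \<kappa>'" for \<sigma> M \<kappa> \<kappa>' N F
    unfolding G_def
  proof (intro allI impI)
    fix c :: "real \<Rightarrow> int ^ 'd \<Rightarrow> complex ^ 'n" and m t :: real
    assume a: "0 \<le> t" "m \<le> M" and b: "\<forall>\<tau>\<in>{0..t}. herm (c \<tau>) \<and> hnorm s (band N) (c \<tau>) \<le> m \<and>
       (\<forall>k\<in>band N. ((\<lambda>\<tau>. c \<tau> k) has_vector_derivative filtered_problem.field N F (c \<tau>) k) (at \<tau>))"
    have "hnorm s (band N) (c 0) \<le> m" using b a by auto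
    then have "0 \<le> m" using hnorm_nonneg[of s "band N" "c 0"] by linarith
    then have "\<kappa> * m * t \<le> \<kappa>' * m * t" using that a by (intro mult_right_mono) auto
    then have "hnorm \<sigma> (band N) (c 0) * exp (\<kappa> * m * t) \<le> hnorm \<sigma> (band N) (c 0) * exp (\<kappa>' * m * t)"
      by (intro mult_left_mono) auto
    moreover have "hnorm \<sigma> (band N) (c t) \<le> hnorm \<sigma> (band N) (c 0) * exp (\<kappa> * m * t)"
      using that(1) a b unfolding G_def by blast
    ultimately show "hnorm \<sigma> (band N) (c t) \<le> hnorm \<sigma> (band N) (c 0) * exp (\<kappa>' * m * t)" by linarith
  qed
  have Gex: "\<exists>\<kappa>>0. \<forall>F\<in>{filtered_full chi A, filtered_nonlinear chi A}. \<forall>N\<ge>1. G \<sigma> M \<kappa> N (F N)"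
    if \<sigma>: "1 \<le> \<sigma>" and M: "0 \<le> M" for \<sigma> M
  proof -
    obtain \<kappa>1 where k1: "\<kappa>1 \<ge> 0" "\<And>N F. filtered_problem chi P1 A N s F \<Longrightarrow> G \<sigma> M \<kappa>1 N F"
      using sobolev_growth[where P=P1 and Q=A, OF cutoff symP1 sym poly s \<sigma> M] unfolding G_def by blast
    obtain \<kappa>2 where k2: "\<kappa>2 \<ge> 0" "\<And>N F. filtered_problem chi P2 Q2 N s F \<Longrightarrow> G \<sigma> M \<kappa>2 N F"
      using sobolev_growth[where P=P2 and Q=Q2, OF cutoff symP2 symQ2 polyQ2 s \<sigma> M] unfolding G_def by blast
    show ?thesis
    proof (intro exI[of _ "\<kappa>1 + \<kappa>2 + 1"] conjI ballI allI impI)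
      show "0 < \<kappa>1 + \<kappa>2 + 1" using k1 k2 by simp
      fix F and N :: nat assume "F \<in> {filtered_full chi A, filtered_nonlinear chi A}" "1 \<le> N"
      then show "G \<sigma> M (\<kappa>1 + \<kappa>2 + 1) N (F N)"
        using Gmono[OF k1(2)[OF fp1]] Gmono[OF k2(2)[OF fp2]] k1(1) k2(1) by auto
    qed
  qed
  have fpex: "\<exists>P Q. filtered_problem chi P Q N s (F N)" if "F \<in> {filtered_full chi A, filtered_nonlinear chi A}" "1 \<le> N" for F N
    using that fp1 fp2 by blast
  show ?thesis
  proof (intro conjI allI impI)
    fix M :: real assume M: "0 < M"
    obtain \<kappa> where k: "\<kappa> > 0" and kG: "\<And>F N. F \<in> {filtered_full chi A, filtered_nonlinear chi A} \<Longrightarrow> 1 \<le> N \<Longrightarrow> G s (2 * M) \<kappa> N (F N)"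
      using Gex[OF s1, of "2 * M"] M by auto
    \<comment> \<open>Any value of \<open>exp (2 * \<kappa> * T)\<close> strictly between 1 and 2 will do; the gap to 2 makes the
      continuity argument strict. The growth bound is needed up to norm \<open>2 * M\<close>.\<close>
    define T where "T = ln (3 / 2) / (2 * \<kappa>)"
    have T: "0 < T" "exp (2 * \<kappa> * T) = 3 / 2" using k by (simp_all add: T_def)
    show "\<exists>C>0. \<exists>T>0. \<forall>F \<in> {filtered_full chi A, filtered_nonlinear chi A}. \<forall>N\<ge>1.
        \<forall>U0::real ^ 'd \<Rightarrow> real ^ 'n. U0 \<in> Hs s \<and> Hs_norm s U0 \<le> M \<longrightarrow>
          (\<exists>I U. maximal_solution (F N) (sharp_filter N U0) s I U \<and>
             (\<forall>J V. maximal_solution (F N) (sharp_filter N U0) s J V \<longrightarrow>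
                J = I \<and> (\<forall>t\<in>I. V t = U t)) \<and>
             time_interval T (Hs_norm s U0) \<subseteq> I \<and>
             (\<forall>t \<in> time_interval T (Hs_norm s U0).
                Hs_norm s (U t) \<le> Hs_norm s U0 * exp (C * Hs_norm s U0 * t) \<and>
                Hs_norm s U0 * exp (C * Hs_norm s U0 * t) \<le> 2 * Hs_norm s U0) \<and>
             (\<forall>s'\<ge>s. C1_Hs s' I U))"
    proof (rule exI[of _ "2 * \<kappa>"], intro conjI exI[of _ T] ballI allI impI T(1))
      show "0 < 2 * \<kappa>" using k by simp
      fix F and N :: nat and U0 :: "real ^ 'd \<Rightarrow> real ^ 'n"
      assume hF: "F \<in> {filtered_full chi A, filtered_nonlinear chi A}" and hN: "1 \<le> N" and U0: "U0 \<in> Hs s \<and> Hs_norm s U0 \<le> M"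
      obtain P Q where "filtered_problem chi P Q N s (F N)" using fpex[OF hF hN] by blast
      then interpret filtered_problem chi P Q N s "F N" .
      let ?\<rho> = "Hs_norm s U0"
      have "\<exists>J V. classical_solution (F N) (sharp_filter N U0) s J V \<and> time_interval T ?\<rho> \<subseteq> J \<and>
        (\<forall>t\<in>time_interval T ?\<rho>. Hs_norm s (V t) \<le> ?\<rho> * exp (2 * \<kappa> * ?\<rho> * t))"
        by (rule controlled_solution[where M=M]) (use kG[OF hF hN, unfolded G_def] k T U0 in auto)
      then obtain J V where V: "classical_solution (F N) (sharp_filter N U0) s J V" "time_interval T ?\<rho> \<subseteq> J"
        "\<And>t. t \<in> time_interval T ?\<rho> \<Longrightarrow> Hs_norm s (V t) \<le> ?\<rho> * exp (2 * \<kappa> * ?\<rho> * t)" by blast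
      obtain I U where U: "maximal_solution (F N) (sharp_filter N U0) s I U"
        "\<forall>J V. maximal_solution (F N) (sharp_filter N U0) s J V \<longrightarrow> J = I \<and> (\<forall>t\<in>I. V t = U t)"
        "\<forall>J V. classical_solution (F N) (sharp_filter N U0) s J V \<longrightarrow> J \<subseteq> I \<and> (\<forall>t\<in>J. V t = U t)"
        using maximal_solution_of_classical[OF V(1)] by blast
      have cU: "classical_solution (F N) (sharp_filter N U0) s I U" using U(1) by (simp add: maximal_solution_def)
      have JI: "J \<subseteq> I" and VU: "\<And>t. t \<in> J \<Longrightarrow> V t = U t" using U(3) V(1) by blast+
      have "Hs_norm s (U t) \<le> ?\<rho> * exp (2 * \<kappa> * ?\<rho> * t) \<and> ?\<rho> * exp (2 * \<kappa> * ?\<rho> * t) \<le> 2 * ?\<rho>"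
        if t: "t \<in> time_interval T ?\<rho>" for t
      proof
        show "Hs_norm s (U t) \<le> ?\<rho> * exp (2 * \<kappa> * ?\<rho> * t)" using V(3)[OF t] VU t V(2) by auto
        show "?\<rho> * exp (2 * \<kappa> * ?\<rho> * t) \<le> 2 * ?\<rho>"
        proof (cases "?\<rho> = 0")
          case False
          then have p: "0 < ?\<rho>" using Hs_norm_nonneg[of s U0] by linarith
          then have "?\<rho> * t \<le> T" using t by (simp add: time_interval_def field_simps)
          then have "2 * \<kappa> * (?\<rho> * t) \<le> 2 * \<kappa> * T" using k by (intro mult_left_mono) auto
          then have "exp (2 * \<kappa> * ?\<rho> * t) \<le> exp (2 * \<kappa> * T)" by (simp add: mult.assoc)
          then have "exp (2 * \<kappa> * ?\<rho> * t) \<le> 2" using T(2) by linarith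
          then show ?thesis using p by simp
        qed simp
      qed
      then show "\<exists>I U. maximal_solution (F N) (sharp_filter N U0) s I U \<and>
             (\<forall>J V. maximal_solution (F N) (sharp_filter N U0) s J V \<longrightarrow>
                J = I \<and> (\<forall>t\<in>I. V t = U t)) \<and>
             time_interval T ?\<rho> \<subseteq> I \<and>
             (\<forall>t \<in> time_interval T ?\<rho>.
                Hs_norm s (U t) \<le> ?\<rho> * exp (2 * \<kappa> * ?\<rho> * t) \<and>
                ?\<rho> * exp (2 * \<kappa> * ?\<rho> * t) \<le> 2 * ?\<rho>) \<and>
             (\<forall>s'\<ge>s. C1_Hs s' I U)"
        using U(1,2) V(2) JI classical_C1[OF cU] by (intro exI[of _ I] exI[of _ U]) blast
    qed
  next
    fix s' Ms :: real assume s': "s \<le> s'" and Ms: "0 < Ms"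
    obtain \<kappa> where k: "\<kappa> > 0" and kG: "\<And>F N. F \<in> {filtered_full chi A, filtered_nonlinear chi A} \<Longrightarrow> 1 \<le> N \<Longrightarrow> G s' Ms \<kappa> N (F N)"
      using Gex[of s' Ms] Ms s1 s' by auto
    show "\<exists>Cstar>0. \<forall>F \<in> {filtered_full chi A, filtered_nonlinear chi A}. \<forall>N\<ge>1.
        \<forall>U0::real ^ 'd \<Rightarrow> real ^ 'n. U0 \<in> Hs s \<longrightarrow>
          (\<forall>I U. maximal_solution (F N) (sharp_filter N U0) s I U \<longrightarrow>
             (\<forall>Tstar\<in>I. 0 < Tstar \<and>
                (SUP t\<in>{0..Tstar}. Hs_enorm s (U t)) \<le> ennreal Ms \<longrightarrow>
                (\<forall>t\<in>{0..Tstar}. Hs_enorm s' (U t) \<le>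
                    Hs_enorm s' U0 * ennreal (exp (Cstar * Ms * t)))))"
    proof (intro exI[of _ \<kappa>] conjI k ballI allI impI)
      fix F and N :: nat and U0 :: "real ^ 'd \<Rightarrow> real ^ 'n" and I U Ts t
      assume hF: "F \<in> {filtered_full chi A, filtered_nonlinear chi A}" and hN: "1 \<le> N"
        and mU: "maximal_solution (F N) (sharp_filter N U0) s I U" and Ts: "Ts \<in> I"
        and sup: "0 < Ts \<and> (SUP t\<in>{0..Ts}. Hs_enorm s (U t)) \<le> ennreal Ms" and t: "t \<in> {0..Ts}"
      obtain P Q where "filtered_problem chi P Q N s (F N)" using fpex[OF hF hN] by blast
      then interpret filtered_problem chi P Q N s "F N" .
      have cU: "classical_solution (F N) (sharp_filter N U0) s I U" using mU by (simp add: maximal_solution_def)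
      note int = classical_interval[OF cU]
      have mem: "\<tau> \<in> I" if "\<tau> \<in> {0..Ts}" for \<tau> using mem_is_interval_1_I[OF int(2,3) Ts] that by simp
      have bound: "hnorm s K (fourier_coeff (U \<tau>)) \<le> Ms" if \<tau>: "\<tau> \<in> {0..Ts}" for \<tau>
      proof -
        have "Hs_enorm s (U \<tau>) \<le> (SUP t\<in>{0..Ts}. Hs_enorm s (U t))" by (rule SUP_upper[OF \<tau>])
        also have "\<dots> \<le> ennreal Ms" using sup by blast
        finally have "ennreal (Hs_norm s (U \<tau>)) \<le> ennreal Ms"
          using classical_Hs(1)[OF cU mem[OF \<tau>]] by (simp add: Hs_enorm_def)
        then have "Hs_norm s (U \<tau>) \<le> Ms" using Ms by (simp add: ennreal_le_iff)
        then show ?thesis by (simp add: classical_Hs(2)[OF cU mem[OF \<tau>]])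
      qed
      have sub: "\<tau> \<in> {0..Ts}" if "\<tau> \<in> {0..t}" for \<tau> using that t by auto
      have "hnorm s' K (fourier_coeff (U t)) \<le> hnorm s' K (fourier_coeff (U 0)) * exp (\<kappa> * Ms * t)"
        using kG[OF hF hN, unfolded G_def, rule_format, of t Ms "\<lambda>\<tau>. fourier_coeff (U \<tau>)"] t
          bound[OF sub] herm_fourier_coeff classical_coefficient_ode[OF cU mem[OF sub]] by auto
      then have le: "Hs_norm s' (U t) \<le> hnorm s' K (fourier_coeff (U 0)) * exp (\<kappa> * Ms * t)"
        by (simp add: classical_Hs(2)[OF cU mem[OF t]])
      have e: "Hs_enorm s' (U t) = ennreal (Hs_norm s' (U t))"
        using classical_Hs(1)[OF cU mem[OF t]] by (simp add: Hs_enorm_def)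
      show "Hs_enorm s' (U t) \<le> Hs_enorm s' U0 * ennreal (exp (\<kappa> * Ms * t))"
      proof (cases "U0 \<in> Hs s'")
        case True
        have "U 0 = sharp_filter N U0" using cU by (simp add: classical_solution_def)
        then have "hnorm s' K (fourier_coeff (U 0)) = hnorm s' K (fourier_coeff U0)"
          unfolding hnorm_def by (intro L2_set_cong) (simp_all add: sharp_filter_coefficients)
        also have "\<dots> \<le> Hs_norm s' U0" by (rule hnorm_sharp_le[OF True])
        finally have "hnorm s' K (fourier_coeff (U 0)) * exp (\<kappa> * Ms * t) \<le> Hs_norm s' U0 * exp (\<kappa> * Ms * t)"
          by (intro mult_right_mono) auto
        then have "ennreal (Hs_norm s' (U t)) \<le> ennreal (Hs_norm s' U0 * exp (\<kappa> * Ms * t))"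
          using le by (intro ennreal_leI) linarith
        then show ?thesis using True unfolding e by (simp add: Hs_enorm_def ennreal_mult)
      next
        case False
        then show ?thesis by (simp add: Hs_enorm_def ennreal_top_mult)
      qed
    qed
  qed
qed

end
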